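(* Let $l$ be a positive integer, $A=k^{\oplus l}$, $B=k^{\oplus 2}$, $R=A*B$, and let $V\subset\overline{A}\oplus\overline{B}$ be a linear subspace. Let $A(V)\subseteq A$ be the unital subalgebra generated by $V\cap\overline{A}$, and let $\{1,\dots,l\}=\bigcup_{j=1}^s I_j$ be the partition determined by $A(V)$. Then: (i) if $V\subseteq\overline{A}$, then $(V,R)^{ab}=R$; (ii) if $V\nsubseteq\overline{A}$ and $A(V)=A$, then $(V,R)^{ab}\cong A\otimes B$, and hence $\mathrm{mid}((V,R)^{ab})=1$; (iii) if $V\nsubseteq\overline{A}$ and $\max_j|I_j|=2$, then $\mathrm{mid}((V,R)^{ab})=2$; (iv) if $V\nsubseteq\overline{A}$ and $\max_j|I_j|>2$, then $\mathrm{mid}((V,R)^{ab})=\infty$.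
   Context: $k$ is an algebraically closed field of characteristic zero; all algebras are unital and associative; $A*B$ is the free product of unital $k$-algebras. Let $p_1,\dots,p_l$ and $q_1,q_2$ be the orthogonal primitive idempotents of $A$ and $B$, so $\sum_i p_i=1=q_1+q_2$. $\overline{A}\subset A$ is the span of $p_1,\dots,p_{l-1}$, and $\overline{B}\subset B$ is the span of $q_1$; $\overline{A}\oplus\overline{B}$ is regarded as a subspace of $A*B$. Any unital subalgebra $A'\subseteq A$ is isomorphic to $k^{\oplus s}$ for some $s$ and has a basis of idempotents $P_j=\sum_{i\in I_j}p_i$, $j=1,\dots,s$, for a unique partition $\{1,\dots,l\}=\bigcup_{j=1}^sI_j$ into disjoint nonempty sets; this is the partition determined by $A'$. For a subspace $V\subset\overline{A}\oplus\overline{B}$, $R(V)\subset R$ denotes the unital subalgebra generated by $V$ and $(V,R)^{ab}$ is the quotient of $R$ by the two-sided ideal generated by $[R(V),R(V)]$. For an algebra $S$, $\mathrm{mid}(S)\in\mathbb{N}\cup\{\infty\}$ is the maximal dimension (supremum) of (finite-dimensional) irreducible representations of $S$ over $k$. *)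

theory Defs
  imports
    "HOL-Algebra.Algebraic_Closure_Type"
    "HOL-Library.Extended_Nat"
    "HOL-Library.Poly_Mapping"
    "Jordan_Normal_Form.Matrix"
begin

text \<open>
  A unital associative algebra over the field given by the type \<open>'k\<close> is a record of type
  \<open>('k, 'a) module\<close>: its ring fields carry the (in general non-commutative) ring structure and
  \<open>smult\<close> the scalar multiplication.  The record type is used without the library
  locale \<open>algebra\<close>, which is restricted to commutative algebras.
\<close>

subsection \<open>Subspaces, subalgebras, homomorphisms\<close>

definition lin_subspace :: "('k::field, 'a) module \<Rightarrow> 'a set \<Rightarrow> bool" where
  "lin_subspace S W \<longleftrightarrow> submodule W (ring_of_type_algebra :: 'k ring) S"

definition lin_span :: "('k::field, 'a) module \<Rightarrow> 'a set \<Rightarrow> 'a set" where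
  "lin_span S G = lin_subspace S hull G"

definition unital_subalgebra :: "('k::field, 'a) module \<Rightarrow> 'a set \<Rightarrow> bool" where
  "unital_subalgebra S W \<longleftrightarrow> subring W S \<and> lin_subspace S W"

definition subalgebra_gen :: "('k::field, 'a) module \<Rightarrow> 'a set \<Rightarrow> 'a set" where
  "subalgebra_gen S G = unital_subalgebra S hull G"

definition alg_hom :: "('k::field, 'a) module \<Rightarrow> ('k, 'b) module \<Rightarrow> ('a \<Rightarrow> 'b) set" where
  "alg_hom S T = {h \<in> Ring.ring_hom S T. \<forall>c. \<forall>x\<in>carrier S. h (c \<odot>\<^bsub>S\<^esub> x) = c \<odot>\<^bsub>T\<^esub> h x}"

definition alg_iso :: "('k::field, 'a) module \<Rightarrow> ('k, 'b) module \<Rightarrow> ('a \<Rightarrow> 'b) set" where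
  "alg_iso S T = {h \<in> alg_hom S T. bij_betw h (carrier S) (carrier T)}"


subsection \<open>Quotients by two-sided ideals\<close>

definition quot_algebra :: "('k::field, 'a) module \<Rightarrow> 'a set \<Rightarrow> ('k, 'a set) module" where
  "quot_algebra S I =
     ring.extend (S Quot I) (module.fields (\<lambda>c C. \<Union>x\<in>C. I +>\<^bsub>S\<^esub> (c \<odot>\<^bsub>S\<^esub> x)))"


subsection \<open>Monoid algebras and free algebras\<close>

text \<open>The algebra of finite formal linear combinations of elements of a monoid.\<close>

definition monoid_algebra :: "('g, 'm) monoid_scheme \<Rightarrow> ('k::field, 'g \<Rightarrow>\<^sub>0 'k) module" where
  "monoid_algebra G =
     \<lparr>carrier = {f. Poly_Mapping.keys f \<subseteq> carrier G},
      monoid.mult = (\<lambda>f g. \<Sum>u\<in>Poly_Mapping.keys f. \<Sum>v\<in>Poly_Mapping.keys g.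
                Poly_Mapping.single (u \<otimes>\<^bsub>G\<^esub> v) (Poly_Mapping.lookup f u * Poly_Mapping.lookup g v)),
      monoid.one = Poly_Mapping.single \<one>\<^bsub>G\<^esub> 1,
      ring.zero = 0,
      ring.add = (+),
      module.smult = (\<lambda>c. Poly_Mapping.map ((*) c))\<rparr>"

definition word_monoid :: "'x set \<Rightarrow> 'x list monoid" where
  "word_monoid G = \<lparr>carrier = lists G, monoid.mult = (@), monoid.one = []\<rparr>"

definition free_algebra :: "'x set \<Rightarrow> ('k::field, 'x list \<Rightarrow>\<^sub>0 'k) module" where
  "free_algebra G = monoid_algebra (word_monoid G)"

definition generator :: "'x \<Rightarrow> 'x list \<Rightarrow>\<^sub>0 'k::field" where
  "generator x = Poly_Mapping.single [x] 1"


subsection \<open>Free product of unital algebras\<close>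

text \<open>
  The relations in \<open>F\<close> that turn a map \<open>\<phi>\<close> from \<open>S\<close> to \<open>F\<close> into a homomorphism of unital algebras.
\<close>

definition hom_relations ::
  "('k::field, 'a) module \<Rightarrow> ('k, 'f) module \<Rightarrow> ('a \<Rightarrow> 'f) \<Rightarrow> 'f set" where
  "hom_relations S F \<phi> =
     {\<phi> (x \<oplus>\<^bsub>S\<^esub> y) \<ominus>\<^bsub>F\<^esub> (\<phi> x \<oplus>\<^bsub>F\<^esub> \<phi> y) | x y. x \<in> carrier S \<and> y \<in> carrier S} \<union>
     {\<phi> (c \<odot>\<^bsub>S\<^esub> x) \<ominus>\<^bsub>F\<^esub> (c \<odot>\<^bsub>F\<^esub> \<phi> x) | c x. x \<in> carrier S} \<union>
     {\<phi> (x \<otimes>\<^bsub>S\<^esub> y) \<ominus>\<^bsub>F\<^esub> (\<phi> x \<otimes>\<^bsub>F\<^esub> \<phi> y) | x y. x \<in> carrier S \<and> y \<in> carrier S} \<union>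
     {\<phi> \<one>\<^bsub>S\<^esub> \<ominus>\<^bsub>F\<^esub> \<one>\<^bsub>F\<^esub>}"

text \<open>
  The coproduct of unital algebras: the free algebra on the disjoint union of the two
  underlying sets, modulo the relations that make both inclusions unital homomorphisms.
\<close>

definition free_product_gens ::
  "('k::field, 'a) module \<Rightarrow> ('k, 'b) module \<Rightarrow> ('k, ('a + 'b) list \<Rightarrow>\<^sub>0 'k) module" where
  "free_product_gens A B = free_algebra (carrier A <+> carrier B)"

definition free_product_ideal ::
  "('k::field, 'a) module \<Rightarrow> ('k, 'b) module \<Rightarrow> (('a + 'b) list \<Rightarrow>\<^sub>0 'k) set" where
  "free_product_ideal A B =
     Idl\<^bsub>free_product_gens A B\<^esub>
       (hom_relations A (free_product_gens A B) (\<lambda>a. generator (Inl a)) \<union>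
        hom_relations B (free_product_gens A B) (\<lambda>b. generator (Inr b)))"

definition free_product ::
  "('k::field, 'a) module \<Rightarrow> ('k, 'b) module \<Rightarrow> ('k, (('a + 'b) list \<Rightarrow>\<^sub>0 'k) set) module" where
  "free_product A B = quot_algebra (free_product_gens A B) (free_product_ideal A B)"

definition free_product_inl ::
  "('k::field, 'a) module \<Rightarrow> ('k, 'b) module \<Rightarrow> 'a \<Rightarrow> (('a + 'b) list \<Rightarrow>\<^sub>0 'k) set" where
  "free_product_inl A B a = free_product_ideal A B +>\<^bsub>free_product_gens A B\<^esub> generator (Inl a)"

definition free_product_inr ::
  "('k::field, 'a) module \<Rightarrow> ('k, 'b) module \<Rightarrow> 'b \<Rightarrow> (('a + 'b) list \<Rightarrow>\<^sub>0 'k) set" where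
  "free_product_inr A B b = free_product_ideal A B +>\<^bsub>free_product_gens A B\<^esub> generator (Inr b)"


subsection \<open>Tensor product of algebras\<close>

text \<open>
  The vector space with basis \<open>A \<times> B\<close> modulo the bilinearity relations.  The multiplication
  \<open>(a \<otimes> b) (a' \<otimes> b') = a a' \<otimes> b b'\<close> is that of the monoid algebra of the direct product of the
  multiplicative monoids; the span of the bilinearity relations is a two-sided ideal there.
\<close>

definition tensor_relations ::
  "('k::field, 'a) module \<Rightarrow> ('k, 'b) module \<Rightarrow> ('a \<times> 'b \<Rightarrow>\<^sub>0 'k) set" where
  "tensor_relations A B =
     (let F = (monoid_algebra (A \<times>\<times> B) :: ('k, 'a \<times> 'b \<Rightarrow>\<^sub>0 'k) module);
          t = (\<lambda>a b. Poly_Mapping.single (a, b) (1 :: 'k))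
      in {t (a \<oplus>\<^bsub>A\<^esub> a') b \<ominus>\<^bsub>F\<^esub> (t a b \<oplus>\<^bsub>F\<^esub> t a' b) | a a' b.
            a \<in> carrier A \<and> a' \<in> carrier A \<and> b \<in> carrier B} \<union>
         {t a (b \<oplus>\<^bsub>B\<^esub> b') \<ominus>\<^bsub>F\<^esub> (t a b \<oplus>\<^bsub>F\<^esub> t a b') | a b b'.
            a \<in> carrier A \<and> b \<in> carrier B \<and> b' \<in> carrier B} \<union>
         {t (c \<odot>\<^bsub>A\<^esub> a) b \<ominus>\<^bsub>F\<^esub> (c \<odot>\<^bsub>F\<^esub> t a b) | c a b. a \<in> carrier A \<and> b \<in> carrier B} \<union>
         {t a (c \<odot>\<^bsub>B\<^esub> b) \<ominus>\<^bsub>F\<^esub> (c \<odot>\<^bsub>F\<^esub> t a b) | c a b. a \<in> carrier A \<and> b \<in> carrier B})"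

definition tensor_algebra ::
  "('k::field, 'a) module \<Rightarrow> ('k, 'b) module \<Rightarrow> ('k, ('a \<times> 'b \<Rightarrow>\<^sub>0 'k) set) module" where
  "tensor_algebra A B =
     quot_algebra (monoid_algebra (A \<times>\<times> B)) (Idl\<^bsub>monoid_algebra (A \<times>\<times> B)\<^esub> (tensor_relations A B))"


subsection \<open>Partial abelianization\<close>

definition commutator_ideal :: "'a set \<Rightarrow> ('k::field, 'a) module \<Rightarrow> 'a set" where
  "commutator_ideal V S =
     Idl\<^bsub>S\<^esub> {x \<otimes>\<^bsub>S\<^esub> y \<ominus>\<^bsub>S\<^esub> y \<otimes>\<^bsub>S\<^esub> x | x y. x \<in> subalgebra_gen S V \<and> y \<in> subalgebra_gen S V}"

definition partial_ab :: "'a set \<Rightarrow> ('k::field, 'a) module \<Rightarrow> ('k, 'a set) module" where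
  "partial_ab V S = quot_algebra S (commutator_ideal V S)"


subsection \<open>Irreducible representations\<close>

definition mat_algebra :: "nat \<Rightarrow> ('k::field, 'k mat) module" where
  "mat_algebra n = ring_mat TYPE('k) n (module.fields (\<cdot>\<^sub>m))"

text \<open>Representations of dimension \<open>n\<close> act on the space of column vectors of length \<open>n\<close>.\<close>

definition irreducible_rep :: "('k::field, 'a) module \<Rightarrow> nat \<Rightarrow> ('a \<Rightarrow> 'k mat) \<Rightarrow> bool" where
  "irreducible_rep S n \<rho> \<longleftrightarrow>
     n > 0 \<and> \<rho> \<in> alg_hom S (mat_algebra n) \<and>
     (\<forall>W. lin_subspace (module_vec TYPE('k) n) W \<and>
          (\<forall>x\<in>carrier S. \<forall>w\<in>W. \<rho> x *\<^sub>v w \<in> W) \<longrightarrow>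
          W = {0\<^sub>v n} \<or> W = carrier_vec n)"

definition mid :: "('k::field, 'a) module \<Rightarrow> enat" where
  "mid S = Sup {enat n | n. \<exists>\<rho>. irreducible_rep S n \<rho>}"


subsection \<open>The algebras \<open>k\<^sup>n\<close> and their subalgebras\<close>

text \<open>Elements are functions supported on \<open>{1..n}\<close>, with pointwise operations.\<close>

definition field_power :: "nat \<Rightarrow> ('k::field, nat \<Rightarrow> 'k) module" where
  "field_power n =
     \<lparr>carrier = {f. \<forall>i. i \<notin> {1..n} \<longrightarrow> f i = 0},
      monoid.mult = (\<lambda>f g i. f i * g i),
      monoid.one = (\<lambda>i. if i \<in> {1..n} then 1 else 0),
      ring.zero = (\<lambda>i. 0),
      ring.add = (\<lambda>f g i. f i + g i),
      module.smult = (\<lambda>c f i. c * f i)\<rparr>"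

definition prim_idem :: "nat \<Rightarrow> nat \<Rightarrow> 'k::field" where
  "prim_idem i = (\<lambda>j. if j = i then 1 else 0)"

text \<open>
  \<open>I 1, \<dots>, I s\<close> is the partition of \<open>{1..n}\<close> determined by the unital subalgebra \<open>S\<close> of \<open>k\<^sup>n\<close>:
  the idempotents \<open>P\<^sub>j = (\<Sum>i\<in>I j. p\<^sub>i)\<close> form a basis of \<open>S\<close>.  Their linear independence is
  automatic, as the sets \<open>I j\<close> are nonempty and disjoint.
\<close>

definition determines_partition ::
  "nat \<Rightarrow> (nat \<Rightarrow> 'k::field) set \<Rightarrow> nat \<Rightarrow> (nat \<Rightarrow> nat set) \<Rightarrow> bool" where
  "determines_partition n S s I \<longleftrightarrow>
     (\<forall>j\<in>{1..s}. I j \<noteq> {}) \<and> disjoint_family_on I {1..s} \<and> (\<Union>j\<in>{1..s}. I j) = {1..n} \<and>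
     S = lin_span (field_power n) {\<Oplus>\<^bsub>field_power n\<^esub>i\<in>I j. prim_idem i | j. j \<in> {1..s}}"

end

(*
  If V is not contained in Abar, it is spanned by its intersection with Abar and a single element
  a_0 + q_1.  As A is commutative, the commutators of R(V) then generate the same two-sided ideal
  as those of A(V) with q_1, so (V,R)^ab is k^l * k^2 with A(V) made to commute with q_1.

  The central idempotents P_j act on an irreducible representation as scalars, hence exactly one
  of them acts as 1, and only the p_i with i in I_j act nontrivially.  If |I_j| <= 2, what remains
  is a pair of idempotents p, q; as (p - q)^2 is central, span(v, qv) is invariant for every v with
  pv = v.  Conversely, an idempotent matrix and a labelling of the basis vectors by elements of I_j
  define a representation, and for |I_j| >= 3 there are irreducible ones of every dimension 3m.
*)

theory Submission
  imports Defs "Jordan_Normal_Form.Char_Poly"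
begin

section \<open>Unital algebras and their quotients\<close>

text \<open>The threshold between classes of two and of three elements is visible in the corner cut
  out by q. On the image of q, the compressions q p_i q for i in one class are operators whose only
  constraint is that they sum to 1. Two of them are S and 1 - S, which commute, so nothing beyond
  dimension two survives; three are S, T and 1 - S - T with S and T arbitrary. \<open>idem3\<close>
  is built backwards from this: given S and T on k^m, it is an idempotent on k^(3m) that has them as
  compressions.

  Since the algebras are given by generators and relations, no normal form of their elements is
  used. Each algebra enters through two facts: how to map out of it, and which elements generate it.
  Generation is stated as an induction rule: a unital subalgebra that contains the generators is
  everything. Commutation, equality of homomorphisms and invariance of a subspace are therefore each
  shown to cut out a subalgebra and are then tested on generators.\<close>

locale unital_algebra = ring S for S :: "('k::field, 'a) module" (structure) +
  assumes smult_closed [simp, intro]: "x \<in> carrier S \<Longrightarrow> c \<odot> x \<in> carrier S"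
    and smult_l_distr: "x \<in> carrier S \<Longrightarrow> (c + d) \<odot> x = c \<odot> x \<oplus> d \<odot> x"
    and smult_r_distr: "x \<in> carrier S \<Longrightarrow> y \<in> carrier S \<Longrightarrow> c \<odot> (x \<oplus> y) = c \<odot> x \<oplus> c \<odot> y"
    and smult_assoc: "x \<in> carrier S \<Longrightarrow> (c * d) \<odot> x = c \<odot> (d \<odot> x)"
    and smult_one [simp]: "x \<in> carrier S \<Longrightarrow> 1 \<odot> x = x"
    and smult_mult_left: "x \<in> carrier S \<Longrightarrow> y \<in> carrier S \<Longrightarrow> (c \<odot> x) \<otimes> y = c \<odot> (x \<otimes> y)"
    and smult_mult_right: "x \<in> carrier S \<Longrightarrow> y \<in> carrier S \<Longrightarrow> x \<otimes> (c \<odot> y) = c \<odot> (x \<otimes> y)"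
begin

lemma smult_zero_left [simp]: "x \<in> carrier S \<Longrightarrow> 0 \<odot> x = \<zero>"
  using smult_l_distr[of x 0 0] add.r_cancel_one'[of "0 \<odot> x" "0 \<odot> x"] by simp

lemma smult_zero_right [simp]: "c \<odot> \<zero> = \<zero>"
  using smult_r_distr[of \<zero> \<zero> c] add.r_cancel_one'[of "c \<odot> \<zero>" "c \<odot> \<zero>"] by simp

lemma a_inv_smult: "x \<in> carrier S \<Longrightarrow> \<ominus> x = (- 1) \<odot> x"
  using smult_l_distr[of x 1 "- 1"] minus_equality[of "(- 1) \<odot> x" x] by (simp add: a_comm)

text \<open>Negation is multiplication by -1, so the additive subgroup inside
  \<open>submodule\<close> reduces to closure under sums and scalars.\<close>

lemma lin_subspace_iff:
  "lin_subspace S W \<longleftrightarrow> W \<subseteq> carrier S \<and> \<zero> \<in> W \<and>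
     (\<forall>x\<in>W. \<forall>y\<in>W. x \<oplus> y \<in> W) \<and> (\<forall>c. \<forall>x\<in>W. c \<odot> x \<in> W)"
proof -
  have "\<ominus> x \<in> W" if "W \<subseteq> carrier S" "\<forall>c. \<forall>x\<in>W. c \<odot> x \<in> W" "x \<in> W" for x
    using that a_inv_smult by (metis subsetD)
  then show ?thesis
    unfolding lin_subspace_def submodule_def submodule_axioms_def subgroup_def ring_of_type_algebra_def
    by (auto simp flip: a_inv_def)
qed

text \<open>Zero and negatives arise from the scalars 0 and -1, so the unit and three closure
  conditions suffice. Subalgebras are verified in this form from here on.\<close>

lemma unital_subalgebra_iff:
  "unital_subalgebra S W \<longleftrightarrow> W \<subseteq> carrier S \<and> \<one> \<in> W \<and>
     (\<forall>x\<in>W. \<forall>y\<in>W. x \<oplus> y \<in> W) \<and> (\<forall>x\<in>W. \<forall>y\<in>W. x \<otimes> y \<in> W) \<and> (\<forall>c. \<forall>x\<in>W. c \<odot> x \<in> W)"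
proof
  assume "unital_subalgebra S W"
  then show "W \<subseteq> carrier S \<and> \<one> \<in> W \<and>
     (\<forall>x\<in>W. \<forall>y\<in>W. x \<oplus> y \<in> W) \<and> (\<forall>x\<in>W. \<forall>y\<in>W. x \<otimes> y \<in> W) \<and> (\<forall>c. \<forall>x\<in>W. c \<odot> x \<in> W)"
    unfolding unital_subalgebra_def lin_subspace_iff
    using subringE by fastforce
next
  assume *: "W \<subseteq> carrier S \<and> \<one> \<in> W \<and>
     (\<forall>x\<in>W. \<forall>y\<in>W. x \<oplus> y \<in> W) \<and> (\<forall>x\<in>W. \<forall>y\<in>W. x \<otimes> y \<in> W) \<and> (\<forall>c. \<forall>x\<in>W. c \<odot> x \<in> W)"
  then have z: "\<zero> \<in> W" using smult_zero_left[of \<one>] by (metis one_closed)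
  then have "lin_subspace S W" using * by (simp add: lin_subspace_iff)
  moreover have "subring W S"
    using * a_inv_smult by (intro subringI) (auto simp: subset_iff)
  ultimately show "unital_subalgebra S W" by (simp add: unital_subalgebra_def)
qed

text \<open>Scaling by c is multiplication by the ring element \<open>c \<odot> \<one>\<close>, so
  an ideal of a unital algebra is automatically a subspace. This makes the scalar multiplication of
  the quotient well defined.\<close>

lemma ideal_smult_closed:
  assumes "ideal I S" "x \<in> I" shows "c \<odot> x \<in> I"
proof -
  interpret ideal I S by fact
  have "c \<odot> x = (c \<odot> \<one>) \<otimes> x" using a_subset assms(2) by (auto simp: smult_mult_left)
  then show ?thesis using assms(2) by (simp add: I_l_closed)
qed

lemma unital_subalgebra_carrier: "unital_subalgebra S (carrier S)"
  by (simp add: unital_subalgebra_iff)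

lemma lin_subspace_carrier: "lin_subspace S (carrier S)"
  by (simp add: lin_subspace_iff)

text \<open>The hull is the intersection of all subalgebras containing \<open>G\<close>; the carrier
  is one of them, which keeps the intersection inside the carrier.\<close>

lemma subalgebra_gen_subalgebra:
  assumes "G \<subseteq> carrier S" shows "unital_subalgebra S (subalgebra_gen S G)"
  using unital_subalgebra_carrier assms
  unfolding subalgebra_gen_def hull_def unital_subalgebra_iff by (auto 0 3)

lemma lin_span_subspace:
  assumes "G \<subseteq> carrier S" shows "lin_subspace S (lin_span S G)"
  using lin_subspace_carrier assms
  unfolding lin_span_def hull_def lin_subspace_iff by (auto 0 3)

text \<open>Makes commutation testable on generators: a generated subalgebra lies in a centralizer
  as soon as its generators do.\<close>

lemma unital_subalgebra_centralizer:
  assumes "G \<subseteq> carrier S"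
  shows "unital_subalgebra S {x \<in> carrier S. \<forall>y\<in>G. x \<otimes> y = y \<otimes> x}"
  using assms unfolding unital_subalgebra_iff
  by (auto simp: l_distr r_distr smult_mult_left smult_mult_right subset_iff m_assoc)
     (metis m_assoc)

end

lemma subalgebra_gen_least:
  assumes "unital_subalgebra S W" "G \<subseteq> W" shows "subalgebra_gen S G \<subseteq> W"
  using assms unfolding subalgebra_gen_def by (rule hull_minimal[rotated])

lemma subalgebra_gen_superset: "G \<subseteq> subalgebra_gen S G"
  unfolding subalgebra_gen_def by (rule hull_subset)

lemma lin_span_least:
  assumes "lin_subspace S W" "G \<subseteq> W" shows "lin_span S G \<subseteq> W"
  using assms unfolding lin_span_def by (rule hull_minimal[rotated])

lemma lin_span_superset: "G \<subseteq> lin_span S G"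
  unfolding lin_span_def by (rule hull_subset)

section \<open>Homomorphisms of algebras and the subalgebras and ideals they cut out\<close>

lemma alg_hom_iff:
  "h \<in> alg_hom S T \<longleftrightarrow>
     (\<forall>x\<in>carrier S. h x \<in> carrier T) \<and>
     (\<forall>x\<in>carrier S. \<forall>y\<in>carrier S. h (x \<otimes>\<^bsub>S\<^esub> y) = h x \<otimes>\<^bsub>T\<^esub> h y) \<and>
     (\<forall>x\<in>carrier S. \<forall>y\<in>carrier S. h (x \<oplus>\<^bsub>S\<^esub> y) = h x \<oplus>\<^bsub>T\<^esub> h y) \<and>
     h \<one>\<^bsub>S\<^esub> = \<one>\<^bsub>T\<^esub> \<and> (\<forall>c. \<forall>x\<in>carrier S. h (c \<odot>\<^bsub>S\<^esub> x) = c \<odot>\<^bsub>T\<^esub> h x)"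
  unfolding alg_hom_def Ring.ring_hom_def by auto

lemma alg_hom_comp:
  "f \<in> alg_hom S T \<Longrightarrow> g \<in> alg_hom T U \<Longrightarrow> (\<lambda>x. g (f x)) \<in> alg_hom S U"
  unfolding alg_hom_iff by auto

lemma alg_hom_zero:
  assumes "unital_algebra S" "unital_algebra T" "h \<in> alg_hom S T" shows "h \<zero>\<^bsub>S\<^esub> = \<zero>\<^bsub>T\<^esub>"
proof -
  interpret S: unital_algebra S by fact
  interpret T: unital_algebra T by fact
  show ?thesis using assms(3) S.smult_zero_left[of "\<zero>\<^bsub>S\<^esub>"] unfolding alg_hom_iff
    by (metis S.zero_closed T.smult_zero_left)
qed

lemma alg_hom_minus:
  assumes "unital_algebra S" "unital_algebra T" "h \<in> alg_hom S T" "x \<in> carrier S" "y \<in> carrier S"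
  shows "h (x \<ominus>\<^bsub>S\<^esub> y) = h x \<ominus>\<^bsub>T\<^esub> h y"
proof -
  interpret S: unital_algebra S by fact
  interpret T: unital_algebra T by fact
  show ?thesis using assms(3-) unfolding alg_hom_iff
    by (simp add: S.minus_eq T.minus_eq S.a_inv_smult T.a_inv_smult)
qed

lemma unital_subalgebra_vimage:
  assumes "unital_algebra S" "unital_algebra T" "h \<in> alg_hom S T" "unital_subalgebra T W"
  shows "unital_subalgebra S {x \<in> carrier S. h x \<in> W}"
  using assms(3,4) unfolding unital_algebra.unital_subalgebra_iff[OF assms(1)]
    unital_algebra.unital_subalgebra_iff[OF assms(2)] alg_hom_iff
  using unital_algebra.axioms(1)[OF assms(1)] unital_algebra.smult_closed[OF assms(1)]
  by (auto simp: ring.ring_simprules)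

text \<open>Used to show that two composites are identities: it is then enough that they fix the
  generators.\<close>

lemma unital_subalgebra_equalizer:
  assumes "unital_algebra S" "f \<in> alg_hom S T" "g \<in> alg_hom S T"
  shows "unital_subalgebra S {x \<in> carrier S. f x = g x}"
  using assms(2,3) unfolding unital_algebra.unital_subalgebra_iff[OF assms(1)] alg_hom_iff
  using unital_algebra.axioms(1)[OF assms(1)] unital_algebra.smult_closed[OF assms(1)]
  by (auto simp: ring.ring_simprules)

lemma alg_hom_kernel_ideal:
  assumes "unital_algebra S" "unital_algebra T" "h \<in> alg_hom S T"
  shows "ideal {x \<in> carrier S. h x = \<zero>\<^bsub>T\<^esub>} S"
proof -
  interpret S: unital_algebra S by fact
  interpret T: unital_algebra T by fact
  have "h \<in> Ring.ring_hom S T" using assms(3) by (simp add: alg_hom_def)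
  then interpret ring_hom_ring S T h
    by (intro ring_hom_ringI2 S.ring_axioms T.ring_axioms)
  show ?thesis using kernel_is_ideal unfolding a_kernel_def' .
qed

lemma alg_iso_if_inverse:
  assumes f: "f \<in> alg_hom S T" and g: "g \<in> alg_hom T S"
    and gf: "\<And>x. x \<in> carrier S \<Longrightarrow> g (f x) = x" and fg: "\<And>y. y \<in> carrier T \<Longrightarrow> f (g y) = y"
  shows "f \<in> alg_iso S T"
proof -
  have "bij_betw f (carrier S) (carrier T)"
    using f g gf fg by (intro bij_betwI[of _ _ _ g]) (auto simp: alg_hom_iff)
  then show ?thesis using f by (simp add: alg_iso_def)
qed

section \<open>Quotient algebras and their universal property\<close>

locale unital_algebra_ideal = unital_algebra S + ideal I S
  for S :: "('k::field, 'a) module" (structure) and I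
begin

lemma coset_eq_iff:
  assumes "x \<in> carrier S" "y \<in> carrier S"
  shows "I +> x = I +> y \<longleftrightarrow> x \<ominus> y \<in> I"
  using assms quotient_eq_iff_same_a_r_cos[OF is_ideal] by simp

lemma quot_carrier: "carrier (quot_algebra S I) = (\<lambda>x. I +> x) ` carrier S"
  unfolding quot_algebra_def by (auto simp: ring.defs FactRing_simps)

lemma quot_coset_closed: "x \<in> carrier S \<Longrightarrow> I +> x \<in> carrier (quot_algebra S I)"
  by (simp add: quot_carrier)

lemma quot_mult:
  "x \<in> carrier S \<Longrightarrow> y \<in> carrier S \<Longrightarrow>
    (I +> x) \<otimes>\<^bsub>quot_algebra S I\<^esub> (I +> y) = I +> (x \<otimes> y)"
  unfolding quot_algebra_def by (simp add: ring.defs FactRing_simps rcoset_mult_add)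

lemma quot_add:
  "x \<in> carrier S \<Longrightarrow> y \<in> carrier S \<Longrightarrow>
    (I +> x) \<oplus>\<^bsub>quot_algebra S I\<^esub> (I +> y) = I +> (x \<oplus> y)"
  unfolding quot_algebra_def by (simp add: ring.defs FactRing_simps a_rcos_sum)

lemma quot_one: "\<one>\<^bsub>quot_algebra S I\<^esub> = I +> \<one>"
  unfolding quot_algebra_def by (simp add: ring.defs FactRing_simps)

lemma quot_zero: "\<zero>\<^bsub>quot_algebra S I\<^esub> = I +> \<zero>"
  unfolding quot_algebra_def by (simp add: ring.defs FactRing_simps a_coset_add_zero a_subset)

text \<open>The scalar multiple is defined as a union over all representatives of the coset.
  Differences of representatives stay in the ideal after scaling, so all members of that union are
  the same coset.\<close>

lemma quot_smult:
  assumes x: "x \<in> carrier S"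
  shows "c \<odot>\<^bsub>quot_algebra S I\<^esub> (I +> x) = I +> (c \<odot> x)"
proof -
  have "I +> (c \<odot> z) = I +> (c \<odot> x)" if z: "z \<in> I +> x" for z
  proof -
    have zc: "z \<in> carrier S" using z x a_r_coset_subset_G a_subset by blast
    have "I +> z = I +> x" using a_repr_independence[OF z x a_subgroup] by simp
    then have "z \<ominus> x \<in> I" using coset_eq_iff zc x by simp
    then have "c \<odot> (z \<ominus> x) \<in> I" by (rule ideal_smult_closed[OF is_ideal])
    moreover have "c \<odot> (z \<ominus> x) = c \<odot> z \<ominus> c \<odot> x"
      using zc x by (simp add: minus_eq smult_r_distr a_inv_smult flip: smult_assoc)
    ultimately show ?thesis using coset_eq_iff zc x by simp
  qed
  then have "(\<Union>z\<in>I +> x. I +> (c \<odot> z)) = (\<Union>z\<in>I +> x. I +> (c \<odot> x))"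
    by (rule SUP_cong[OF refl])
  also have "\<dots> = I +> (c \<odot> x)" using a_rcos_self[OF x] by blast
  finally show ?thesis
    unfolding quot_algebra_def by (simp add: ring.defs module.defs)
qed

lemmas quot_simps = quot_coset_closed quot_mult quot_add quot_one quot_zero quot_smult

lemma quot_unital_algebra: "unital_algebra (quot_algebra S I)"
proof -
  have "ring (quot_algebra S I)"
  proof -
    have r: "ring (S Quot I)" by (rule quotient_is_ring)
    show ?thesis
      using ring.ring_simprules(1-)[OF r]
    proof (intro ringI abelian_groupI monoidI, goal_cases)
      \<comment> \<open>The sixth goal is the existence of additive inverses, the only ring axiom
        that asks for a witness.\<close>
      case (6 x)
      then obtain a where a: "a \<in> carrier S" "x = I +> a" by (auto simp: quot_carrier)
      then show ?case
        by (intro bexI[of _ "I +> (\<ominus> a)"]) (auto simp: quot_simps l_neg)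
    qed (auto simp: quot_carrier quot_simps ring_simprules)
  qed
  then show ?thesis
    by (auto intro!: unital_algebra.intro unital_algebra_axioms.intro
        simp: quot_carrier quot_simps smult_l_distr smult_r_distr smult_assoc smult_mult_left smult_mult_right)
qed

lemma quot_proj_hom: "(\<lambda>x. I +> x) \<in> alg_hom S (quot_algebra S I)"
  by (simp add: alg_hom_iff quot_simps)

lemma quot_lift:
  assumes T: "unital_algebra T" and h: "h \<in> alg_hom S T" and ker: "\<And>x. x \<in> I \<Longrightarrow> h x = \<zero>\<^bsub>T\<^esub>"
  obtains g where "g \<in> alg_hom (quot_algebra S I) T" "\<And>x. x \<in> carrier S \<Longrightarrow> g (I +> x) = h x"
proof -
  interpret T: unital_algebra T by fact
  \<comment> \<open>\<open>h\<close> is constant on every coset because it kills \<open>I\<close>,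
    so the image of a coset is a singleton and no representative has to be chosen.\<close>
  define g where "g C = the_elem (h ` C)" for C
  have g: "g (I +> x) = h x" if x: "x \<in> carrier S" for x
  proof -
    have "h z = h x" if z: "z \<in> I +> x" for z
    proof -
      have zc: "z \<in> carrier S" using z x a_r_coset_subset_G a_subset by blast
      have "I +> z = I +> x" using a_repr_independence[OF z x a_subgroup] by simp
      then have "h (z \<ominus> x) = \<zero>\<^bsub>T\<^esub>" using coset_eq_iff zc x ker by simp
      then have "h z \<ominus>\<^bsub>T\<^esub> h x = \<zero>\<^bsub>T\<^esub>"
        using alg_hom_minus[OF unital_algebra_axioms T h zc x] by simp
      then show ?thesis using h zc x by (simp add: alg_hom_iff)
    qed
    then have "h ` (I +> x) = {h x}" using a_rcos_self[OF x] by blast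
    then show ?thesis by (simp add: g_def)
  qed
  have "g \<in> alg_hom (quot_algebra S I) T"
    using h unfolding alg_hom_iff by (auto simp: quot_carrier quot_simps g)
  then show thesis using g that by blast
qed

text \<open>The preimage of \<open>W\<close> under the projection is a subalgebra containing
  \<open>G\<close>, hence everything. Generation is a rule on subalgebras, so it passes to the
  quotient without any description of the elements.\<close>

lemma quot_generated:
  assumes W: "unital_subalgebra (quot_algebra S I) W"
    and G: "\<And>W. unital_subalgebra S W \<Longrightarrow> G \<subseteq> W \<Longrightarrow> W = carrier S"
    and sub: "G \<subseteq> carrier S" "\<And>x. x \<in> G \<Longrightarrow> I +> x \<in> W"
  shows "W = carrier (quot_algebra S I)"
proof -
  have "{x \<in> carrier S. I +> x \<in> W} = carrier S"
    using sub by (intro G unital_subalgebra_vimage[OF _ quot_unital_algebra quot_proj_hom W]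
      unital_algebra_axioms) auto
  then have "carrier (quot_algebra S I) \<subseteq> W" by (auto simp: quot_carrier)
  then show ?thesis
    using W by (auto simp: unital_algebra.unital_subalgebra_iff[OF quot_unital_algebra])
qed

end

lemma (in unital_algebra) genideal_unital_algebra_ideal:
  "G \<subseteq> carrier S \<Longrightarrow> unital_algebra_ideal S (Idl G)"
  by (intro unital_algebra_ideal.intro unital_algebra_axioms genideal_ideal)

text \<open>The kernel is an ideal containing the relations, so it contains the ideal they generate.
  Every map out of an algebra given by relations is shown to be well defined in this way.\<close>

lemma (in unital_algebra) genideal_kernel:
  assumes "unital_algebra T" "h \<in> alg_hom S T" "G \<subseteq> carrier S" "\<And>x. x \<in> G \<Longrightarrow> h x = \<zero>\<^bsub>T\<^esub>"
    and x: "x \<in> Idl G"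
  shows "h x = \<zero>\<^bsub>T\<^esub>"
proof -
  have "Idl G \<subseteq> {x \<in> carrier S. h x = \<zero>\<^bsub>T\<^esub>}"
    using assms by (intro genideal_minimal alg_hom_kernel_ideal unital_algebra_axioms) auto
  then show ?thesis using x by auto
qed

section \<open>Monoid algebras and free algebras\<close>

lemma monoid_algebra_simps:
  "carrier (monoid_algebra G) = {f. Poly_Mapping.keys f \<subseteq> carrier G}"
  "\<one>\<^bsub>monoid_algebra G\<^esub> = Poly_Mapping.single \<one>\<^bsub>G\<^esub> 1"
  "\<zero>\<^bsub>monoid_algebra G\<^esub> = 0"
  "f \<oplus>\<^bsub>monoid_algebra G\<^esub> g = f + g"
  "c \<odot>\<^bsub>monoid_algebra G\<^esub> f = Poly_Mapping.map ((*) c) f"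
  by (simp_all add: monoid_algebra_def)

lemma lookup_map_times: "Poly_Mapping.lookup (Poly_Mapping.map ((*) c) f) u = (c::'k::field) * Poly_Mapping.lookup f u"
  by (simp add: Poly_Mapping.map.rep_eq when_def)

lemma map_times_single:
  "Poly_Mapping.map ((*) c) (Poly_Mapping.single u a) = Poly_Mapping.single u ((c::'k::field) * a)"
  by (rule poly_mapping_eqI) (simp add: lookup_map_times lookup_single when_def)

lemma keys_map_times: "Poly_Mapping.keys (Poly_Mapping.map ((*) (c::'k::field)) f) \<subseteq> Poly_Mapping.keys f"
  by (auto simp: in_keys_iff lookup_map_times)

lemma map_times_add:
  "Poly_Mapping.map ((*) (c::'k::field)) (f + g) = Poly_Mapping.map ((*) c) f + Poly_Mapping.map ((*) c) g"
  by (rule poly_mapping_eqI) (simp add: lookup_map_times lookup_add distrib_left)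

lemma map_times_sum:
  "Poly_Mapping.map ((*) (c::'k::field)) (sum f K) = (\<Sum>u\<in>K. Poly_Mapping.map ((*) c) (f u))"
  by (rule poly_mapping_eqI) (simp add: lookup_map_times lookup_sum sum_distrib_left)

lemma map_times_zero: "Poly_Mapping.map ((*) (c::'k::field)) 0 = 0"
  by (rule poly_mapping_eqI) (simp add: lookup_map_times)

text \<open>Supports of sums can shrink by cancellation. Summing over fixed finite sets that contain
  the supports makes bilinearity a termwise computation.\<close>

lemma monoid_algebra_mult_superset:
  assumes "finite K" "Poly_Mapping.keys f \<subseteq> K" "finite L" "Poly_Mapping.keys g \<subseteq> L"
  shows "f \<otimes>\<^bsub>monoid_algebra G\<^esub> g = (\<Sum>u\<in>K. \<Sum>v\<in>L. Poly_Mapping.single (u \<otimes>\<^bsub>G\<^esub> v)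
           (Poly_Mapping.lookup f u * Poly_Mapping.lookup g v))"
proof -
  have "f \<otimes>\<^bsub>monoid_algebra G\<^esub> g = (\<Sum>u\<in>Poly_Mapping.keys f. \<Sum>v\<in>L. Poly_Mapping.single (u \<otimes>\<^bsub>G\<^esub> v)
           (Poly_Mapping.lookup f u * Poly_Mapping.lookup g v))"
    unfolding monoid_algebra_def using assms
    by (simp, intro sum.cong[OF refl] sum.mono_neutral_left) (auto simp: in_keys_iff)
  also have "\<dots> = (\<Sum>u\<in>K. \<Sum>v\<in>L. Poly_Mapping.single (u \<otimes>\<^bsub>G\<^esub> v)
           (Poly_Mapping.lookup f u * Poly_Mapping.lookup g v))"
    using assms by (intro sum.mono_neutral_left) (auto simp: in_keys_iff)
  finally show ?thesis .
qed

lemma monoid_algebra_mult_single: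
  "Poly_Mapping.single u a \<otimes>\<^bsub>monoid_algebra G\<^esub> Poly_Mapping.single v b =
     Poly_Mapping.single (u \<otimes>\<^bsub>G\<^esub> v) (a * b)"
  by (subst monoid_algebra_mult_superset[of "{u}" _ "{v}"]) auto

lemma monoid_algebra_mult_add_left:
  "(f + g) \<otimes>\<^bsub>monoid_algebra G\<^esub> h = f \<otimes>\<^bsub>monoid_algebra G\<^esub> h + g \<otimes>\<^bsub>monoid_algebra G\<^esub> h"
proof -
  let ?K = "Poly_Mapping.keys f \<union> Poly_Mapping.keys g"
  have "Poly_Mapping.keys (f + g) \<subseteq> ?K" by (rule keys_add)
  then show ?thesis
    by (simp add: monoid_algebra_mult_superset[where K = ?K and L = "Poly_Mapping.keys h"]
        lookup_add distrib_right single_add sum.distrib)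
qed

lemma monoid_algebra_mult_add_right:
  "h \<otimes>\<^bsub>monoid_algebra G\<^esub> (f + g) = h \<otimes>\<^bsub>monoid_algebra G\<^esub> f + h \<otimes>\<^bsub>monoid_algebra G\<^esub> g"
proof -
  let ?K = "Poly_Mapping.keys f \<union> Poly_Mapping.keys g"
  have "Poly_Mapping.keys (f + g) \<subseteq> ?K" by (rule keys_add)
  then show ?thesis
    by (simp add: monoid_algebra_mult_superset[where L = ?K and K = "Poly_Mapping.keys h"]
        lookup_add distrib_left single_add sum.distrib)
qed

lemma monoid_algebra_mult_zero:
  "0 \<otimes>\<^bsub>monoid_algebra G\<^esub> f = 0" "f \<otimes>\<^bsub>monoid_algebra G\<^esub> 0 = 0"
  by (simp_all add: monoid_algebra_def)

text \<open>Every element is the sum of its monomials. The coefficient belongs to the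
  \<open>single\<close> case, so no case for scalar multiples arises.\<close>

lemma monoid_algebra_induct [consumes 1, case_names zero single add]:
  assumes "f \<in> carrier (monoid_algebra G)"
    and "P 0"
    and "\<And>u c. u \<in> carrier G \<Longrightarrow> P (Poly_Mapping.single u c)"
    and "\<And>f g. f \<in> carrier (monoid_algebra G) \<Longrightarrow> g \<in> carrier (monoid_algebra G) \<Longrightarrow>
           P f \<Longrightarrow> P g \<Longrightarrow> P (f + g)"
  shows "P f"
proof -
  have decomp: "f = (\<Sum>u\<in>Poly_Mapping.keys f. Poly_Mapping.single u (Poly_Mapping.lookup f u))"
    by (rule poly_mapping_eqI)
      (auto simp: lookup_sum lookup_single when_def in_keys_iff)
  have "(\<Sum>u\<in>K. Poly_Mapping.single u (Poly_Mapping.lookup f u)) \<in> carrier (monoid_algebra G) \<and>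
        P (\<Sum>u\<in>K. Poly_Mapping.single u (Poly_Mapping.lookup f u))"
    if "finite K" "K \<subseteq> carrier G" for K
    using that
  proof (induction K rule: finite_induct)
    case empty
    then show ?case using assms(2) by (simp add: monoid_algebra_simps)
  next
    case (insert u K)
    let ?s = "Poly_Mapping.single u (Poly_Mapping.lookup f u)"
    have s: "?s \<in> carrier (monoid_algebra G)"
      using insert.prems by (simp add: monoid_algebra_simps)
    have "?s + (\<Sum>u\<in>K. Poly_Mapping.single u (Poly_Mapping.lookup f u)) \<in> carrier (monoid_algebra G)"
      using insert s keys_add[of ?s "\<Sum>u\<in>K. Poly_Mapping.single u (Poly_Mapping.lookup f u)"]
      by (auto simp: monoid_algebra_simps)
    then show ?case using insert assms(3,4) s by simp
  qed
  then have "P (\<Sum>u\<in>Poly_Mapping.keys f. Poly_Mapping.single u (Poly_Mapping.lookup f u))"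
    using assms(1) by (simp add: monoid_algebra_simps)
  then show ?thesis using decomp by argo
qed

lemma monoid_algebra_mult_smult:
  "Poly_Mapping.map ((*) c) f \<otimes>\<^bsub>monoid_algebra G\<^esub> g = Poly_Mapping.map ((*) (c::'k::field)) (f \<otimes>\<^bsub>monoid_algebra G\<^esub> g)"
  "f \<otimes>\<^bsub>monoid_algebra G\<^esub> Poly_Mapping.map ((*) c) g = Poly_Mapping.map ((*) c) (f \<otimes>\<^bsub>monoid_algebra G\<^esub> g)"
proof -
  let ?K = "Poly_Mapping.keys f" and ?L = "Poly_Mapping.keys g"
  note * = monoid_algebra_mult_superset[where K = ?K and L = ?L] keys_map_times
  show "Poly_Mapping.map ((*) c) f \<otimes>\<^bsub>monoid_algebra G\<^esub> g = Poly_Mapping.map ((*) c) (f \<otimes>\<^bsub>monoid_algebra G\<^esub> g)"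
    by (simp add: * map_times_sum map_times_single lookup_map_times mult_ac)
  show "f \<otimes>\<^bsub>monoid_algebra G\<^esub> Poly_Mapping.map ((*) c) g = Poly_Mapping.map ((*) c) (f \<otimes>\<^bsub>monoid_algebra G\<^esub> g)"
    by (simp add: * map_times_sum map_times_single lookup_map_times mult_ac)
qed

lemma monoid_algebra_single_closed:
  "u \<in> carrier G \<Longrightarrow> Poly_Mapping.single u c \<in> carrier (monoid_algebra G)"
  by (simp add: monoid_algebra_simps)

lemma monoid_algebra_add_closed:
  "f \<in> carrier (monoid_algebra G) \<Longrightarrow> g \<in> carrier (monoid_algebra G) \<Longrightarrow> f + g \<in> carrier (monoid_algebra G)"
  using keys_add[of f g] by (auto simp: monoid_algebra_simps)

lemma monoid_algebra_mult_closed: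
  assumes G: "Group.monoid G" and f: "f \<in> carrier (monoid_algebra G)" and g: "g \<in> carrier (monoid_algebra G)"
  shows "f \<otimes>\<^bsub>monoid_algebra G\<^esub> g \<in> carrier (monoid_algebra G)"
  using f
proof (induction f rule: monoid_algebra_induct)
  case (single u c)
  show ?case using g
    by (induction g rule: monoid_algebra_induct)
      (auto simp: monoid_algebra_mult_zero monoid_algebra_mult_single monoid_algebra_mult_add_right
        intro!: monoid_algebra_single_closed monoid_algebra_add_closed single monoid.m_closed[OF G],
        simp add: monoid_algebra_simps)
next
  case (add f h)
  then show ?case by (simp add: monoid_algebra_mult_add_left monoid_algebra_add_closed)
qed (simp add: monoid_algebra_mult_zero monoid_algebra_simps)

lemma monoid_algebra_mult_assoc:
  assumes G: "Group.monoid G"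
    and f: "f \<in> carrier (monoid_algebra G)" and g: "g \<in> carrier (monoid_algebra G)"
    and h: "h \<in> carrier (monoid_algebra G)"
  shows "(f \<otimes>\<^bsub>monoid_algebra G\<^esub> g) \<otimes>\<^bsub>monoid_algebra G\<^esub> h = f \<otimes>\<^bsub>monoid_algebra G\<^esub> (g \<otimes>\<^bsub>monoid_algebra G\<^esub> h)"
  using f
proof (induction f rule: monoid_algebra_induct)
  case (single u a)
  show ?case using g
  proof (induction g rule: monoid_algebra_induct)
    case (single v b)
    show ?case using h
    proof (induction h rule: monoid_algebra_induct)
      case (single w c)
      then show ?case
        using \<open>u \<in> carrier G\<close> \<open>v \<in> carrier G\<close>
        by (simp add: monoid_algebra_mult_single monoid.m_assoc[OF G] mult.assoc)
    qed (simp_all add: monoid_algebra_mult_zero monoid_algebra_mult_add_right)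
  qed (simp_all add: monoid_algebra_mult_zero monoid_algebra_mult_add_right monoid_algebra_mult_add_left)
qed (simp_all add: monoid_algebra_mult_zero monoid_algebra_mult_add_left)

lemma monoid_algebra_mult_one:
  assumes G: "Group.monoid G" and f: "f \<in> carrier (monoid_algebra G)"
  shows "Poly_Mapping.single \<one>\<^bsub>G\<^esub> 1 \<otimes>\<^bsub>monoid_algebra G\<^esub> f = f"
    "f \<otimes>\<^bsub>monoid_algebra G\<^esub> Poly_Mapping.single \<one>\<^bsub>G\<^esub> 1 = f"
  using f
  by (induction f rule: monoid_algebra_induct)
    (simp_all add: monoid_algebra_mult_zero monoid_algebra_mult_single monoid_algebra_mult_add_right
      monoid_algebra_mult_add_left monoid.l_one[OF G] monoid.r_one[OF G])

lemma monoid_algebra_unital_algebra: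
  assumes G: "Group.monoid G" shows "unital_algebra (monoid_algebra G)"
proof -
  let ?M = "monoid_algebra G"
  have uminus: "- f \<in> carrier ?M" if "f \<in> carrier ?M" for f
    using that by (auto simp: monoid_algebra_simps in_keys_iff)
  have "abelian_group ?M"
  proof (rule abelian_groupI)
    fix f assume "f \<in> carrier ?M"
    then show "\<exists>y\<in>carrier ?M. y \<oplus>\<^bsub>?M\<^esub> f = \<zero>\<^bsub>?M\<^esub>"
      using uminus by (intro bexI[of _ "- f"]) (auto simp: monoid_algebra_simps)
  qed (auto simp: monoid_algebra_simps add_ac dest: subsetD[OF keys_add])
  moreover have "Group.monoid ?M"
    using monoid_algebra_mult_closed[OF G] monoid_algebra_mult_assoc[OF G] monoid_algebra_mult_one[OF G]
    by (intro monoidI) (auto simp: monoid_algebra_simps(2) intro!: monoid_algebra_single_closed monoid.one_closed[OF G])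
  ultimately have "ring ?M"
    by (intro ringI) (simp_all add: monoid_algebra_simps(4) monoid_algebra_mult_add_left monoid_algebra_mult_add_right)
  then show ?thesis
  proof (rule unital_algebra.intro, unfold_locales)
    fix f c assume "f \<in> carrier ?M"
    then show "c \<odot>\<^bsub>?M\<^esub> f \<in> carrier ?M" using keys_map_times[of c f] by (auto simp: monoid_algebra_simps)
  qed (auto simp: monoid_algebra_simps(3-) monoid_algebra_mult_smult
      intro!: poly_mapping_eqI simp: lookup_map_times lookup_add algebra_simps)
qed

text \<open>Linear extension of a monoid homomorphism into the multiplicative monoid of
  \<open>T\<close>. It serves twice: words yield the free algebra, pairs yield the tensor
  product.\<close>

lemma monoid_algebra_lift:
  assumes G: "Group.monoid G" and T: "unital_algebra T"
    and closed: "\<And>u. u \<in> carrier G \<Longrightarrow> \<phi> u \<in> carrier T"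
    and mult: "\<And>u v. u \<in> carrier G \<Longrightarrow> v \<in> carrier G \<Longrightarrow> \<phi> (u \<otimes>\<^bsub>G\<^esub> v) = \<phi> u \<otimes>\<^bsub>T\<^esub> \<phi> v"
    and one: "\<phi> \<one>\<^bsub>G\<^esub> = \<one>\<^bsub>T\<^esub>"
  obtains h where "h \<in> alg_hom (monoid_algebra G) T"
    "\<And>u. u \<in> carrier G \<Longrightarrow> h (Poly_Mapping.single u 1) = \<phi> u"
proof -
  interpret T: unital_algebra T by fact
  define h where "h f = (\<Oplus>\<^bsub>T\<^esub>u\<in>Poly_Mapping.keys f. Poly_Mapping.lookup f u \<odot>\<^bsub>T\<^esub> \<phi> u)" for f
  \<comment> \<open>The same device as for products: additivity needs both sums over a common index
    set, which may be larger than the support of the sum.\<close>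
  have super: "h f = (\<Oplus>\<^bsub>T\<^esub>u\<in>K. Poly_Mapping.lookup f u \<odot>\<^bsub>T\<^esub> \<phi> u)"
    if "finite K" "Poly_Mapping.keys f \<subseteq> K" "K \<subseteq> carrier G" for f K
    unfolding h_def using that closed
    by (intro T.add.finprod_mono_neutral_cong_left) (auto simp: in_keys_iff subset_iff)
  have h_closed: "h f \<in> carrier T" if "f \<in> carrier (monoid_algebra G)" for f
    using that closed unfolding h_def by (intro T.finsum_closed) (auto simp: monoid_algebra_simps)
  have h_single: "h (Poly_Mapping.single u c) = c \<odot>\<^bsub>T\<^esub> \<phi> u" if "u \<in> carrier G" for u c
    using that closed by (subst super[of "{u}"]) (auto simp: T.finsum_singleton)
  have h_add: "h (f + g) = h f \<oplus>\<^bsub>T\<^esub> h g"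
    if "f \<in> carrier (monoid_algebra G)" "g \<in> carrier (monoid_algebra G)" for f g
  proof -
    let ?K = "Poly_Mapping.keys f \<union> Poly_Mapping.keys g"
    have K: "?K \<subseteq> carrier G" using that by (auto simp: monoid_algebra_simps)
    have "h (f + g) = (\<Oplus>\<^bsub>T\<^esub>u\<in>?K. Poly_Mapping.lookup f u \<odot>\<^bsub>T\<^esub> \<phi> u \<oplus>\<^bsub>T\<^esub> Poly_Mapping.lookup g u \<odot>\<^bsub>T\<^esub> \<phi> u)"
      using K closed keys_add[of f g]
      by (subst super[of ?K], simp_all, intro T.finsum_cong')
        (auto simp: lookup_add T.smult_l_distr subset_iff)
    also have "\<dots> = h f \<oplus>\<^bsub>T\<^esub> h g"
      using K closed by (subst T.finsum_addf) (auto simp: super[of ?K] subset_iff)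
    finally show ?thesis .
  qed
  have h0: "h 0 = \<zero>\<^bsub>T\<^esub>" by (simp add: h_def)
  have h_mult: "h (f \<otimes>\<^bsub>monoid_algebra G\<^esub> g) = h f \<otimes>\<^bsub>T\<^esub> h g"
    if f: "f \<in> carrier (monoid_algebra G)" and g: "g \<in> carrier (monoid_algebra G)" for f g
    using f
  proof (induction f rule: monoid_algebra_induct)
    case (single u a)
    show ?case using g
    proof (induction g rule: monoid_algebra_induct)
      case (single v b)
      then show ?case
        using \<open>u \<in> carrier G\<close> closed G
        by (simp add: monoid_algebra_mult_single h_single monoid.m_closed mult T.smult_mult_left
            T.smult_mult_right mult.commute flip: T.smult_assoc)
    next
      case (add f g)
      then show ?case using single closed
        by (simp add: monoid_algebra_mult_add_right h_add h_closed h_single T.r_distr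
          monoid_algebra_mult_closed[OF G] monoid_algebra_single_closed)
    qed (use single closed in \<open>simp add: monoid_algebra_mult_zero h0 h_single\<close>)
  next
    case (add f h)
    then show ?case using g
      by (simp add: monoid_algebra_mult_add_left h_add h_closed T.l_distr monoid_algebra_mult_closed[OF G])
  qed (use g in \<open>simp add: monoid_algebra_mult_zero h0 h_closed\<close>)
  have h_smult: "h (Poly_Mapping.map ((*) c) f) = c \<odot>\<^bsub>T\<^esub> h f" if "f \<in> carrier (monoid_algebra G)" for c f
    using that
  proof (induction f rule: monoid_algebra_induct)
    case (add f g)
    then show ?case
      using unital_algebra.smult_closed[OF monoid_algebra_unital_algebra[OF G], of _ c]
      by (simp add: map_times_add h_add h_closed T.smult_r_distr monoid_algebra_simps(5))
  qed (use closed in \<open>simp_all add: h_single h0 map_times_single map_times_zero T.smult_assoc\<close>)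
  have "h \<in> alg_hom (monoid_algebra G) T"
    using closed h_single[of "\<one>\<^bsub>G\<^esub>" 1] G
    unfolding alg_hom_iff
    by (simp add: h_closed h_mult monoid_algebra_simps(2,4,5) h_add h_smult one monoid.one_closed)
  moreover have "h (Poly_Mapping.single u 1) = \<phi> u" if "u \<in> carrier G" for u
    using that closed h_single by simp
  ultimately show thesis using that by blast
qed

lemma monoid_algebra_generated:
  assumes G: "Group.monoid G"
    and W: "unital_subalgebra (monoid_algebra G) W"
    and single: "\<And>u. u \<in> carrier G \<Longrightarrow> Poly_Mapping.single u 1 \<in> W"
  shows "W = carrier (monoid_algebra G)"
proof -
  interpret unital_algebra "monoid_algebra G" by (rule monoid_algebra_unital_algebra[OF G])
  have W': "W \<subseteq> carrier (monoid_algebra G)" "\<And>f g. f \<in> W \<Longrightarrow> g \<in> W \<Longrightarrow> f + g \<in> W"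
    "\<And>c f. f \<in> W \<Longrightarrow> Poly_Mapping.map ((*) c) f \<in> W"
    using W unfolding unital_subalgebra_iff by (auto simp: monoid_algebra_simps(4,5))
  have s: "Poly_Mapping.single u c \<in> W" if "u \<in> carrier G" for u c
    using W'(3)[OF single[OF that], of c] by (simp add: map_times_single)
  have "f \<in> W" if "f \<in> carrier (monoid_algebra G)" for f
    using that
    by (induction f rule: monoid_algebra_induct)
      (use s[OF monoid.one_closed[OF G], of 0] W' s in auto)
  then show ?thesis using W'(1) by blast
qed

section \<open>Free algebras as monoid algebras of words\<close>

lemma word_monoid_monoid: "Group.monoid (word_monoid Y)"
  by (intro monoidI) (auto simp: word_monoid_def)

lemma free_algebra_unital_algebra: "unital_algebra (free_algebra Y)"
  unfolding free_algebra_def by (intro monoid_algebra_unital_algebra word_monoid_monoid)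

lemma generator_closed: "x \<in> Y \<Longrightarrow> generator x \<in> carrier (free_algebra Y)"
  by (auto simp: generator_def free_algebra_def word_monoid_def intro!: monoid_algebra_single_closed)

text \<open>A map on letters extends to words by multiplying out the images, starting from the unit
  of \<open>T\<close>; this is a monoid homomorphism, to which linear extension applies.\<close>

lemma free_algebra_lift:
  assumes T: "unital_algebra T" and closed: "\<And>x. x \<in> Y \<Longrightarrow> \<phi> x \<in> carrier T"
  obtains h where "h \<in> alg_hom (free_algebra Y) T" "\<And>x. x \<in> Y \<Longrightarrow> h (generator x) = \<phi> x"
proof -
  interpret T: unital_algebra T by fact
  define \<psi> where "\<psi> u = foldr (\<lambda>x y. \<phi> x \<otimes>\<^bsub>T\<^esub> y) u \<one>\<^bsub>T\<^esub>" for u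
  have \<psi>_closed: "\<psi> u \<in> carrier T" if "u \<in> lists Y" for u
    using that by induction (auto simp: \<psi>_def closed)
  have \<psi>_append: "\<psi> (u @ v) = \<psi> u \<otimes>\<^bsub>T\<^esub> \<psi> v" if "u \<in> lists Y" "v \<in> lists Y" for u v
    using that(1)
  proof induction
    case Nil
    then show ?case using \<psi>_closed[OF that(2)] by (simp add: \<psi>_def)
  next
    case (Cons x u)
    then have "\<psi> ((x # u) @ v) = \<phi> x \<otimes>\<^bsub>T\<^esub> (\<psi> u \<otimes>\<^bsub>T\<^esub> \<psi> v)" by (simp add: \<psi>_def)
    also have "\<dots> = (\<phi> x \<otimes>\<^bsub>T\<^esub> \<psi> u) \<otimes>\<^bsub>T\<^esub> \<psi> v"
      using Cons \<psi>_closed that(2) closed by (simp add: T.m_assoc)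
    finally show ?case by (simp add: \<psi>_def)
  qed
  obtain h where "h \<in> alg_hom (monoid_algebra (word_monoid Y)) T"
    "\<And>u. u \<in> carrier (word_monoid Y) \<Longrightarrow> h (Poly_Mapping.single u 1) = \<psi> u"
    by (rule monoid_algebra_lift[OF word_monoid_monoid T, of Y \<psi>])
      (auto simp: word_monoid_def \<psi>_closed \<psi>_append, auto simp: \<psi>_def)
  then show thesis using that closed
    by (auto simp: free_algebra_def generator_def word_monoid_def \<psi>_def)
qed

lemma free_algebra_generated:
  assumes W: "unital_subalgebra (free_algebra Y) W" and gen: "\<And>x. x \<in> Y \<Longrightarrow> generator x \<in> W"
  shows "W = carrier (free_algebra Y)"
  unfolding free_algebra_def
proof (rule monoid_algebra_generated[OF word_monoid_monoid])
  show "unital_subalgebra (monoid_algebra (word_monoid Y)) W" using W by (simp add: free_algebra_def)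
  fix u assume "u \<in> carrier (word_monoid Y)"
  then have "u \<in> lists Y" by (simp add: word_monoid_def)
  then show "Poly_Mapping.single u 1 \<in> W"
  proof induction
    case Nil
    then show ?case using W
      unfolding unital_algebra.unital_subalgebra_iff[OF free_algebra_unital_algebra]
      by (simp add: free_algebra_def monoid_algebra_simps word_monoid_def)
  next
    case (Cons x u)
    have "generator x \<otimes>\<^bsub>free_algebra Y\<^esub> Poly_Mapping.single u 1 \<in> W"
      using W gen[OF Cons(1)] Cons
      unfolding unital_algebra.unital_subalgebra_iff[OF free_algebra_unital_algebra] by blast
    then show ?case
      by (simp add: free_algebra_def generator_def monoid_algebra_mult_single word_monoid_def)
  qed
qed

section \<open>Free products and tensor products\<close>

lemma hom_relations_closed:
  assumes "unital_algebra A" "unital_algebra F" "\<And>a. a \<in> carrier A \<Longrightarrow> \<phi> a \<in> carrier F"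
  shows "hom_relations A F \<phi> \<subseteq> carrier F"
proof -
  interpret A: unital_algebra A by fact
  interpret F: unital_algebra F by fact
  show ?thesis using assms(3) by (auto simp: hom_relations_def)
qed

text \<open>The relations are exactly the failures of \<open>\<phi>\<close> to be a homomorphism, so
  once they lie in the ideal the induced map is one.\<close>

lemma hom_relations_hom:
  assumes A: "unital_algebra A" and I: "unital_algebra_ideal F I"
    and \<phi>: "\<And>a. a \<in> carrier A \<Longrightarrow> \<phi> a \<in> carrier F" and rel: "hom_relations A F \<phi> \<subseteq> I"
  shows "(\<lambda>a. I +>\<^bsub>F\<^esub> \<phi> a) \<in> alg_hom A (quot_algebra F I)"
proof -
  interpret A: unital_algebra A by fact
  interpret unital_algebra_ideal F I by fact
  have add: "\<phi> (x \<oplus>\<^bsub>A\<^esub> y) \<ominus>\<^bsub>F\<^esub> (\<phi> x \<oplus>\<^bsub>F\<^esub> \<phi> y) \<in> I"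
    and mult: "\<phi> (x \<otimes>\<^bsub>A\<^esub> y) \<ominus>\<^bsub>F\<^esub> (\<phi> x \<otimes>\<^bsub>F\<^esub> \<phi> y) \<in> I"
    if "x \<in> carrier A" "y \<in> carrier A" for x y
    using rel that unfolding hom_relations_def by blast+
  have smult: "\<phi> (c \<odot>\<^bsub>A\<^esub> x) \<ominus>\<^bsub>F\<^esub> (c \<odot>\<^bsub>F\<^esub> \<phi> x) \<in> I" if "x \<in> carrier A" for x c
    using rel that unfolding hom_relations_def by blast
  have one: "\<phi> \<one>\<^bsub>A\<^esub> \<ominus>\<^bsub>F\<^esub> \<one>\<^bsub>F\<^esub> \<in> I"
    using rel unfolding hom_relations_def by blast
  show ?thesis
    using \<phi> add mult smult one unfolding alg_hom_iff by (simp add: quot_simps coset_eq_iff)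
qed

text \<open>The converse half: a map that restricts to a homomorphism along \<open>\<phi>\<close>
  sends both sides of each relation to the same element.\<close>

lemma hom_relations_kernel:
  assumes A: "unital_algebra A" and F: "unital_algebra F" and T: "unital_algebra T"
    and \<phi>: "\<And>a. a \<in> carrier A \<Longrightarrow> \<phi> a \<in> carrier F"
    and h: "h \<in> alg_hom F T" and \<alpha>: "\<alpha> \<in> alg_hom A T"
    and eq: "\<And>a. a \<in> carrier A \<Longrightarrow> h (\<phi> a) = \<alpha> a"
    and x: "x \<in> hom_relations A F \<phi>"
  shows "h x = \<zero>\<^bsub>T\<^esub>"
proof -
  interpret A: unital_algebra A by fact
  interpret F: unital_algebra F by fact
  interpret T: unital_algebra T by fact
  note * = h[unfolded alg_hom_iff] \<alpha>[unfolded alg_hom_iff] alg_hom_minus[OF F T h]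
  show ?thesis
    using x \<phi> * unfolding hom_relations_def
    by (auto simp: eq T.r_right_minus_eq)
qed

lemma free_product_gens_unital_algebra: "unital_algebra (free_product_gens A B)"
  unfolding free_product_gens_def by (rule free_algebra_unital_algebra)

lemma free_product_gens_closed:
  "a \<in> carrier A \<Longrightarrow> generator (Inl a) \<in> carrier (free_product_gens A B)"
  "b \<in> carrier B \<Longrightarrow> generator (Inr b) \<in> carrier (free_product_gens A B)"
  by (auto simp: free_product_gens_def intro!: generator_closed)

section \<open>The free product and its universal property\<close>

locale unital_algebra_pair = A: unital_algebra A + B: unital_algebra B
  for A :: "('k::field, 'a) module" and B :: "('k, 'b) module"
begin

abbreviation "\<F> \<equiv> free_product_gens A B"
abbreviation "\<I> \<equiv> free_product_ideal A B"
abbreviation "\<P> \<equiv> free_product A B"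
abbreviation "\<T> \<equiv> tensor_algebra A B"

lemma free_product_relations_closed:
  "hom_relations A \<F> (\<lambda>a. generator (Inl a)) \<union> hom_relations B \<F> (\<lambda>b. generator (Inr b))
     \<subseteq> carrier \<F>"
  by (intro Un_least hom_relations_closed free_product_gens_closed free_product_gens_unital_algebra
      A.unital_algebra_axioms B.unital_algebra_axioms)

sublocale FI: unital_algebra_ideal \<F> \<I>
  unfolding free_product_ideal_def
  by (intro unital_algebra.genideal_unital_algebra_ideal free_product_gens_unital_algebra free_product_relations_closed)

lemma free_product_ideal_superset:
  "hom_relations A \<F> (\<lambda>a. generator (Inl a)) \<union> hom_relations B \<F> (\<lambda>b. generator (Inr b)) \<subseteq> \<I>"
  unfolding free_product_ideal_def
  by (intro FI.genideal_self free_product_relations_closed)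

lemma free_product_unital_algebra: "unital_algebra \<P>"
  unfolding free_product_def by (rule FI.quot_unital_algebra)

lemma free_product_inl_hom: "free_product_inl A B \<in> alg_hom A \<P>"
  unfolding free_product_def free_product_inl_def
  using free_product_ideal_superset
  by (intro hom_relations_hom A.unital_algebra_axioms FI.unital_algebra_ideal_axioms free_product_gens_closed) auto

lemma free_product_inr_hom: "free_product_inr A B \<in> alg_hom B \<P>"
  unfolding free_product_def free_product_inr_def
  using free_product_ideal_superset
  by (intro hom_relations_hom B.unital_algebra_axioms FI.unital_algebra_ideal_axioms free_product_gens_closed) auto

text \<open>\<open>\<alpha>\<close> and \<open>\<beta>\<close> together form one map on the letters.
  Its extension to the free algebra kills the relations because each of the two is a
  homomorphism.\<close>

lemma free_product_lift:
  assumes T: "unital_algebra T" and \<alpha>: "\<alpha> \<in> alg_hom A T" and \<beta>: "\<beta> \<in> alg_hom B T"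
  obtains h where "h \<in> alg_hom \<P> T"
    "\<And>a. a \<in> carrier A \<Longrightarrow> h (free_product_inl A B a) = \<alpha> a"
    "\<And>b. b \<in> carrier B \<Longrightarrow> h (free_product_inr A B b) = \<beta> b"
proof -
  define \<phi> where "\<phi> = case_sum \<alpha> \<beta>"
  have cl: "\<phi> x \<in> carrier T" if "x \<in> carrier A <+> carrier B" for x
    using that \<alpha> \<beta> by (auto simp: \<phi>_def alg_hom_iff)
  obtain g where g: "g \<in> alg_hom \<F> T"
    and g_gen: "\<And>x. x \<in> carrier A <+> carrier B \<Longrightarrow> g (generator x) = \<phi> x"
    using free_algebra_lift[of T _ \<phi>, OF T cl] unfolding free_product_gens_def by metis
  have "g x = \<zero>\<^bsub>T\<^esub>" if "x \<in> \<I>" for x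
  proof (rule FI.genideal_kernel[OF T g free_product_relations_closed])
    show "x \<in> Idl\<^bsub>\<F>\<^esub> (hom_relations A \<F> (\<lambda>a. generator (Inl a)) \<union> hom_relations B \<F> (\<lambda>b. generator (Inr b)))"
      using that by (simp add: free_product_ideal_def)
    fix y assume "y \<in> hom_relations A \<F> (\<lambda>a. generator (Inl a)) \<union> hom_relations B \<F> (\<lambda>b. generator (Inr b))"
    then show "g y = \<zero>\<^bsub>T\<^esub>"
    proof
      assume "y \<in> hom_relations A \<F> (\<lambda>a. generator (Inl a))"
      then show ?thesis
        by (rule hom_relations_kernel[OF A.unital_algebra_axioms FI.unital_algebra_axioms T _ g \<alpha>, rotated 2])
          (simp_all add: g_gen \<phi>_def free_product_gens_closed InlI InrI)
    next
      assume "y \<in> hom_relations B \<F> (\<lambda>b. generator (Inr b))"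
      then show ?thesis
        by (rule hom_relations_kernel[OF B.unital_algebra_axioms FI.unital_algebra_axioms T _ g \<beta>, rotated 2])
          (simp_all add: g_gen \<phi>_def free_product_gens_closed InlI InrI)
    qed
  qed
  then obtain h where h: "h \<in> alg_hom \<P> T" "\<And>x. x \<in> carrier \<F> \<Longrightarrow> h (\<I> +>\<^bsub>\<F>\<^esub> x) = g x"
    using FI.quot_lift[OF T g] unfolding free_product_def by blast
  show thesis
    using h that[of h] g_gen[OF InlI] g_gen[OF InrI]
    by (simp add: free_product_inl_def free_product_inr_def free_product_gens_closed \<phi>_def)
qed

lemma free_product_generated:
  assumes "unital_subalgebra \<P> W"
    and "\<And>a. a \<in> carrier A \<Longrightarrow> free_product_inl A B a \<in> W"
    and "\<And>b. b \<in> carrier B \<Longrightarrow> free_product_inr A B b \<in> W"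
  shows "W = carrier \<P>"
  unfolding free_product_def
proof (rule FI.quot_generated)
  show "unital_subalgebra (quot_algebra \<F> \<I>) W" using assms(1) by (simp add: free_product_def)
  show "W' = carrier \<F>" if "unital_subalgebra \<F> W'" "generator ` (carrier A <+> carrier B) \<subseteq> W'" for W'
    unfolding free_product_gens_def
    using that by (intro free_algebra_generated) (auto simp: free_product_gens_def)
qed (use assms in \<open>auto simp: free_product_gens_closed free_product_inl_def free_product_inr_def\<close>)

section \<open>The tensor product and its universal property\<close>

abbreviation "\<M> \<equiv> monoid_algebra (A \<times>\<times> B) :: ('k, 'a \<times> 'b \<Rightarrow>\<^sub>0 'k) module"

definition pure_tensor :: "'a \<Rightarrow> 'b \<Rightarrow> ('a \<times> 'b \<Rightarrow>\<^sub>0 'k) set" where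
  "pure_tensor a b = Idl\<^bsub>\<M>\<^esub> (tensor_relations A B) +>\<^bsub>\<M>\<^esub> Poly_Mapping.single (a, b) 1"

lemma DirProd_multiplicative_monoid: "Group.monoid (A \<times>\<times> B)"
  by (intro DirProd_monoid A.is_monoid B.is_monoid A.monoid_axioms B.monoid_axioms)

lemma tensor_gens_unital_algebra: "unital_algebra \<M>"
  by (rule monoid_algebra_unital_algebra[OF DirProd_multiplicative_monoid])

lemma single_pair_closed:
  "a \<in> carrier A \<Longrightarrow> b \<in> carrier B \<Longrightarrow> Poly_Mapping.single (a, b) 1 \<in> carrier \<M>"
  by (intro monoid_algebra_single_closed) (simp add: DirProd_def)

lemma tensor_relations_closed: "tensor_relations A B \<subseteq> carrier \<M>"
proof -
  interpret M: unital_algebra \<M> by (rule tensor_gens_unital_algebra)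
  show ?thesis unfolding tensor_relations_def Let_def
    by (auto intro!: M.minus_closed M.add.m_closed M.smult_closed single_pair_closed)
qed

sublocale MI: unital_algebra_ideal \<M> "Idl\<^bsub>\<M>\<^esub> (tensor_relations A B)"
  by (intro unital_algebra.genideal_unital_algebra_ideal tensor_gens_unital_algebra tensor_relations_closed)

lemma tensor_unital_algebra: "unital_algebra \<T>"
  unfolding tensor_algebra_def by (rule MI.quot_unital_algebra)

lemma pure_tensor_closed: "a \<in> carrier A \<Longrightarrow> b \<in> carrier B \<Longrightarrow> pure_tensor a b \<in> carrier \<T>"
  unfolding pure_tensor_def tensor_algebra_def by (intro MI.quot_simps single_pair_closed)

lemma pure_tensor_mult:
  assumes "a \<in> carrier A" "b \<in> carrier B" "a' \<in> carrier A" "b' \<in> carrier B"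
  shows "pure_tensor a b \<otimes>\<^bsub>\<T>\<^esub> pure_tensor a' b' = pure_tensor (a \<otimes>\<^bsub>A\<^esub> a') (b \<otimes>\<^bsub>B\<^esub> b')"
  using assms unfolding pure_tensor_def tensor_algebra_def
  by (simp add: MI.quot_mult single_pair_closed monoid_algebra_mult_single)

lemma pure_tensor_one: "pure_tensor \<one>\<^bsub>A\<^esub> \<one>\<^bsub>B\<^esub> = \<one>\<^bsub>\<T>\<^esub>"
  unfolding pure_tensor_def tensor_algebra_def
  by (simp add: MI.quot_one monoid_algebra_simps)

lemma tensor_relations_memI:
  fixes t defines "t \<equiv> \<lambda>a b. Poly_Mapping.single (a, b) (1 :: 'k)"
  shows "a \<in> carrier A \<Longrightarrow> a' \<in> carrier A \<Longrightarrow> b \<in> carrier B \<Longrightarrow>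
      t (a \<oplus>\<^bsub>A\<^esub> a') b \<ominus>\<^bsub>\<M>\<^esub> (t a b \<oplus>\<^bsub>\<M>\<^esub> t a' b) \<in> tensor_relations A B"
    "a \<in> carrier A \<Longrightarrow> b \<in> carrier B \<Longrightarrow> b' \<in> carrier B \<Longrightarrow>
      t a (b \<oplus>\<^bsub>B\<^esub> b') \<ominus>\<^bsub>\<M>\<^esub> (t a b \<oplus>\<^bsub>\<M>\<^esub> t a b') \<in> tensor_relations A B"
    "a \<in> carrier A \<Longrightarrow> b \<in> carrier B \<Longrightarrow>
      t (c \<odot>\<^bsub>A\<^esub> a) b \<ominus>\<^bsub>\<M>\<^esub> (c \<odot>\<^bsub>\<M>\<^esub> t a b) \<in> tensor_relations A B"
    "a \<in> carrier A \<Longrightarrow> b \<in> carrier B \<Longrightarrow>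
      t a (c \<odot>\<^bsub>B\<^esub> b) \<ominus>\<^bsub>\<M>\<^esub> (c \<odot>\<^bsub>\<M>\<^esub> t a b) \<in> tensor_relations A B"
  unfolding t_def tensor_relations_def Let_def by blast+

lemma tensor_relation_coset:
  assumes "x \<ominus>\<^bsub>\<M>\<^esub> y \<in> tensor_relations A B" "x \<in> carrier \<M>" "y \<in> carrier \<M>"
  shows "Idl\<^bsub>\<M>\<^esub> (tensor_relations A B) +>\<^bsub>\<M>\<^esub> x = Idl\<^bsub>\<M>\<^esub> (tensor_relations A B) +>\<^bsub>\<M>\<^esub> y"
  using assms MI.genideal_self[OF tensor_relations_closed] by (subst MI.coset_eq_iff) auto

lemma pure_tensor_hom_left: "(\<lambda>a. pure_tensor a \<one>\<^bsub>B\<^esub>) \<in> alg_hom A \<T>"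
proof -
  have "pure_tensor (a \<oplus>\<^bsub>A\<^esub> a') \<one>\<^bsub>B\<^esub> = pure_tensor a \<one>\<^bsub>B\<^esub> \<oplus>\<^bsub>\<T>\<^esub> pure_tensor a' \<one>\<^bsub>B\<^esub>"
    if "a \<in> carrier A" "a' \<in> carrier A" for a a'
    unfolding pure_tensor_def tensor_algebra_def using that
    by (subst MI.quot_add, simp_all add: single_pair_closed, intro tensor_relation_coset)
      (simp_all add: tensor_relations_memI single_pair_closed)
  moreover have "pure_tensor (c \<odot>\<^bsub>A\<^esub> a) \<one>\<^bsub>B\<^esub> = c \<odot>\<^bsub>\<T>\<^esub> pure_tensor a \<one>\<^bsub>B\<^esub>" if "a \<in> carrier A" for a c
    unfolding pure_tensor_def tensor_algebra_def using that
    by (subst MI.quot_smult, simp_all add: single_pair_closed, intro tensor_relation_coset)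
      (simp_all add: tensor_relations_memI single_pair_closed)
  ultimately show ?thesis
    unfolding alg_hom_iff by (simp add: pure_tensor_closed pure_tensor_mult pure_tensor_one)
qed

lemma pure_tensor_hom_right: "(\<lambda>b. pure_tensor \<one>\<^bsub>A\<^esub> b) \<in> alg_hom B \<T>"
proof -
  have "pure_tensor \<one>\<^bsub>A\<^esub> (a \<oplus>\<^bsub>B\<^esub> a') = pure_tensor \<one>\<^bsub>A\<^esub> a \<oplus>\<^bsub>\<T>\<^esub> pure_tensor \<one>\<^bsub>A\<^esub> a'"
    if "a \<in> carrier B" "a' \<in> carrier B" for a a'
    unfolding pure_tensor_def tensor_algebra_def using that
    by (subst MI.quot_add, simp_all add: single_pair_closed, intro tensor_relation_coset)
      (simp_all add: tensor_relations_memI single_pair_closed)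
  moreover have "pure_tensor \<one>\<^bsub>A\<^esub> (c \<odot>\<^bsub>B\<^esub> a) = c \<odot>\<^bsub>\<T>\<^esub> pure_tensor \<one>\<^bsub>A\<^esub> a" if "a \<in> carrier B" for a c
    unfolding pure_tensor_def tensor_algebra_def using that
    by (subst MI.quot_smult, simp_all add: single_pair_closed, intro tensor_relation_coset)
      (simp_all add: tensor_relations_memI single_pair_closed)
  ultimately show ?thesis
    unfolding alg_hom_iff by (simp add: pure_tensor_closed pure_tensor_mult pure_tensor_one)
qed

text \<open>The map is induced by sending a pair (a, b) to \<open>\<alpha> a\<close> times
  \<open>\<beta> b\<close>. Commuting images make it multiplicative on pairs, and linearity of
  \<open>\<alpha>\<close> and \<open>\<beta>\<close> makes it respect bilinearity.\<close>

lemma tensor_lift: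
  assumes T: "unital_algebra T" and \<alpha>: "\<alpha> \<in> alg_hom A T" and \<beta>: "\<beta> \<in> alg_hom B T"
    and comm: "\<And>a b. a \<in> carrier A \<Longrightarrow> b \<in> carrier B \<Longrightarrow> \<alpha> a \<otimes>\<^bsub>T\<^esub> \<beta> b = \<beta> b \<otimes>\<^bsub>T\<^esub> \<alpha> a"
  obtains h where "h \<in> alg_hom \<T> T"
    "\<And>a b. a \<in> carrier A \<Longrightarrow> b \<in> carrier B \<Longrightarrow> h (pure_tensor a b) = \<alpha> a \<otimes>\<^bsub>T\<^esub> \<beta> b"
proof -
  interpret T: unital_algebra T by fact
  note \<alpha>' = \<alpha>[unfolded alg_hom_iff] and \<beta>' = \<beta>[unfolded alg_hom_iff]
  have cl: "\<alpha> a \<in> carrier T" "\<beta> b \<in> carrier T" if "a \<in> carrier A" "b \<in> carrier B" for a b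
    using that \<alpha>' \<beta>' by auto
  define \<phi> where "\<phi> = (\<lambda>(a, b). \<alpha> a \<otimes>\<^bsub>T\<^esub> \<beta> b)"
  \<comment> \<open>Here \<open>comm\<close> is used, to move \<open>\<alpha> a'\<close> past
    \<open>\<beta> b\<close>.\<close>
  have mult: "(\<alpha> a \<otimes>\<^bsub>T\<^esub> \<alpha> a') \<otimes>\<^bsub>T\<^esub> (\<beta> b \<otimes>\<^bsub>T\<^esub> \<beta> b') = (\<alpha> a \<otimes>\<^bsub>T\<^esub> \<beta> b) \<otimes>\<^bsub>T\<^esub> (\<alpha> a' \<otimes>\<^bsub>T\<^esub> \<beta> b')"
    if "a \<in> carrier A" "b \<in> carrier B" "a' \<in> carrier A" "b' \<in> carrier B" for a b a' b'
  proof -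
    have "\<alpha> a' \<otimes>\<^bsub>T\<^esub> (\<beta> b \<otimes>\<^bsub>T\<^esub> \<beta> b') = \<beta> b \<otimes>\<^bsub>T\<^esub> (\<alpha> a' \<otimes>\<^bsub>T\<^esub> \<beta> b')"
      using that cl comm[of a' b] by (simp flip: T.m_assoc)
    then show ?thesis using that cl by (simp add: T.m_assoc)
  qed
  obtain g where g: "g \<in> alg_hom \<M> T"
    and g_single: "\<And>u. u \<in> carrier (A \<times>\<times> B) \<Longrightarrow> g (Poly_Mapping.single u 1) = \<phi> u"
  proof (rule monoid_algebra_lift[OF DirProd_multiplicative_monoid T, of \<phi>])
    fix u v assume u: "u \<in> carrier (A \<times>\<times> B)"
    show "\<phi> u \<in> carrier T" using u cl by (auto simp: \<phi>_def DirProd_def)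
    assume "v \<in> carrier (A \<times>\<times> B)"
    with u show "\<phi> (u \<otimes>\<^bsub>A \<times>\<times> B\<^esub> v) = \<phi> u \<otimes>\<^bsub>T\<^esub> \<phi> v"
      using \<alpha>' \<beta>' by (auto simp: \<phi>_def DirProd_def mult)
  next
    show "\<phi> \<one>\<^bsub>A \<times>\<times> B\<^esub> = \<one>\<^bsub>T\<^esub>" using \<alpha>' \<beta>' by (simp add: \<phi>_def DirProd_def)
  qed (erule that, simp)
  note g' = g[unfolded alg_hom_iff]
  have g_pair: "g (Poly_Mapping.single (a, b) 1) = \<alpha> a \<otimes>\<^bsub>T\<^esub> \<beta> b" if "a \<in> carrier A" "b \<in> carrier B" for a b
    using that g_single by (simp add: \<phi>_def DirProd_def)
  have "g x = \<zero>\<^bsub>T\<^esub>" if "x \<in> Idl\<^bsub>\<M>\<^esub> (tensor_relations A B)" for x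
  proof (rule MI.genideal_kernel[OF T g tensor_relations_closed _ that])
    fix y assume "y \<in> tensor_relations A B"
    \<comment> \<open>Each of the four kinds of relation is a difference of two elements with equal
      image, so they can be treated uniformly.\<close>
    then obtain p q where y: "y = p \<ominus>\<^bsub>\<M>\<^esub> q" and pq: "p \<in> carrier \<M>" "q \<in> carrier \<M>" "g p = g q"
    proof -
      have *: thesis if "y = p \<ominus>\<^bsub>\<M>\<^esub> q" "p \<in> carrier \<M>" "q \<in> carrier \<M>" "g p = g q" for p q
        using \<open>\<And>p q. y = p \<ominus>\<^bsub>\<M>\<^esub> q \<Longrightarrow> p \<in> carrier \<M> \<Longrightarrow> q \<in> carrier \<M> \<Longrightarrow> g p = g q \<Longrightarrow> thesis\<close> that by blast
      show thesis
        using \<open>y \<in> tensor_relations A B\<close> unfolding tensor_relations_def Let_def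
        apply (elim UnE CollectE exE conjE)
        subgoal by (rule *, assumption)
            (use g' \<alpha>' cl in \<open>simp_all add: single_pair_closed g_pair T.l_distr\<close>)
        subgoal by (rule *, assumption)
            (use g' \<beta>' cl in \<open>simp_all add: single_pair_closed g_pair T.r_distr\<close>)
        subgoal by (rule *, assumption)
            (use g' \<alpha>' cl in \<open>simp_all add: single_pair_closed g_pair T.smult_mult_left\<close>)
        subgoal by (rule *, assumption)
            (use g' \<beta>' cl in \<open>simp_all add: single_pair_closed g_pair T.smult_mult_right\<close>)
        done
    qed
    show "g y = \<zero>\<^bsub>T\<^esub>"
      using pq g' unfolding y by (simp add: alg_hom_minus[OF MI.unital_algebra_axioms T g])
  qed
  then obtain h where "h \<in> alg_hom \<T> T"
    "\<And>x. x \<in> carrier \<M> \<Longrightarrow> h (Idl\<^bsub>\<M>\<^esub> (tensor_relations A B) +>\<^bsub>\<M>\<^esub> x) = g x"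
    using MI.quot_lift[OF T g] unfolding tensor_algebra_def by blast
  then show thesis
    using that by (auto simp: pure_tensor_def single_pair_closed g_pair)
qed

text \<open>A pure tensor is the product of its left part (a with 1) and its right part (1 with
  b).\<close>

lemma tensor_generated:
  assumes W: "unital_subalgebra \<T> W"
    and left: "\<And>a. a \<in> carrier A \<Longrightarrow> pure_tensor a \<one>\<^bsub>B\<^esub> \<in> W"
    and right: "\<And>b. b \<in> carrier B \<Longrightarrow> pure_tensor \<one>\<^bsub>A\<^esub> b \<in> W"
  shows "W = carrier \<T>"
proof -
  have pure: "pure_tensor a b \<in> W" if "a \<in> carrier A" "b \<in> carrier B" for a b
    using pure_tensor_mult[of a "\<one>\<^bsub>B\<^esub>" "\<one>\<^bsub>A\<^esub>" b] left[OF that(1)] right[OF that(2)] W that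
    unfolding unital_algebra.unital_subalgebra_iff[OF tensor_unital_algebra]
    by (metis A.one_closed A.r_one B.l_one B.one_closed)
  show ?thesis
    unfolding tensor_algebra_def
  proof (rule MI.quot_generated)
    show "unital_subalgebra (quot_algebra \<M> (Idl\<^bsub>\<M>\<^esub> (tensor_relations A B))) W"
      using W by (simp add: tensor_algebra_def)
    show "W' = carrier \<M>" if "unital_subalgebra \<M> W'"
      "(\<lambda>u. Poly_Mapping.single u 1) ` (carrier A \<times> carrier B) \<subseteq> W'" for W'
      using that by (intro monoid_algebra_generated DirProd_multiplicative_monoid) (auto simp: DirProd_def)
  qed (use pure in \<open>auto simp: single_pair_closed pure_tensor_def\<close>)
qed

end

section \<open>The algebras \<open>k\<^sup>n\<close>\<close>

lemma field_power_simps: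
  "carrier (field_power n) = {f. \<forall>i. i \<notin> {1..n} \<longrightarrow> f i = 0}"
  "f \<otimes>\<^bsub>field_power n\<^esub> g = (\<lambda>i. f i * g i)"
  "\<one>\<^bsub>field_power n\<^esub> = (\<lambda>i. if i \<in> {1..n} then 1 else 0)"
  "\<zero>\<^bsub>field_power n\<^esub> = (\<lambda>i. 0)"
  "f \<oplus>\<^bsub>field_power n\<^esub> g = (\<lambda>i. f i + g i)"
  "c \<odot>\<^bsub>field_power n\<^esub> f = (\<lambda>i. c * f i)"
  by (simp_all add: field_power_def)

lemma field_power_unital_algebra: "unital_algebra (field_power n :: ('k::field, nat \<Rightarrow> 'k) module)"
proof -
  have "abelian_group (field_power n :: ('k, nat \<Rightarrow> 'k) module)"
  proof (rule abelian_groupI)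
    fix f :: "nat \<Rightarrow> 'k" assume "f \<in> carrier (field_power n)"
    then show "\<exists>g\<in>carrier (field_power n). g \<oplus>\<^bsub>field_power n\<^esub> f = \<zero>\<^bsub>field_power n\<^esub>"
      by (intro bexI[of _ "\<lambda>i. - f i"]) (auto simp: field_power_simps)
  qed (auto simp: field_power_simps add_ac)
  moreover have "Group.monoid (field_power n :: ('k, nat \<Rightarrow> 'k) module)"
    by (intro monoidI) (auto simp: field_power_simps mult_ac)
  ultimately have "ring (field_power n :: ('k, nat \<Rightarrow> 'k) module)"
    by (intro ringI) (auto simp: field_power_simps algebra_simps)
  then show ?thesis
    by (intro unital_algebra.intro unital_algebra_axioms.intro) (auto simp: field_power_simps algebra_simps)
qed

lemma prim_idem_closed: "i \<in> {1..n} \<Longrightarrow> prim_idem i \<in> carrier (field_power n)"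
  by (auto simp: field_power_simps prim_idem_def)

text \<open>Converts the class sums P_j into indicator functions, for which products and membership
  are pointwise matters.\<close>

lemma finsum_prim_idem:
  assumes "J \<subseteq> {1..n}"
  shows "(\<Oplus>\<^bsub>field_power n\<^esub>i\<in>J. prim_idem i) = (\<lambda>i. if i \<in> J then 1 else (0::'k::field))"
proof -
  interpret unital_algebra "field_power n :: ('k, nat \<Rightarrow> 'k) module" by (rule field_power_unital_algebra)
  have "finite J" using assms by (rule finite_subset) simp
  then show ?thesis using assms
  proof (induction J rule: finite_induct)
    case empty
    then show ?case by (simp add: field_power_simps)
  next
    case (insert j J)
    then have "(\<Oplus>\<^bsub>field_power n\<^esub>i\<in>insert j J. prim_idem i) =
      prim_idem j \<oplus>\<^bsub>field_power n\<^esub> (\<Oplus>\<^bsub>field_power n\<^esub>i\<in>J. prim_idem i :: nat \<Rightarrow> 'k)"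
      using prim_idem_closed by (intro finsum_insert) auto
    then show ?case using insert by (auto simp: field_power_simps prim_idem_def)
  qed
qed

lemma field_power_generated:
  assumes W: "lin_subspace (field_power n) W" and idem: "\<And>i. i \<in> {1..n} \<Longrightarrow> prim_idem i \<in> W"
  shows "W = carrier (field_power n :: ('k::field, nat \<Rightarrow> 'k) module)"
proof -
  interpret unital_algebra "field_power n :: ('k, nat \<Rightarrow> 'k) module" by (rule field_power_unital_algebra)
  note W' = W[unfolded lin_subspace_iff]
  have "f \<in> W" if f: "f \<in> carrier (field_power n)" for f
  proof -
    have "(\<lambda>i. if i \<le> m then f i else 0) \<in> W" if "m \<le> n" for m
      using that
    proof (induction m)
      case 0
      \<comment> \<open>Supports start at 1, so the truncation at 0 is the zero function.\<close>
      have "(\<lambda>i. if i \<le> 0 then f i else 0) = (\<lambda>i. 0)" using f by (auto simp: field_power_simps)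
      then show ?case using W' by (simp add: field_power_simps)
    next
      case (Suc m)
      have "(\<lambda>i. if i \<le> Suc m then f i else 0) =
        (\<lambda>i. if i \<le> m then f i else 0) \<oplus>\<^bsub>field_power n\<^esub> f (Suc m) \<odot>\<^bsub>field_power n\<^esub> prim_idem (Suc m)"
        by (auto simp: field_power_simps prim_idem_def fun_eq_iff le_Suc_eq)
      then show ?case using Suc W' idem[of "Suc m"] by simp
    qed
    from this[of n] have "(\<lambda>i. if i \<le> n then f i else 0) \<in> W" by simp
    moreover have "(\<lambda>i. if i \<le> n then f i else 0) = f" using f by (auto simp: field_power_simps)
    ultimately show ?thesis by simp
  qed
  then show ?thesis using W' by blast
qed

section \<open>Irreducible sets of matrices\<close>

lemma mat_algebra_simps:
  "carrier (mat_algebra n) = carrier_mat n n"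
  "M \<otimes>\<^bsub>mat_algebra n\<^esub> N = M * N"
  "\<one>\<^bsub>mat_algebra n\<^esub> = 1\<^sub>m n"
  "\<zero>\<^bsub>mat_algebra n\<^esub> = 0\<^sub>m n n"
  "M \<oplus>\<^bsub>mat_algebra n\<^esub> N = M + N"
  "c \<odot>\<^bsub>mat_algebra n\<^esub> M = c \<cdot>\<^sub>m M"
  by (simp_all add: mat_algebra_def ring_mat_def module.defs)

lemma smult_mat_mult_mat_vec_assoc:
  "M \<in> carrier_mat n m \<Longrightarrow> w \<in> carrier_vec m \<Longrightarrow> (c \<cdot>\<^sub>m M) *\<^sub>v w = c \<cdot>\<^sub>v (M *\<^sub>v w)"
  by (intro eq_vecI) (auto simp: scalar_prod_def sum_distrib_left mult.assoc)

lemma mat_algebra_unital_algebra: "unital_algebra (mat_algebra n :: ('k::field, 'k mat) module)"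
proof (rule unital_algebra.intro)
  show "ring (mat_algebra n :: ('k, 'k mat) module)"
    unfolding mat_algebra_def by (rule ring_mat)
  show "unital_algebra_axioms (mat_algebra n :: ('k, 'k mat) module)"
    by (rule unital_algebra_axioms.intro)
      (auto simp: mat_algebra_simps add_smult_distrib_left_mat add_smult_distrib_right_mat
        mult_smult_distrib mult_smult_assoc_mat mult.assoc intro!: eq_matI)
qed

lemma vec_lin_subspace_iff:
  "lin_subspace (module_vec TYPE('k::field) n) W \<longleftrightarrow> W \<subseteq> carrier_vec n \<and> 0\<^sub>v n \<in> W \<and>
     (\<forall>x\<in>W. \<forall>y\<in>W. x + y \<in> W) \<and> (\<forall>c. \<forall>x\<in>W. c \<cdot>\<^sub>v x \<in> W)"
proof -
  let ?M = "module_vec TYPE('k) n"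
  have grp: "abelian_group ?M"
  proof (rule abelian_groupI)
    fix x assume "x \<in> carrier ?M"
    then show "\<exists>y\<in>carrier ?M. y \<oplus>\<^bsub>?M\<^esub> x = \<zero>\<^bsub>?M\<^esub>"
      by (intro bexI[of _ "- x"]) (auto simp: module_vec_simps)
  qed (auto simp: module_vec_simps comm_add_vec)
  have inv: "inv\<^bsub>add_monoid ?M\<^esub> x = - 1 \<cdot>\<^sub>v x" if "x \<in> carrier_vec n" for x
  proof -
    interpret abelian_group ?M by fact
    have "\<ominus>\<^bsub>?M\<^esub> x = - 1 \<cdot>\<^sub>v x"
      using that by (intro minus_equality) (auto simp: module_vec_simps intro!: eq_vecI)
    then show ?thesis by (simp add: a_inv_def)
  qed
  show ?thesis
    unfolding lin_subspace_def submodule_def submodule_axioms_def subgroup_def ring_of_type_algebra_def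
    by (auto simp: module_vec_simps inv[unfolded module_vec_simps] subset_iff)
qed

text \<open>Irreducibility attached to a set of matrices instead of a representation, so that it can
  be moved between an algebra and its generators. Dimension zero is not excluded here; positivity of
  n is carried separately.\<close>

definition irreducible_mats :: "nat \<Rightarrow> 'k::field mat set \<Rightarrow> bool" where
  "irreducible_mats n \<G> \<longleftrightarrow>
     (\<forall>W. lin_subspace (module_vec TYPE('k) n) W \<and> (\<forall>M\<in>\<G>. \<forall>w\<in>W. M *\<^sub>v w \<in> W) \<longrightarrow>
        W = {0\<^sub>v n} \<or> W = carrier_vec n)"

lemma irreducible_matsD:
  "irreducible_mats n \<G> \<Longrightarrow> lin_subspace (module_vec TYPE('k::field) n) W \<Longrightarrow>
     (\<And>M w. M \<in> \<G> \<Longrightarrow> w \<in> W \<Longrightarrow> M *\<^sub>v w \<in> W) \<Longrightarrow> w \<in> W \<Longrightarrow> w \<noteq> 0\<^sub>v n \<Longrightarrow> W = carrier_vec n"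
  unfolding irreducible_mats_def by blast

lemma irreducible_mats_mono: "irreducible_mats n \<G> \<Longrightarrow> \<G> \<subseteq> \<H> \<Longrightarrow> irreducible_mats n \<H>"
  unfolding irreducible_mats_def by blast

lemma irreducible_rep_iff:
  "irreducible_rep S n \<rho> \<longleftrightarrow> n > 0 \<and> \<rho> \<in> alg_hom S (mat_algebra n) \<and> irreducible_mats n (\<rho> ` carrier S)"
  unfolding irreducible_rep_def irreducible_mats_def by auto

text \<open>The elements that map a given subspace into itself form a unital subalgebra. A subspace
  invariant under the generators is therefore invariant under the whole algebra.\<close>

lemma irreducible_rep_generated:
  fixes S :: "('k::field, 'a) module"
  assumes S: "unital_algebra S" and \<rho>: "irreducible_rep S n \<rho>"
    and G: "G \<subseteq> carrier S"
    and gen: "\<And>W. unital_subalgebra S W \<Longrightarrow> G \<subseteq> W \<Longrightarrow> W = carrier S"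
  shows "irreducible_mats n (\<rho> ` G)"
  unfolding irreducible_mats_def
proof (intro allI impI, elim conjE)
  fix W :: "'k vec set"
  assume W: "lin_subspace (module_vec TYPE('k) n) W" and inv: "\<forall>M\<in>\<rho> ` G. \<forall>w\<in>W. M *\<^sub>v w \<in> W"
  note W' = W[unfolded vec_lin_subspace_iff]
  interpret unital_algebra S by fact
  have hom: "\<rho> \<in> alg_hom S (mat_algebra n)" and irr: "irreducible_mats n (\<rho> ` carrier S)"
    using \<rho> by (auto simp: irreducible_rep_iff)
  note hom' = hom[unfolded alg_hom_iff mat_algebra_simps]
  have WC: "w \<in> carrier_vec n" if "w \<in> W" for w using that W' by blast
  have \<rho>C: "\<rho> x \<in> carrier_mat n n" if "x \<in> carrier S" for x using that hom' by blast
  have "unital_subalgebra S {x \<in> carrier S. \<forall>w\<in>W. \<rho> x *\<^sub>v w \<in> W}"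
    unfolding unital_subalgebra_iff
  proof (intro conjI ballI allI)
    show "\<one>\<^bsub>S\<^esub> \<in> {x \<in> carrier S. \<forall>w\<in>W. \<rho> x *\<^sub>v w \<in> W}"
      using hom' WC by (simp add: one_mult_mat_vec)
  next
    fix x y assume xy: "x \<in> {x \<in> carrier S. \<forall>w\<in>W. \<rho> x *\<^sub>v w \<in> W}" "y \<in> {x \<in> carrier S. \<forall>w\<in>W. \<rho> x *\<^sub>v w \<in> W}"
    have "(\<rho> x + \<rho> y) *\<^sub>v w \<in> W" if "w \<in> W" for w
      using xy W' that WC[OF that] \<rho>C by (simp add: add_mult_distrib_mat_vec[of _ n n])
    then show "x \<oplus>\<^bsub>S\<^esub> y \<in> {x \<in> carrier S. \<forall>w\<in>W. \<rho> x *\<^sub>v w \<in> W}" using xy hom' by simp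
    have "(\<rho> x * \<rho> y) *\<^sub>v w \<in> W" if "w \<in> W" for w
      using xy that WC[OF that] \<rho>C by (simp add: assoc_mult_mat_vec[of _ n n _ n])
    then show "x \<otimes>\<^bsub>S\<^esub> y \<in> {x \<in> carrier S. \<forall>w\<in>W. \<rho> x *\<^sub>v w \<in> W}" using xy hom' by simp
  next
    fix c x assume x: "x \<in> {x \<in> carrier S. \<forall>w\<in>W. \<rho> x *\<^sub>v w \<in> W}"
    have "(c \<cdot>\<^sub>m \<rho> x) *\<^sub>v w \<in> W" if "w \<in> W" for w
      using x W' that WC[OF that] \<rho>C by (simp add: smult_mat_mult_mat_vec_assoc[of _ n n])
    then show "c \<odot>\<^bsub>S\<^esub> x \<in> {x \<in> carrier S. \<forall>w\<in>W. \<rho> x *\<^sub>v w \<in> W}" using x hom' by simp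
  qed auto
  then have "{x \<in> carrier S. \<forall>w\<in>W. \<rho> x *\<^sub>v w \<in> W} = carrier S"
    using inv G by (intro gen) auto
  then show "W = {0\<^sub>v n} \<or> W = carrier_vec n"
    using irr W unfolding irreducible_mats_def by blast
qed

section \<open>Eigenvectors, Schur's lemma and bounds on dimensions\<close>

lemma mat_eqI_vec:
  assumes "M \<in> carrier_mat n n" "N \<in> carrier_mat n n"
    and "\<And>w. w \<in> carrier_vec n \<Longrightarrow> M *\<^sub>v w = N *\<^sub>v (w :: 'k::comm_ring_1 vec)"
  shows "M = N"
proof (rule eq_matI)
  fix i j assume "i < dim_row N" "j < dim_col N"
  then have "i < n" "j < n" using assms by auto
  then have "(M *\<^sub>v unit_vec n j) $ i = (N *\<^sub>v unit_vec n j) $ i" using assms(3) by simp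
  then show "M $$ (i, j) = N $$ (i, j)" using assms(1,2) \<open>i < n\<close> \<open>j < n\<close> by simp
qed (use assms in auto)

text \<open>The characteristic polynomial has degree n > 0, hence a root. This is the point at which
  algebraic closedness is used.\<close>

lemma eigenvector_exists:
  fixes M :: "'k::alg_closed_field mat"
  assumes "M \<in> carrier_mat n n" "n > 0"
  obtains e v where "v \<in> carrier_vec n" "v \<noteq> 0\<^sub>v n" "M *\<^sub>v v = e \<cdot>\<^sub>v v"
proof -
  have "degree (char_poly M) > 0" using degree_monic_char_poly[OF assms(1)] assms(2) by simp
  then obtain e where "poly (char_poly M) e = 0" using alg_closed_imp_poly_has_root by blast
  then have "eigenvalue M e" using eigenvalue_root_char_poly[OF assms(1)] by simp
  then show thesis using that assms(1) by (auto simp: eigenvalue_def eigenvector_def)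
qed

text \<open>Schur's lemma: an eigenspace of \<open>M\<close> is invariant under everything that
  commutes with \<open>M\<close>, and it is nonzero, so it is the whole space.\<close>

lemma irreducible_mats_schur:
  fixes \<G> :: "'k::alg_closed_field mat set"
  assumes irr: "irreducible_mats n \<G>" and n: "n > 0" and \<G>: "\<G> \<subseteq> carrier_mat n n"
    and M: "M \<in> carrier_mat n n" and comm: "\<And>N. N \<in> \<G> \<Longrightarrow> M * N = N * M"
  obtains c where "M = c \<cdot>\<^sub>m 1\<^sub>m n"
proof -
  obtain e v where v: "v \<in> carrier_vec n" "v \<noteq> 0\<^sub>v n" "M *\<^sub>v v = e \<cdot>\<^sub>v v"
    using eigenvector_exists[OF M n] .
  define W where "W = {w \<in> carrier_vec n. M *\<^sub>v w = e \<cdot>\<^sub>v w}"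
  have "lin_subspace (module_vec TYPE('k) n) W"
    unfolding vec_lin_subspace_iff W_def
    using M by (auto simp: mult_add_distrib_mat_vec smult_add_distrib_vec mult_mat_vec smult_smult_assoc mult.commute)
  moreover have "N *\<^sub>v w \<in> W" if "N \<in> \<G>" "w \<in> W" for N w
  proof -
    have N: "N \<in> carrier_mat n n" and w: "w \<in> carrier_vec n" using that \<G> by (auto simp: W_def)
    have "M *\<^sub>v (N *\<^sub>v w) = (M * N) *\<^sub>v w" using M N w by simp
    also have "\<dots> = N *\<^sub>v (M *\<^sub>v w)" using M N w comm[OF that(1)] by simp
    also have "\<dots> = e \<cdot>\<^sub>v (N *\<^sub>v w)" using N w that(2) by (simp add: W_def mult_mat_vec)
    finally show ?thesis using N w by (simp add: W_def)
  qed
  moreover have "v \<in> W" using v by (simp add: W_def)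
  ultimately have "W = carrier_vec n" using v(2) by (rule irreducible_matsD[OF irr])
  then have "M *\<^sub>v w = (e \<cdot>\<^sub>m 1\<^sub>m n) *\<^sub>v w" if "w \<in> carrier_vec n" for w
    using that by (auto simp: W_def smult_mat_mult_mat_vec_assoc[of _ n n])
  then have "M = e \<cdot>\<^sub>m 1\<^sub>m n" using M by (intro mat_eqI_vec[of _ n]) auto
  then show thesis using that by blast
qed

text \<open>If two vectors spanned the space, the identity matrix would be a sum of two matrices of
  rank at most one, and the 3x3 minors of such a sum vanish.\<close>

lemma vec_spanned_by_two:
  assumes v: "v \<in> carrier_vec n" and w: "w \<in> carrier_vec n"
    and span: "\<And>x. x \<in> carrier_vec n \<Longrightarrow> \<exists>a b. x = a \<cdot>\<^sub>v v + b \<cdot>\<^sub>v (w :: 'k::field vec)"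
  shows "n \<le> 2"
proof (rule ccontr)
  assume "\<not> n \<le> 2"
  then have n: "2 < n" by simp
  have "\<forall>i. \<exists>a b. unit_vec n i = a \<cdot>\<^sub>v v + b \<cdot>\<^sub>v w"
    using span[OF unit_vec_carrier] by blast
  then obtain a b where ab: "\<And>i. unit_vec n i = a i \<cdot>\<^sub>v v + b i \<cdot>\<^sub>v w"
    by metis
  have e: "(if i = j then 1 else 0) = a i * v $ j + b i * w $ j" if "i < n" "j < n" for i j
  proof -
    have "unit_vec n i $ j = (a i \<cdot>\<^sub>v v + b i \<cdot>\<^sub>v w) $ j" using ab by simp
    then show ?thesis using that v w by (auto split: if_splits)
  qed
  define m where "m i j = a i * v $ j + b i * w $ j" for i j
  have m: "m i j = (if i = j then 1 else 0)" if "i < n" "j < n" for i j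
    using e[OF that] by (simp add: m_def)
  \<comment> \<open>The determinant of the upper left 3x3 corner, expanded along its first row: 0 by
    the shape of \<open>m\<close>, but 1 for the identity matrix.\<close>
  have "m 0 0 * (m 1 1 * m 2 2 - m 1 2 * m 2 1) - m 0 1 * (m 1 0 * m 2 2 - m 1 2 * m 2 0)
      + m 0 2 * (m 1 0 * m 2 1 - m 1 1 * m 2 0) = 0"
    unfolding m_def by (simp add: algebra_simps)
  then show False using n by (simp add: m)
qed

text \<open>Scalar matrices preserve every line, and the first coordinate axis is a proper nonzero
  subspace once n > 1.\<close>

lemma irreducible_mats_scalar:
  fixes \<G> :: "'k::field mat set"
  assumes irr: "irreducible_mats n \<G>" and scal: "\<And>M. M \<in> \<G> \<Longrightarrow> \<exists>c. M = c \<cdot>\<^sub>m 1\<^sub>m n"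
  shows "n \<le> 1"
proof (rule ccontr)
  assume "\<not> n \<le> 1"
  then have n: "1 < n" by simp
  define W where "W = {w \<in> carrier_vec n. \<forall>i<n. i \<noteq> 0 \<longrightarrow> w $ i = (0::'k)}"
  have "lin_subspace (module_vec TYPE('k) n) W"
    unfolding vec_lin_subspace_iff W_def by auto
  moreover have "M *\<^sub>v w \<in> W" if "M \<in> \<G>" "w \<in> W" for M w
  proof -
    obtain c where "M = c \<cdot>\<^sub>m 1\<^sub>m n" using scal \<open>M \<in> \<G>\<close> by blast
    then have "M *\<^sub>v w = c \<cdot>\<^sub>v w" using that(2) by (simp add: W_def smult_mat_mult_mat_vec_assoc[of _ n n])
    then show ?thesis using that(2) by (auto simp: W_def)
  qed
  moreover have "unit_vec n 0 \<in> W" by (auto simp: W_def)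
  moreover have "unit_vec n 0 \<noteq> (0\<^sub>v n :: 'k vec)" using n by simp
  ultimately have "W = carrier_vec n" by (rule irreducible_matsD[OF irr])
  then have "unit_vec n 1 \<in> W" by simp
  then show False using n by (auto simp: W_def)
qed

text \<open>The element is (P - Q)^2, expanded by idempotency. Multiplication by P on either side
  gives P - PQP, and by Q on either side Q - QPQ, so it commutes with both. The third equation lets
  a scalar value of it determine PQP.\<close>

lemma two_idempotents_commute:
  fixes P Q :: "'k::field mat"
  assumes PQ: "P \<in> carrier_mat n n" "Q \<in> carrier_mat n n" and idem: "P * P = P" "Q * Q = Q"
  shows "(P + Q - (P * Q + Q * P)) * P = P * (P + Q - (P * Q + Q * P))"
    "(P + Q - (P * Q + Q * P)) * Q = Q * (P + Q - (P * Q + Q * P))"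
    "P * (P + Q - (P * Q + Q * P)) = P - P * Q * P"
proof -
  have aux: "A + B - (C + A) = B - C" "A + B - (B + C) = A - C"
    "A + B - (A + C) = B - C" "A + B - (C + B) = A - C"
    if "A \<in> carrier_mat n n" "B \<in> carrier_mat n n" "C \<in> carrier_mat n n" for A B C :: "'k mat"
    using that by (auto intro!: eq_matI)
  have c: "P * Q \<in> carrier_mat n n" "Q * P \<in> carrier_mat n n" using PQ by auto
  have 1: "P * (P * Q) = P * Q" "Q * (Q * P) = Q * P"
    using PQ idem by (simp_all flip: assoc_mult_mat[of _ n n _ n _ n])
  have 2: "P * Q * Q = P * Q" "Q * P * P = Q * P"
    using PQ idem by simp_all
  have d: "M * (P + Q - (P * Q + Q * P)) = M * P + M * Q - (M * (P * Q) + M * (Q * P))"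
    "(P + Q - (P * Q + Q * P)) * M = P * M + Q * M - (P * Q * M + Q * P * M)"
    if "M \<in> carrier_mat n n" for M
    using that PQ c by (simp_all add: mult_minus_distrib_mat[of _ n n _ n] mult_add_distrib_mat[of _ n n _ n]
      minus_mult_distrib_mat[of _ n n _ _ n] add_mult_distrib_mat[of _ n n _ _ n] del: assoc_mult_mat)
  have c3: "P * (Q * P) \<in> carrier_mat n n" "Q * (P * Q) \<in> carrier_mat n n" using PQ by auto
  have L: "P * (P + Q - (P * Q + Q * P)) = P - P * (Q * P)"
    using d(1)[OF PQ(1)] PQ c c3 by (simp add: idem 1 aux)
  moreover have "(P + Q - (P * Q + Q * P)) * P = P - P * (Q * P)"
    using d(2)[OF PQ(1)] PQ c c3 by (simp add: idem 2 aux assoc_mult_mat[of _ n n _ n _ n])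
  moreover have "Q * (P + Q - (P * Q + Q * P)) = Q - Q * (P * Q)"
    using d(1)[OF PQ(2)] PQ c c3 by (simp add: idem 1 aux)
  moreover have "(P + Q - (P * Q + Q * P)) * Q = Q - Q * (P * Q)"
    using d(2)[OF PQ(2)] PQ c c3 by (simp add: idem 2 aux assoc_mult_mat[of _ n n _ n _ n])
  ultimately show "(P + Q - (P * Q + Q * P)) * P = P * (P + Q - (P * Q + Q * P))"
    "(P + Q - (P * Q + Q * P)) * Q = Q * (P + Q - (P * Q + Q * P))"
    "P * (P + Q - (P * Q + Q * P)) = P - P * Q * P"
    using PQ by (simp_all add: assoc_mult_mat[of _ n n _ n _ n])
qed

lemma irreducible_two_idempotents:
  fixes P Q :: "'k::alg_closed_field mat"
  assumes irr: "irreducible_mats n {P, Q}" and n: "n > 0"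
    and PQ: "P \<in> carrier_mat n n" "Q \<in> carrier_mat n n" and idem: "P * P = P" "Q * Q = Q"
  shows "n \<le> 2"
proof -
  have "P + Q - (P * Q + Q * P) \<in> carrier_mat n n" using PQ by (intro minus_carrier_mat) auto
  moreover have "(P + Q - (P * Q + Q * P)) * N = N * (P + Q - (P * Q + Q * P))" if "N \<in> {P, Q}" for N
    using that two_idempotents_commute(1,2)[OF PQ idem] by blast
  ultimately obtain c where c: "P + Q - (P * Q + Q * P) = c \<cdot>\<^sub>m 1\<^sub>m n"
    using irreducible_mats_schur[OF irr n] PQ by blast
  \<comment> \<open>Schur's lemma has made (P - Q)^2 the scalar c; multiplied by P this reads P -
    PQP = cP.\<close>
  have PQP: "P * Q * P = (1 - c) \<cdot>\<^sub>m P"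
  proof -
    have "P - P * Q * P = c \<cdot>\<^sub>m P"
      using two_idempotents_commute(3)[OF PQ idem] PQ unfolding c
      by (simp add: mult_smult_distrib[of _ n n _ n])
    moreover have "N = (1 - c) \<cdot>\<^sub>m P" if "P - N = c \<cdot>\<^sub>m P" "N \<in> carrier_mat n n" for N
    proof (rule eq_matI)
      fix i j assume "i < dim_row ((1 - c) \<cdot>\<^sub>m P)" "j < dim_col ((1 - c) \<cdot>\<^sub>m P)"
      moreover have "(P - N) $$ (i, j) = (c \<cdot>\<^sub>m P) $$ (i, j)" using that by simp
      ultimately show "N $$ (i, j) = ((1 - c) \<cdot>\<^sub>m P) $$ (i, j)"
        using PQ(1) that(2) by (auto simp: algebra_simps)
    qed (use that PQ in auto)
    moreover have "P * Q * P \<in> carrier_mat n n" using PQ by auto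
    ultimately show ?thesis by blast
  qed
  \<comment> \<open>These two equations make span(v, Qv) invariant under P. For nonzero P take v =
    Pu, with d = 1 and e = 1 - c; for P = 0 any nonzero vector works, with d = e = 0.\<close>
  obtain v d e where v: "v \<in> carrier_vec n" "v \<noteq> 0\<^sub>v n" "P *\<^sub>v v = d \<cdot>\<^sub>v v" "P *\<^sub>v (Q *\<^sub>v v) = e \<cdot>\<^sub>v v"
  proof (cases "\<exists>u\<in>carrier_vec n. P *\<^sub>v u \<noteq> 0\<^sub>v n")
    case True
    then obtain u where u: "u \<in> carrier_vec n" "P *\<^sub>v u \<noteq> 0\<^sub>v n" by blast
    have "P *\<^sub>v (Q *\<^sub>v (P *\<^sub>v u)) = (P * Q * P) *\<^sub>v u"
      using PQ u by (simp add: assoc_mult_mat_vec[of _ n n _ n])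
    also have "\<dots> = (1 - c) \<cdot>\<^sub>v (P *\<^sub>v u)" using PQ u unfolding PQP by (simp add: smult_mat_mult_mat_vec_assoc[of _ n n])
    finally have "P *\<^sub>v (Q *\<^sub>v (P *\<^sub>v u)) = (1 - c) \<cdot>\<^sub>v (P *\<^sub>v u)" .
    moreover have "P *\<^sub>v (P *\<^sub>v u) = 1 \<cdot>\<^sub>v (P *\<^sub>v u)"
      using PQ u idem by (simp flip: assoc_mult_mat_vec[of _ n n _ n])
    ultimately show ?thesis using that[of "P *\<^sub>v u" 1 "1 - c"] u PQ by simp
  next
    case False
    then have P0: "P *\<^sub>v u = 0\<^sub>v n" if "u \<in> carrier_vec n" for u using that by blast
    have z: "0 \<cdot>\<^sub>v unit_vec n 0 = (0\<^sub>v n :: 'k vec)" by (rule eq_vecI) auto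
    have "unit_vec n 0 \<noteq> (0\<^sub>v n :: 'k vec)" using n by simp
    moreover have "P *\<^sub>v unit_vec n 0 = 0 \<cdot>\<^sub>v unit_vec n 0" unfolding z by (rule P0) simp
    moreover have "P *\<^sub>v (Q *\<^sub>v unit_vec n 0) = 0 \<cdot>\<^sub>v unit_vec n 0"
      unfolding z by (rule P0) (use PQ in simp)
    ultimately show ?thesis by (rule that[OF unit_vec_carrier])
  qed
  have Qv: "Q *\<^sub>v v \<in> carrier_vec n" using PQ v by simp
  have QQv: "Q *\<^sub>v (Q *\<^sub>v v) = Q *\<^sub>v v" using assoc_mult_mat_vec[OF PQ(2,2) v(1)] idem(2) by simp
  define W where "W = {a \<cdot>\<^sub>v v + b \<cdot>\<^sub>v (Q *\<^sub>v v) | a b. True}"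
  have W: "x \<in> W \<longleftrightarrow> (\<exists>a b. x = a \<cdot>\<^sub>v v + b \<cdot>\<^sub>v (Q *\<^sub>v v))" for x by (auto simp: W_def)
  have "lin_subspace (module_vec TYPE('k) n) W"
    unfolding vec_lin_subspace_iff
  proof (intro conjI ballI allI subsetI)
    fix x assume "x \<in> W"
    then show "x \<in> carrier_vec n" using v Qv by (auto simp: W)
  next
    have "0\<^sub>v n = 0 \<cdot>\<^sub>v v + 0 \<cdot>\<^sub>v (Q *\<^sub>v v)" using v Qv PQ by (auto intro!: eq_vecI)
    then show "0\<^sub>v n \<in> W" unfolding W by blast
  next
    fix x y assume "x \<in> W" "y \<in> W"
    then obtain a b a' b' where xy: "x = a \<cdot>\<^sub>v v + b \<cdot>\<^sub>v (Q *\<^sub>v v)" "y = a' \<cdot>\<^sub>v v + b' \<cdot>\<^sub>v (Q *\<^sub>v v)"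
      unfolding W by blast
    have "x + y = (a + a') \<cdot>\<^sub>v v + (b + b') \<cdot>\<^sub>v (Q *\<^sub>v v)"
      unfolding xy using v Qv PQ by (auto intro!: eq_vecI simp: algebra_simps)
    then show "x + y \<in> W" unfolding W by blast
  next
    fix k x assume "x \<in> W"
    then obtain a b where x: "x = a \<cdot>\<^sub>v v + b \<cdot>\<^sub>v (Q *\<^sub>v v)" unfolding W by blast
    have "k \<cdot>\<^sub>v x = (k * a) \<cdot>\<^sub>v v + (k * b) \<cdot>\<^sub>v (Q *\<^sub>v v)"
      unfolding x using v Qv PQ by (auto intro!: eq_vecI simp: algebra_simps)
    then show "k \<cdot>\<^sub>v x \<in> W" unfolding W by blast
  qed
  moreover have "M *\<^sub>v x \<in> W" if M: "M \<in> {P, Q}" and "x \<in> W" for M x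
  proof -
    obtain a b where x: "x = a \<cdot>\<^sub>v v + b \<cdot>\<^sub>v (Q *\<^sub>v v)" using \<open>x \<in> W\<close> unfolding W by blast
    have z: "0 \<cdot>\<^sub>v y = 0\<^sub>v n" if "y \<in> carrier_vec n" for y :: "'k vec"
      using that by (intro eq_vecI) auto
    have "P *\<^sub>v x = (a * d + b * e) \<cdot>\<^sub>v v + 0 \<cdot>\<^sub>v (Q *\<^sub>v v)"
      unfolding x using v Qv PQ
      by (simp add: mult_add_distrib_mat_vec[of _ n n] mult_mat_vec[of _ n n] smult_smult_assoc add_smult_distrib_vec z)
    moreover have "Q *\<^sub>v x = 0 \<cdot>\<^sub>v v + (a + b) \<cdot>\<^sub>v (Q *\<^sub>v v)"
      unfolding x using v Qv PQ
      by (simp add: mult_add_distrib_mat_vec[of _ n n] mult_mat_vec[of _ n n] QQv add_smult_distrib_vec z)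
    ultimately show ?thesis using M unfolding W by blast
  qed
  moreover have "v \<in> W"
  proof -
    have "v = 1 \<cdot>\<^sub>v v + 0 \<cdot>\<^sub>v (Q *\<^sub>v v)" using v(1) Qv PQ by (auto intro!: eq_vecI)
    then show ?thesis unfolding W by blast
  qed
  ultimately have "W = carrier_vec n" using v(2) by (rule irreducible_matsD[OF irr])
  then have "\<exists>a b. x = a \<cdot>\<^sub>v v + b \<cdot>\<^sub>v (Q *\<^sub>v v)" if "x \<in> carrier_vec n" for x
    using that W[of x] by blast
  then show ?thesis using vec_spanned_by_two[OF v(1) Qv] by blast
qed

lemma mat_diag_mult_vec:
  "w \<in> carrier_vec n \<Longrightarrow> mat_diag n f *\<^sub>v w = vec n (\<lambda>r. f r * w $ r)"
  by (intro eq_vecI)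
    (simp_all add: mat_diag_def scalar_prod_def if_distrib[of "\<lambda>x. x * _"] sum.delta cong: if_cong)

lemma irreducible_mats_one: "irreducible_mats 1 (\<G> :: 'k::field mat set)"
  unfolding irreducible_mats_def
proof (intro allI impI, elim conjE)
  fix W :: "'k vec set" assume "lin_subspace (module_vec TYPE('k) 1) W"
  note W = this[unfolded vec_lin_subspace_iff]
  show "W = {0\<^sub>v 1} \<or> W = carrier_vec 1"
  proof (cases "W = {0\<^sub>v 1}")
    case False
    then obtain w where w: "w \<in> W" "w \<noteq> 0\<^sub>v 1" using W by blast
    then have wc: "w \<in> carrier_vec 1" using W by blast
    then have nz: "w $ 0 \<noteq> 0" using w(2) by (auto simp: vec_eq_iff)
    have "x \<in> W" if "x \<in> carrier_vec 1" for x
    proof -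
      have "x = (x $ 0 / w $ 0) \<cdot>\<^sub>v w" using that wc nz by (auto intro!: eq_vecI)
      moreover have "(x $ 0 / w $ 0) \<cdot>\<^sub>v w \<in> W" using W w(1) by blast
      ultimately show ?thesis by (simp only:)
    qed
    then show ?thesis using W by blast
  qed simp
qed

lemma subspace_eq_carrier_vec:
  fixes W :: "'k::field vec set"
  assumes W: "lin_subspace (module_vec TYPE('k) n) W" and unit: "\<And>i. i < n \<Longrightarrow> unit_vec n i \<in> W"
  shows "W = carrier_vec n"
proof -
  note W' = W[unfolded vec_lin_subspace_iff]
  have "w \<in> W" if w: "w \<in> carrier_vec n" for w
  proof -
    have "vec n (\<lambda>i. if i < m then w $ i else 0) \<in> W" if "m \<le> n" for m
      using that
    proof (induction m)
      case 0
      have "vec n (\<lambda>i. if i < 0 then w $ i else 0) = 0\<^sub>v n" by auto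
      then show ?case using W' by metis
    next
      case (Suc m)
      have "vec n (\<lambda>i. if i < Suc m then w $ i else 0) =
        vec n (\<lambda>i. if i < m then w $ i else 0) + w $ m \<cdot>\<^sub>v unit_vec n m"
        using Suc.prems by (intro eq_vecI) (auto simp: less_Suc_eq)
      then show ?case using Suc W' unit[of m] by simp
    qed
    from this[of n] have "vec n (\<lambda>i. if i < n then w $ i else 0) \<in> W" by simp
    moreover have "vec n (\<lambda>i. if i < n then w $ i else 0) = w" using w by (intro eq_vecI) auto
    ultimately show ?thesis by simp
  qed
  then show ?thesis using W' by blast
qed

section \<open>Two families of irreducible idempotents\<close>

text \<open>The idempotent sending (x, y) to (u, u) with u = 2x - y. Its coefficients sum to 1,
  which gives idempotency; in characteristic zero both are nonzero, which gives
  irreducibility.\<close>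

definition idem2 :: "'k::field mat" where
  "idem2 = mat 2 2 (\<lambda>(i, j). if j = 0 then 2 else - 1)"

lemma idem2_closed: "idem2 \<in> carrier_mat 2 2"
  by (simp add: idem2_def)

lemma idem2_mult_vec:
  "w \<in> carrier_vec 2 \<Longrightarrow> i < 2 \<Longrightarrow> (idem2 *\<^sub>v w) $ i = 2 * w $ 0 - w $ 1"
  by (simp add: idem2_def scalar_prod_def numeral_2_eq_2)

lemma idem2_idem: "idem2 * idem2 = (idem2 :: 'k::field mat)"
proof (rule mat_eqI_vec[of _ 2])
  fix w :: "'k vec" assume w: "w \<in> carrier_vec 2"
  note [simp] = idem2_mult_vec
  have Qw: "idem2 *\<^sub>v w \<in> carrier_vec 2" using idem2_closed w by (rule mult_mat_vec_carrier)
  have "idem2 *\<^sub>v (idem2 *\<^sub>v w) = idem2 *\<^sub>v w"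
  proof (rule eq_vecI)
    fix i assume "i < dim_vec (idem2 *\<^sub>v w)"
    then have "i < 2" by (simp add: idem2_def)
    then show "(idem2 *\<^sub>v (idem2 *\<^sub>v w)) $ i = (idem2 *\<^sub>v w) $ i" using w Qw by simp
  qed (use idem2_closed in auto)
  then show "(idem2 * idem2) *\<^sub>v w = idem2 *\<^sub>v w" using assoc_mult_mat_vec[OF idem2_closed idem2_closed w] by simp
qed (use idem2_closed mult_carrier_mat[OF idem2_closed idem2_closed] in auto)

text \<open>The coordinate projections break an invariant subspace into coordinate lines, so a
  nonzero one contains a unit vector. Both entries of its image under \<open>idem2\<close> are
  nonzero, which puts both unit vectors into the subspace.\<close>

lemma irreducible_idem2:
  "irreducible_mats 2 {mat_diag 2 (\<lambda>r. if r = 0 then 1 else 0), mat_diag 2 (\<lambda>r. if r = 1 then 1 else 0),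
     idem2 :: 'k::field_char_0 mat}"
  unfolding irreducible_mats_def
proof (intro allI impI, elim conjE)
  let ?e = "\<lambda>j r. if r = j then 1 else (0::'k)"
  fix W :: "'k vec set" assume sub: "lin_subspace (module_vec TYPE('k) 2) W"
    and inv: "\<forall>M\<in>{mat_diag 2 (?e 0), mat_diag 2 (?e 1), idem2}. \<forall>w\<in>W. M *\<^sub>v w \<in> W"
  note W = sub[unfolded vec_lin_subspace_iff]
  have split: "w $ j \<cdot>\<^sub>v unit_vec 2 j \<in> W" if w: "w \<in> W" and j: "j < 2" for w :: "'k vec" and j
  proof -
    have "mat_diag 2 (?e j) *\<^sub>v w \<in> W" using inv w j by (auto simp: less_2_cases_iff)
    moreover have "mat_diag 2 (?e j) *\<^sub>v w = w $ j \<cdot>\<^sub>v unit_vec 2 j"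
      using W w j by (intro eq_vecI) (auto simp: mat_diag_mult_vec subset_iff)
    ultimately show ?thesis by simp
  qed
  have unit: "unit_vec 2 j \<in> W" if "w \<in> W" "w $ j \<noteq> 0" "j < 2" for w :: "'k vec" and j
  proof -
    have "(1 / w $ j) \<cdot>\<^sub>v (w $ j \<cdot>\<^sub>v unit_vec 2 j) \<in> W" using split[OF that(1,3)] W by blast
    then show ?thesis using that by (simp add: smult_smult_assoc)
  qed
  show "W = {0\<^sub>v 2} \<or> W = carrier_vec 2"
  proof (cases "W = {0\<^sub>v 2}")
    case False
    then obtain w where w: "w \<in> W" "w \<noteq> 0\<^sub>v 2" using W by blast
    then have "w \<in> carrier_vec 2" using W by blast
    then obtain j where j: "j < 2" "w $ j \<noteq> 0" using w(2) by (auto simp: vec_eq_iff)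
    have "idem2 *\<^sub>v unit_vec 2 j \<in> W" using unit[OF w(1) j(2,1)] inv by blast
    moreover have "(idem2 *\<^sub>v unit_vec 2 j) $ i \<noteq> (0::'k)" if "i < 2" for i
      using that j(1) by (auto simp: idem2_mult_vec less_2_cases_iff)
    ultimately have "unit_vec 2 i \<in> W" if "i < 2" for i using unit that by blast
    then show ?thesis using subspace_eq_carrier_vec[OF sub] by blast
  qed simp
qed

text \<open>
  With respect to the decomposition of \<open>k\<^sup>3\<^sup>m\<close> into three blocks of size \<open>m\<close>, this is the idempotent
  \<open>(x, y, z) \<mapsto> (u, u, u)\<close> with \<open>u = S x + T y + (1 - S - T) z\<close>, where \<open>S\<close> is diagonal with the
  distinct eigenvalues \<open>1, \<dots>, m\<close> and \<open>T\<close> is the cyclic shift.  The coefficients sum to \<open>1\<close>, whence the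
  idempotency; irreducibility needs \<open>T\<close> and \<open>1 - S - T\<close> to be injective.
\<close>

definition cyclic_pred :: "nat \<Rightarrow> nat \<Rightarrow> nat" where
  "cyclic_pred m a = (if a = 0 then m - 1 else a - 1)"

definition idem3 :: "nat \<Rightarrow> 'k::field mat" where
  "idem3 m = mat (3 * m) (3 * m) (\<lambda>(r, c). let a = r mod m in
     (if c = a then of_nat (a + 1) else 0) + (if c = m + cyclic_pred m a then 1 else 0) +
     ((if c = 2 * m + a then - of_nat a else 0) + (if c = 2 * m + cyclic_pred m a then - 1 else 0)))"

lemma idem3_closed: "idem3 m \<in> carrier_mat (3 * m) (3 * m)"
  by (simp add: idem3_def)

lemma cyclic_pred_less: "0 < m \<Longrightarrow> a < m \<Longrightarrow> cyclic_pred m a < m"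
  by (auto simp: cyclic_pred_def)

text \<open>With (x, y, z) the blocks of \<open>w\<close>, the terms are the entries at
  \<open>a\<close> of S x, T y and (1 - S - T) z; the diagonal entry of 1 - S is 1 - (a + 1) = -a.
  The result depends on \<open>r\<close> only through its residue, so the three blocks of the image
  agree.\<close>

lemma idem3_mult_vec:
  assumes w: "w \<in> carrier_vec (3 * m)" and r: "r < 3 * m"
  defines "a \<equiv> r mod m"
  shows "(idem3 m *\<^sub>v w) $ r = (of_nat (a + 1) * w $ a + w $ (m + cyclic_pred m a))
     + (- of_nat a * w $ (2 * m + a) - w $ (2 * m + cyclic_pred m a) :: 'k::field)"
proof -
  have "m > 0" using r by (cases m) auto
  then have a: "a < m" "cyclic_pred m a < m" by (simp_all add: a_def cyclic_pred_less)
  have delta: "(\<Sum>c\<in>{0..<3 * m}. (if c = d then x else 0) * w $ c) = x * w $ d" if "d < 3 * m" for d and x :: 'k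
    using that by (simp add: if_distrib[of "\<lambda>y. y * _"] sum.delta cong: if_cong)
  show ?thesis
    using w r a unfolding idem3_def
    by (simp add: scalar_prod_def Let_def a_def[symmetric] distrib_right sum.distrib delta)
qed

lemma idem3_idem: "idem3 m * idem3 m = (idem3 m :: 'k::field mat)"
proof (rule mat_eqI_vec[of _ "3 * m"])
  fix w :: "'k vec" assume w: "w \<in> carrier_vec (3 * m)"
  have Qw: "idem3 m *\<^sub>v w \<in> carrier_vec (3 * m)" using idem3_closed w by (rule mult_mat_vec_carrier)
  have "idem3 m *\<^sub>v (idem3 m *\<^sub>v w) = idem3 m *\<^sub>v w"
  proof (rule eq_vecI)
    fix r assume "r < dim_vec (idem3 m *\<^sub>v w)"
    then have r: "r < 3 * m" by (simp add: idem3_def)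
    then have "m > 0" by (cases m) auto
    define a where "a = r mod m"
    have a: "a < m" "cyclic_pred m a < m" using \<open>m > 0\<close> by (simp_all add: a_def cyclic_pred_less)
    define u where "u b = (idem3 m *\<^sub>v w) $ b" for b
    have u: "u b = u b'" if "b < 3 * m" "b' < 3 * m" "b mod m = b' mod m" for b b'
      using that idem3_mult_vec[OF w] by (simp add: u_def)
    \<comment> \<open>A vector in the image repeats one block three times, so every entry met in the
      second application can be read in the first block.\<close>
    have eq: "u (m + cyclic_pred m a) = u (cyclic_pred m a)" "u (2 * m + a) = u a"
      "u (2 * m + cyclic_pred m a) = u (cyclic_pred m a)" "u r = u a"
      using a r less_le_trans[OF a(1), of "3 * m"] by (auto intro!: u simp: a_def)
    have "(idem3 m *\<^sub>v (idem3 m *\<^sub>v w)) $ r = (of_nat (a + 1) * u a + u (m + cyclic_pred m a))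
     + (- of_nat a * u (2 * m + a) - u (2 * m + cyclic_pred m a))"
      unfolding idem3_mult_vec[OF Qw r] u_def a_def ..
    also have "\<dots> = u r" unfolding eq by (simp add: algebra_simps)
    finally show "(idem3 m *\<^sub>v (idem3 m *\<^sub>v w)) $ r = (idem3 m *\<^sub>v w) $ r" by (simp add: u_def)
  qed (use idem3_closed[of m] in auto)
  then show "(idem3 m * idem3 m) *\<^sub>v w = idem3 m *\<^sub>v w"
    using assoc_mult_mat_vec[OF idem3_closed idem3_closed w] by simp
qed (use idem3_closed mult_carrier_mat[OF idem3_closed idem3_closed] in auto)

text \<open>The block projections split an invariant subspace into parts \<open>U 0\<close>,
  \<open>U 1\<close>, \<open>U 2\<close>, and \<open>idem3\<close> sends S of the first, T of the
  second and 1 - S - T of the third into all three. If \<open>U 0\<close> is nonzero, S isolates a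
  single position and T carries it around the cycle, which produces every unit vector. If
  \<open>U 0\<close> vanishes, injectivity of T and of 1 - S - T forces the other parts to
  vanish.\<close>

lemma irreducible_idem3:
  assumes m: "m > 0"
  shows "irreducible_mats (3 * m)
    (insert (idem3 m) ((\<lambda>j. mat_diag (3 * m) (\<lambda>r. if r div m = j then 1 else (0::'k::field_char_0))) ` {..<3}))"
  unfolding irreducible_mats_def
proof (intro allI impI, elim conjE)
  let ?n = "3 * m"
  let ?E = "\<lambda>j. mat_diag ?n (\<lambda>r. if r div m = j then 1 else (0::'k))"
  fix W :: "'k vec set" assume sub: "lin_subspace (module_vec TYPE('k) ?n) W"
    and inv: "\<forall>M\<in>insert (idem3 m) (?E ` {..<3}). \<forall>w\<in>W. M *\<^sub>v w \<in> W"
  note W = sub[unfolded vec_lin_subspace_iff]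
  \<comment> \<open>\<open>\<epsilon> j x\<close> places the values of \<open>x\<close> below m in
    block j. Functions on all naturals spare index bounds; that only the values below m matter is
    recorded in \<open>U_cong\<close>.\<close>
  define \<epsilon> where "\<epsilon> j x = vec ?n (\<lambda>r. if r div m = j then x (r mod m) else (0::'k))" for j x
  define U where "U j = {x. \<epsilon> j x \<in> W}" for j
  have idx: "(j * m + a) div m = j" "(j * m + a) mod m = a" if "a < m" for j a
    using that by auto
  have less: "j * m + a < ?n" if "a < m" "j < 3" for j a
  proof -
    have "j * m + a < (j + 1) * m" using that by simp
    also have "\<dots> \<le> 3 * m" using that by (intro mult_le_mono1) simp
    finally show ?thesis .
  qed
  have cong: "\<epsilon> j x = \<epsilon> j y" if "\<And>a. a < m \<Longrightarrow> x a = y a" for j x y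
    unfolding \<epsilon>_def using that m by (intro eq_vecI) auto
  have U_cong: "y \<in> U j" if "x \<in> U j" "\<And>a. a < m \<Longrightarrow> x a = y a" for x y j
    using cong[of x y j] that by (simp add: U_def)
  have comp: "(\<lambda>a. w $ (j * m + a)) \<in> U j" if "w \<in> W" "j < 3" for w :: "'k vec" and j
  proof -
    have w: "w \<in> carrier_vec ?n" using that W by blast
    have "?E j *\<^sub>v w = \<epsilon> j (\<lambda>a. w $ (j * m + a))"
      using w by (intro eq_vecI) (auto simp: \<epsilon>_def mat_diag_mult_vec)
    moreover have "?E j *\<^sub>v w \<in> W" using inv that by blast
    ultimately show ?thesis by (simp add: U_def)
  qed
  have U_add: "(\<lambda>a. x a + y a) \<in> U j" if "x \<in> U j" "y \<in> U j" for x y j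
  proof -
    have "\<epsilon> j (\<lambda>a. x a + y a) = \<epsilon> j x + \<epsilon> j y" by (intro eq_vecI) (auto simp: \<epsilon>_def)
    then show ?thesis using that W by (simp add: U_def)
  qed
  have U_smult: "(\<lambda>a. c * x a) \<in> U j" if "x \<in> U j" for c x j
  proof -
    have "\<epsilon> j (\<lambda>a. c * x a) = c \<cdot>\<^sub>v \<epsilon> j x" by (intro eq_vecI) (auto simp: \<epsilon>_def)
    then show ?thesis using that W by (simp add: U_def)
  qed
  define S where "S x = (\<lambda>a. of_nat (a + 1) * x a :: 'k)" for x :: "nat \<Rightarrow> 'k"
  define T where "T x = (\<lambda>a. x (cyclic_pred m a) :: 'k)" for x :: "nat \<Rightarrow> 'k"
  \<comment> \<open>\<open>D\<close> is 1 - S - T, with diagonal entries 1 - (a + 1) = -a.\<close>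
  define D where "D x = (\<lambda>a. - of_nat a * x a - x (cyclic_pred m a) :: 'k)" for x :: "nat \<Rightarrow> 'k"
  have Q: "(idem3 m *\<^sub>v \<epsilon> j x) $ r = (if j = 0 then S x else if j = 1 then T x else D x) (r mod m)"
    if "r < ?n" "j < 3" for r j x
  proof -
    define a where "a = r mod m"
    have a: "a < m" "cyclic_pred m a < m" using m by (simp_all add: a_def cyclic_pred_less)
    have e: "\<epsilon> j x $ (i * m + b) = (if i = j then x b else 0)" if "i < 3" "b < m" for i b
      using less[of b i] idx[of b i] that by (simp add: \<epsilon>_def)
    have "(idem3 m *\<^sub>v \<epsilon> j x) $ r = (of_nat (a + 1) * \<epsilon> j x $ (0 * m + a) + \<epsilon> j x $ (1 * m + cyclic_pred m a))
     + (- of_nat a * \<epsilon> j x $ (2 * m + a) - \<epsilon> j x $ (2 * m + cyclic_pred m a))"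
      using idem3_mult_vec[of "\<epsilon> j x" m r] that by (simp add: \<epsilon>_def a_def)
    also have "\<dots> = (if j = 0 then S x else if j = 1 then T x else D x) a"
      using that(2) a by (simp only: e) (auto simp: S_def T_def D_def)
    finally show ?thesis by (simp add: a_def)
  qed
  \<comment> \<open>\<open>idem3\<close> writes one and the same vector into all blocks, so the
    projection to block i puts that vector into \<open>U i\<close>.\<close>
  have Q_U: "(if j = 0 then S x else if j = 1 then T x else D x) \<in> U i" if "x \<in> U j" "j < 3" "i < 3" for x i j
  proof (rule U_cong)
    have "idem3 m *\<^sub>v \<epsilon> j x \<in> W" using that inv by (simp add: U_def)
    then show "(\<lambda>a. vec_index (idem3 m *\<^sub>v \<epsilon> j x) (i * m + a)) \<in> U i" using that(3) by (rule comp)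
    show "(idem3 m *\<^sub>v \<epsilon> j x) $ (i * m + a) = (if j = 0 then S x else if j = 1 then T x else D x) a"
      if "a < m" for a
      using Q[of "i * m + a" j x] less idx that \<open>i < 3\<close> \<open>j < 3\<close> by simp
  qed
  have S_U: "S x \<in> U i" if "x \<in> U 0" "i < 3" for x i using Q_U[of x 0 i] that by simp
  have T_U: "T x \<in> U i" if "x \<in> U 1" "i < 3" for x i using Q_U[of x 1 i] that by simp
  have D_U: "D x \<in> U i" if "x \<in> U 2" "i < 3" for x i using Q_U[of x 2 i] that by simp
  let ?\<delta> = "\<lambda>b a. if a = b then 1 else (0::'k)"
  show "W = {0\<^sub>v ?n} \<or> W = carrier_vec ?n"
  proof (cases "\<exists>x\<in>U 0. \<exists>a<m. x a \<noteq> 0")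
    case True
    let ?P = "\<lambda>x. x \<in> U 0 \<and> (\<exists>a<m. x a \<noteq> 0)"
    \<comment> \<open>Minimal support forces S - (b + 1), for b in the support, to annihilate x:
      this operator kills position b and multiplies each other position a by a - b, which is nonzero
      in characteristic zero. So x is supported at b alone.\<close>
    obtain x where x: "?P x" and least: "\<And>y. ?P y \<Longrightarrow> card {a. a < m \<and> x a \<noteq> 0} \<le> card {a. a < m \<and> y a \<noteq> 0}"
      using True ex_has_least_nat[of ?P _ "\<lambda>x. card {a. a < m \<and> x a \<noteq> 0}"] by blast
    then obtain b where b: "b < m" "x b \<noteq> 0" by blast
    define y where "y = (\<lambda>a. S x a + (- of_nat (b + 1)) * x a)"
    have "y \<in> U 0" unfolding y_def using x by (intro U_add U_smult S_U) auto
    have y: "y a = (of_nat a - of_nat b) * x a" for a by (simp add: y_def S_def algebra_simps)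
    have supp: "{a. a < m \<and> y a \<noteq> 0} = {a. a < m \<and> x a \<noteq> 0} - {b}" by (auto simp: y)
    have "card {a. a < m \<and> y a \<noteq> 0} < card {a. a < m \<and> x a \<noteq> 0}"
      unfolding supp using b by (intro card_Diff1_less) auto
    then have "y a = 0" if "a < m" for a using least[of y] \<open>y \<in> U 0\<close> that by auto
    then have x0: "x a = 0" if "a < m" "a \<noteq> b" for a using that by (auto simp: y)
    have \<delta>b: "?\<delta> b \<in> U 0"
    proof (rule U_cong)
      show "(\<lambda>a. 1 / x b * x a) \<in> U 0" using x by (intro U_smult) blast
      show "1 / x b * x a = ?\<delta> b a" if "a < m" for a using b(2) x0[OF that] by simp
    qed
    \<comment> \<open>S scales position b by b + 1, which is invertible in characteristic zero, and
      the result is available in every block.\<close>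
    have step1: "?\<delta> b \<in> U i" if "?\<delta> b \<in> U 0" "i < 3" for b i
      by (rule U_cong[OF U_smult[OF S_U[OF that], of "1 / of_nat (b + 1)"]])
        (auto simp: S_def simp flip: of_nat_Suc)
    \<comment> \<open>T moves position b to its cyclic successor. As T acts on block 1, the vector
      is first copied there by \<open>step1\<close>, and the result is read in block 0.\<close>
    have step2: "?\<delta> ((b + 1) mod m) \<in> U 0" if "?\<delta> b \<in> U 0" "b < m" for b
    proof (rule U_cong[OF T_U[OF step1[OF that(1), of 1], of 0]])
      fix a assume "a < m"
      then show "T (?\<delta> b) a = ?\<delta> ((b + 1) mod m) a"
        using that(2) by (cases "b + 1 = m") (auto simp: T_def cyclic_pred_def)
    qed simp_all
    have "?\<delta> ((b + k) mod m) \<in> U 0" for k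
    proof (induction k)
      case 0
      then show ?case using \<delta>b b by simp
    next
      case (Suc k)
      then show ?case using step2[OF Suc] m by (simp add: mod_Suc_eq)
    qed
    note all = this
    have "?\<delta> a \<in> U 0" if "a < m" for a
    proof -
      \<comment> \<open>From b, m - b steps around the cycle lead to 0 and a more steps lead to
        a.\<close>
      have "(b + (m - b + a)) mod m = a" using b that by simp
      then show ?thesis using all[of "m - b + a"] by simp
    qed
    then have \<delta>_U: "?\<delta> a \<in> U j" if "a < m" "j < 3" for a j using step1 that by blast
    have "unit_vec ?n r \<in> W" if r: "r < ?n" for r
    proof -
      have "\<epsilon> (r div m) (?\<delta> (r mod m)) = unit_vec ?n r"
      proof (rule eq_vecI)
        fix i assume "i < dim_vec (unit_vec ?n r)"
        then have "i < ?n" by simp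
        moreover have "i = r" if "i div m = r div m" "i mod m = r mod m"
          using that by (metis div_mult_mod_eq)
        ultimately show "\<epsilon> (r div m) (?\<delta> (r mod m)) $ i = unit_vec ?n r $ i"
          using r by (auto simp: \<epsilon>_def)
      qed (simp add: \<epsilon>_def)
      moreover have "?\<delta> (r mod m) \<in> U (r div m)"
        using r m by (intro \<delta>_U) (auto simp: less_mult_imp_div_less)
      ultimately show ?thesis by (simp add: U_def)
    qed
    then show ?thesis using subspace_eq_carrier_vec[OF sub] by blast
  next
    case False
    then have U0: "x a = 0" if "x \<in> U 0" "a < m" for x a using that by blast
    have U1: "x a = 0" if "x \<in> U 1" "a < m" for x a
    proof -
      \<comment> \<open>The value of T x at the cyclic successor of a is x a.\<close>
      have "T x (if a + 1 = m then 0 else a + 1) = 0" using that m by (intro U0 T_U) auto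
      then show ?thesis using that by (auto simp: T_def cyclic_pred_def split: if_splits)
    qed
    have U2: "x a = 0" if "x \<in> U 2" "a < m" for x a
    proof -
      have D0: "D x a = 0" if "a < m" for a using that \<open>x \<in> U 2\<close> by (intro U0 D_U) auto
      \<comment> \<open>Row 0 of \<open>D\<close> has zero diagonal entry and gives x (m - 1) = 0;
        for a > 0, row a gives x (a - 1) = 0 once x a = 0. Hence the descent from m - 1.\<close>
      have "x (m - 1 - k) = 0" if "k < m" for k
        using that
      proof (induction k)
        case 0
        then show ?case using D0[OF m] by (simp add: D_def cyclic_pred_def)
      next
        case (Suc k)
        then have "x (m - 1 - k) = 0" by simp
        moreover have "m - 1 - k \<noteq> 0" "m - 1 - k - 1 = m - 1 - Suc k" using Suc.prems by auto
        ultimately show ?case using D0[of "m - 1 - k"] m by (simp add: D_def cyclic_pred_def)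
      qed
      from this[of "m - 1 - a"] show ?thesis using that by simp
    qed
    have "w = 0\<^sub>v ?n" if w: "w \<in> W" for w
    proof (rule eq_vecI)
      fix r assume "r < dim_vec (0\<^sub>v ?n :: 'k vec)"
      then have r: "r < ?n" by simp
      define j where "j = r div m"
      have j: "j < 3" using r by (simp add: j_def less_mult_imp_div_less)
      have "w $ (j * m + r mod m) = 0"
      proof -
        have rm: "r mod m < m" using m by simp
        consider "j = 0" | "j = 1" | "j = 2" using j by linarith
        then show ?thesis
        proof cases
          case 1
          show ?thesis using U0[OF _ rm] comp[OF w j] unfolding 1 .
        next
          case 2
          show ?thesis using U1[OF _ rm] comp[OF w j] unfolding 2 .
        next
          case 3
          show ?thesis using U2[OF _ rm] comp[OF w j] unfolding 3 .
        qed
      qed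
      then show "w $ r = 0\<^sub>v ?n $ r" using r by (simp add: j_def)
    qed (use w W in auto)
    then show ?thesis using W by blast
  qed
qed

section \<open>The partial abelianization\<close>

text \<open>Isolates what the algebraic part uses: A is commutative, B is spanned by q and 1, and
  every element of V is an element of Abar plus a multiple of q.\<close>

locale partial_abelianization = unital_algebra_pair A B
  for A :: "('k::field, 'a) module" and B :: "('k, 'b) module" +
  fixes Abar :: "'a set" and q :: 'b and V :: "(('a + 'b) list \<Rightarrow>\<^sub>0 'k) set set"
  assumes A_comm: "a \<in> carrier A \<Longrightarrow> a' \<in> carrier A \<Longrightarrow> a \<otimes>\<^bsub>A\<^esub> a' = a' \<otimes>\<^bsub>A\<^esub> a"
    and q_closed: "q \<in> carrier B"
    and B_span: "b \<in> carrier B \<Longrightarrow> \<exists>c d. b = c \<odot>\<^bsub>B\<^esub> q \<oplus>\<^bsub>B\<^esub> d \<odot>\<^bsub>B\<^esub> \<one>\<^bsub>B\<^esub>"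
    and Abar_subspace: "lin_subspace A Abar"
    and V_subspace: "lin_subspace \<P> V"
    and V_decomp: "v \<in> V \<Longrightarrow> \<exists>a\<in>Abar. \<exists>c. v = free_product_inl A B a \<oplus>\<^bsub>\<P>\<^esub> c \<odot>\<^bsub>\<P>\<^esub> free_product_inr A B q"
begin

sublocale P: unital_algebra \<P> by (rule free_product_unital_algebra)

abbreviation "\<iota> \<equiv> free_product_inl A B"
abbreviation "\<kappa> \<equiv> free_product_inr A B"
abbreviation "\<Q> \<equiv> partial_ab V \<P>"

text \<open>The intersection of V with Abar is formed inside \<open>A\<close>, through the
  inclusion, because V itself lives in the free product.\<close>

definition AV :: "'a set" where
  "AV = subalgebra_gen A {a \<in> Abar. \<iota> a \<in> V}"

lemmas Abar_props = Abar_subspace[unfolded A.lin_subspace_iff]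
lemmas V_props = V_subspace[unfolded P.lin_subspace_iff]
lemmas \<iota>_props = free_product_inl_hom[unfolded alg_hom_iff]
lemmas \<kappa>_props = free_product_inr_hom[unfolded alg_hom_iff]

lemma \<iota>_commute:
  assumes "a \<in> carrier A" "b \<in> carrier A" shows "\<iota> a \<otimes>\<^bsub>\<P>\<^esub> \<iota> b = \<iota> b \<otimes>\<^bsub>\<P>\<^esub> \<iota> a"
proof -
  have "\<iota> (a \<otimes>\<^bsub>A\<^esub> b) = \<iota> a \<otimes>\<^bsub>\<P>\<^esub> \<iota> b" "\<iota> (b \<otimes>\<^bsub>A\<^esub> a) = \<iota> b \<otimes>\<^bsub>\<P>\<^esub> \<iota> a"
    using assms \<iota>_props by blast+
  then show ?thesis using A_comm[OF assms] by simp
qed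

lemma AV_subalgebra: "unital_subalgebra A AV"
  unfolding AV_def using Abar_props by (intro A.subalgebra_gen_subalgebra) auto

lemma AV_subset: "AV \<subseteq> carrier A"
  using AV_subalgebra by (simp add: A.unital_subalgebra_iff)

lemma subalgebra_gen_V_closed: "subalgebra_gen \<P> V \<subseteq> carrier \<P>"
  using P.subalgebra_gen_subalgebra[of V] V_props by (auto simp: P.unital_subalgebra_iff)

lemma commutators_closed:
  "{x \<otimes>\<^bsub>\<P>\<^esub> y \<ominus>\<^bsub>\<P>\<^esub> y \<otimes>\<^bsub>\<P>\<^esub> x | x y. x \<in> subalgebra_gen \<P> V \<and> y \<in> subalgebra_gen \<P> V} \<subseteq> carrier \<P>"
  using subalgebra_gen_V_closed by auto

sublocale C: unital_algebra_ideal \<P> "commutator_ideal V \<P>"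
  unfolding commutator_ideal_def by (intro P.genideal_unital_algebra_ideal commutators_closed)

lemma partial_ab_unital_algebra: "unital_algebra \<Q>"
  unfolding partial_ab_def by (rule C.quot_unital_algebra)

sublocale Q: unital_algebra \<Q> by (rule partial_ab_unital_algebra)

section \<open>The images of A and B in (V,R)^ab and the maps out of it\<close>

abbreviation "\<pi> \<equiv> \<lambda>x. commutator_ideal V \<P> +>\<^bsub>\<P>\<^esub> x"

lemma proj_hom: "\<pi> \<in> alg_hom \<P> \<Q>"
  unfolding partial_ab_def by (rule C.quot_proj_hom)

definition jA :: "'a \<Rightarrow> (('a + 'b) list \<Rightarrow>\<^sub>0 'k) set set" where "jA a = \<pi> (\<iota> a)"
definition jB :: "'b \<Rightarrow> (('a + 'b) list \<Rightarrow>\<^sub>0 'k) set set" where "jB b = \<pi> (\<kappa> b)"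

lemma jA_hom: "jA \<in> alg_hom A \<Q>"
  unfolding jA_def[abs_def] by (rule alg_hom_comp[OF free_product_inl_hom proj_hom])

lemma jB_hom: "jB \<in> alg_hom B \<Q>"
  unfolding jB_def[abs_def] by (rule alg_hom_comp[OF free_product_inr_hom proj_hom])

lemmas jA_props = jA_hom[unfolded alg_hom_iff]
lemmas jB_props = jB_hom[unfolded alg_hom_iff]

lemma jA_commute:
  assumes "a \<in> carrier A" "b \<in> carrier A" shows "jA a \<otimes>\<^bsub>\<Q>\<^esub> jA b = jA b \<otimes>\<^bsub>\<Q>\<^esub> jA a"
proof -
  have "jA (a \<otimes>\<^bsub>A\<^esub> b) = jA a \<otimes>\<^bsub>\<Q>\<^esub> jA b" "jA (b \<otimes>\<^bsub>A\<^esub> a) = jA b \<otimes>\<^bsub>\<Q>\<^esub> jA a"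
    using assms jA_props by blast+
  then show ?thesis using A_comm[OF assms] by simp
qed

text \<open>Commutation of the images of V alone is tested; it extends to the generated subalgebra
  R(V) in one argument at a time, through centralizers.\<close>

lemma commutator_ideal_kernel:
  assumes T: "unital_algebra T" and h: "h \<in> alg_hom \<P> T"
    and comm: "\<And>v w. v \<in> V \<Longrightarrow> w \<in> V \<Longrightarrow> h v \<otimes>\<^bsub>T\<^esub> h w = h w \<otimes>\<^bsub>T\<^esub> h v"
    and x: "x \<in> commutator_ideal V \<P>"
  shows "h x = \<zero>\<^bsub>T\<^esub>"
proof -
  interpret T: unital_algebra T by fact
  note h' = h[unfolded alg_hom_iff]
  let ?S = "subalgebra_gen \<P> V"
  have VC: "V \<subseteq> carrier \<P>" using V_props by blast
  \<comment> \<open>Applied with G = V to extend one argument to R(V), then with G = R(V) to extend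
    the other.\<close>
  have step: "h x \<otimes>\<^bsub>T\<^esub> h w = h w \<otimes>\<^bsub>T\<^esub> h x"
    if G: "G \<subseteq> carrier \<P>" "\<And>v w. v \<in> V \<Longrightarrow> w \<in> G \<Longrightarrow> h v \<otimes>\<^bsub>T\<^esub> h w = h w \<otimes>\<^bsub>T\<^esub> h v"
      and xw: "x \<in> ?S" "w \<in> G" for G x w
  proof -
    have "h ` G \<subseteq> carrier T" using G(1) h' by blast
    then have "unital_subalgebra \<P>
      {x \<in> carrier \<P>. h x \<in> {y \<in> carrier T. \<forall>z\<in>h ` G. y \<otimes>\<^bsub>T\<^esub> z = z \<otimes>\<^bsub>T\<^esub> y}}"
      by (intro unital_subalgebra_vimage[OF P.unital_algebra_axioms T h] T.unital_subalgebra_centralizer)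
    moreover have "V \<subseteq> {x \<in> carrier \<P>. h x \<in> {y \<in> carrier T. \<forall>z\<in>h ` G. y \<otimes>\<^bsub>T\<^esub> z = z \<otimes>\<^bsub>T\<^esub> y}}"
      using G(2) VC h' by blast
    ultimately have "?S \<subseteq> {x \<in> carrier \<P>. h x \<in> {y \<in> carrier T. \<forall>z\<in>h ` G. y \<otimes>\<^bsub>T\<^esub> z = z \<otimes>\<^bsub>T\<^esub> y}}"
      by (rule subalgebra_gen_least)
    then show ?thesis using xw by blast
  qed
  have V_S: "h w \<otimes>\<^bsub>T\<^esub> h x = h x \<otimes>\<^bsub>T\<^esub> h w" if "w \<in> V" "x \<in> ?S" for x w
    by (rule sym, rule step[OF VC comm that(2,1)])
  have comm': "h x \<otimes>\<^bsub>T\<^esub> h y = h y \<otimes>\<^bsub>T\<^esub> h x" if "x \<in> ?S" "y \<in> ?S" for x y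
    by (rule step[OF subalgebra_gen_V_closed _ that]) (erule (1) V_S)
  show ?thesis
  proof (rule P.genideal_kernel[OF T h commutators_closed])
    show "x \<in> Idl\<^bsub>\<P>\<^esub> {x \<otimes>\<^bsub>\<P>\<^esub> y \<ominus>\<^bsub>\<P>\<^esub> y \<otimes>\<^bsub>\<P>\<^esub> x | x y. x \<in> ?S \<and> y \<in> ?S}"
      using x by (simp add: commutator_ideal_def)
    fix z assume "z \<in> {x \<otimes>\<^bsub>\<P>\<^esub> y \<ominus>\<^bsub>\<P>\<^esub> y \<otimes>\<^bsub>\<P>\<^esub> x | x y. x \<in> ?S \<and> y \<in> ?S}"
    then obtain x y where z: "z = x \<otimes>\<^bsub>\<P>\<^esub> y \<ominus>\<^bsub>\<P>\<^esub> y \<otimes>\<^bsub>\<P>\<^esub> x" and xy: "x \<in> ?S" "y \<in> ?S" by blast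
    then have C: "x \<in> carrier \<P>" "y \<in> carrier \<P>" using subalgebra_gen_V_closed by auto
    have "h z = h x \<otimes>\<^bsub>T\<^esub> h y \<ominus>\<^bsub>T\<^esub> h y \<otimes>\<^bsub>T\<^esub> h x"
      unfolding z using C h' by (simp add: alg_hom_minus[OF P.unital_algebra_axioms T h])
    then show "h z = \<zero>\<^bsub>T\<^esub>" using comm'[OF xy] C h' by (simp add: T.r_right_minus_eq)
  qed
qed

text \<open>If v has a nonzero coefficient at q, subtracting a multiple of v from w removes q and
  leaves an element of V that comes from Abar, hence from A(V). It commutes with v, and therefore so
  does w.\<close>

lemma V_images_commute:
  assumes T: "unital_algebra T" and h: "h \<in> alg_hom \<P> T"
    and comm: "\<And>a. a \<in> AV \<Longrightarrow> h (\<iota> a) \<otimes>\<^bsub>T\<^esub> h (\<kappa> q) = h (\<kappa> q) \<otimes>\<^bsub>T\<^esub> h (\<iota> a)"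
    and v: "v \<in> V" and w: "w \<in> V"
  shows "h v \<otimes>\<^bsub>T\<^esub> h w = h w \<otimes>\<^bsub>T\<^esub> h v"
proof -
  interpret T: unital_algebra T by fact
  note h' = h[unfolded alg_hom_iff]
  have AbarC: "a \<in> carrier A" if "a \<in> Abar" for a using that Abar_props by blast
  have hC: "h (\<iota> a) \<in> carrier T" "h (\<kappa> q) \<in> carrier T" if "a \<in> carrier A" for a
    using that h' \<iota>_props \<kappa>_props q_closed by auto
  have hA: "h (\<iota> a) \<otimes>\<^bsub>T\<^esub> h (\<iota> a') = h (\<iota> a') \<otimes>\<^bsub>T\<^esub> h (\<iota> a)" if "a \<in> carrier A" "a' \<in> carrier A" for a a'
  proof -
    have "\<iota> a \<in> carrier \<P>" "\<iota> a' \<in> carrier \<P>" using that \<iota>_props by blast+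
    then have "h (\<iota> a \<otimes>\<^bsub>\<P>\<^esub> \<iota> a') = h (\<iota> a) \<otimes>\<^bsub>T\<^esub> h (\<iota> a')"
      "h (\<iota> a' \<otimes>\<^bsub>\<P>\<^esub> \<iota> a) = h (\<iota> a') \<otimes>\<^bsub>T\<^esub> h (\<iota> a)"
      using h' by blast+
    then show ?thesis using \<iota>_commute[OF that] by simp
  qed
  \<comment> \<open>An element of V coming from Abar lies in A(V). It commutes with the Abar part of
    w since A is commutative, and with the multiple of q by \<open>comm\<close>.\<close>
  have left: "h v \<otimes>\<^bsub>T\<^esub> h w = h w \<otimes>\<^bsub>T\<^esub> h v" if v: "v = \<iota> a" "v \<in> V" "a \<in> Abar" and w: "w \<in> V" for v w a
  proof -
    have "a \<in> AV" using subalgebra_gen_superset v unfolding AV_def by fast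
    obtain a' c where a': "a' \<in> Abar" and w': "w = \<iota> a' \<oplus>\<^bsub>\<P>\<^esub> c \<odot>\<^bsub>\<P>\<^esub> \<kappa> q"
      using V_decomp[OF w] by blast
    have "h w = h (\<iota> a') \<oplus>\<^bsub>T\<^esub> c \<odot>\<^bsub>T\<^esub> h (\<kappa> q)"
      unfolding w' using h' \<iota>_props \<kappa>_props q_closed AbarC[OF a'] by auto
    then show ?thesis
      using hC AbarC[OF a'] AbarC[OF v(3)] hA comm[OF \<open>a \<in> AV\<close>] unfolding v(1)
      by (simp add: T.l_distr T.r_distr T.smult_mult_left T.smult_mult_right)
  qed
  obtain a c where a: "a \<in> Abar" and v': "v = \<iota> a \<oplus>\<^bsub>\<P>\<^esub> c \<odot>\<^bsub>\<P>\<^esub> \<kappa> q" using V_decomp[OF v] by blast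
  obtain a' c' where a': "a' \<in> Abar" and w': "w = \<iota> a' \<oplus>\<^bsub>\<P>\<^esub> c' \<odot>\<^bsub>\<P>\<^esub> \<kappa> q" using V_decomp[OF w] by blast
  note C = AbarC[OF a] AbarC[OF a']
  have PC: "\<iota> a \<in> carrier \<P>" "\<iota> a' \<in> carrier \<P>" "\<kappa> q \<in> carrier \<P>"
    using C \<iota>_props \<kappa>_props q_closed by auto
  have vC: "v \<in> carrier \<P>" "w \<in> carrier \<P>" using v w V_props by auto
  show ?thesis
  proof (cases "c = 0")
    case True
    then have "v = \<iota> a" unfolding v' using PC by simp
    then show ?thesis using left v a w by blast
  next
    case False
    define d where "d = - (c' / c)"
    define u where "u = w \<oplus>\<^bsub>\<P>\<^esub> d \<odot>\<^bsub>\<P>\<^esub> v"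
    have uV: "u \<in> V" using v w V_props by (simp add: u_def)
    have "u = (\<iota> a' \<oplus>\<^bsub>\<P>\<^esub> d \<odot>\<^bsub>\<P>\<^esub> \<iota> a) \<oplus>\<^bsub>\<P>\<^esub> (c' + d * c) \<odot>\<^bsub>\<P>\<^esub> \<kappa> q"
      unfolding u_def v' w' using PC by (simp add: P.smult_r_distr P.smult_l_distr P.smult_assoc P.a_ac)
    also have "\<dots> = \<iota> (a' \<oplus>\<^bsub>A\<^esub> d \<odot>\<^bsub>A\<^esub> a)"
      using PC C \<iota>_props False by (simp add: d_def)
    finally have u: "u = \<iota> (a' \<oplus>\<^bsub>A\<^esub> d \<odot>\<^bsub>A\<^esub> a)" .
    have "h u \<otimes>\<^bsub>T\<^esub> h v = h v \<otimes>\<^bsub>T\<^esub> h u"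
      using a a' Abar_props by (intro left[OF u uV _ v]) blast
    moreover have "h u = h w \<oplus>\<^bsub>T\<^esub> d \<odot>\<^bsub>T\<^esub> h v" using h' vC by (simp add: u_def)
    moreover have "h v \<in> carrier T" "h w \<in> carrier T" using h' vC by auto
    ultimately show ?thesis
      by (simp add: T.l_distr T.r_distr T.smult_mult_left T.smult_mult_right)
  qed
qed

text \<open>All maps out of (V,R)^ab used for the tensor product and for representations come from
  here: the relations amount to A(V) commuting with q.\<close>

lemma partial_ab_lift:
  assumes T: "unital_algebra T" and \<alpha>: "\<alpha> \<in> alg_hom A T" and \<beta>: "\<beta> \<in> alg_hom B T"
    and comm: "\<And>a. a \<in> AV \<Longrightarrow> \<alpha> a \<otimes>\<^bsub>T\<^esub> \<beta> q = \<beta> q \<otimes>\<^bsub>T\<^esub> \<alpha> a"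
  obtains h where "h \<in> alg_hom \<Q> T"
    "\<And>a. a \<in> carrier A \<Longrightarrow> h (jA a) = \<alpha> a" "\<And>b. b \<in> carrier B \<Longrightarrow> h (jB b) = \<beta> b"
proof -
  obtain g where g: "g \<in> alg_hom \<P> T"
    "\<And>a. a \<in> carrier A \<Longrightarrow> g (\<iota> a) = \<alpha> a" "\<And>b. b \<in> carrier B \<Longrightarrow> g (\<kappa> b) = \<beta> b"
    using free_product_lift[OF T \<alpha> \<beta>] by blast
  have "g (\<iota> a) \<otimes>\<^bsub>T\<^esub> g (\<kappa> q) = g (\<kappa> q) \<otimes>\<^bsub>T\<^esub> g (\<iota> a)" if "a \<in> AV" for a
    using comm[OF that] that AV_subset q_closed g(2,3) by (metis subsetD)
  then have "g x = \<zero>\<^bsub>T\<^esub>" if "x \<in> commutator_ideal V \<P>" for x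
    using commutator_ideal_kernel[OF T g(1) _ that] V_images_commute[OF T g(1)] by blast
  then obtain h where "h \<in> alg_hom \<Q> T" "\<And>x. x \<in> carrier \<P> \<Longrightarrow> h (\<pi> x) = g x"
    using C.quot_lift[OF T g(1)] unfolding partial_ab_def by blast
  then show thesis
    using that g \<iota>_props \<kappa>_props by (simp add: jA_def jB_def)
qed

lemma partial_ab_generated:
  assumes W: "unital_subalgebra \<Q> W" and A: "\<And>a. a \<in> carrier A \<Longrightarrow> jA a \<in> W" and q: "jB q \<in> W"
  shows "W = carrier \<Q>"
proof -
  note W' = W[unfolded Q.unital_subalgebra_iff]
  have B: "jB b \<in> W" if b: "b \<in> carrier B" for b
  proof -
    obtain c d where "b = c \<odot>\<^bsub>B\<^esub> q \<oplus>\<^bsub>B\<^esub> d \<odot>\<^bsub>B\<^esub> \<one>\<^bsub>B\<^esub>" using B_span[OF b] by blast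
    then have "jB b = c \<odot>\<^bsub>\<Q>\<^esub> jB q \<oplus>\<^bsub>\<Q>\<^esub> d \<odot>\<^bsub>\<Q>\<^esub> \<one>\<^bsub>\<Q>\<^esub>"
      using jB_props q_closed by simp
    then show ?thesis using W' q by simp
  qed
  show ?thesis
    unfolding partial_ab_def
  proof (rule C.quot_generated)
    show "unital_subalgebra (quot_algebra \<P> (commutator_ideal V \<P>)) W"
      using W by (simp add: partial_ab_def)
    show "W' = carrier \<P>" if "unital_subalgebra \<P> W'" "\<iota> ` carrier A \<union> \<kappa> ` carrier B \<subseteq> W'" for W'
      using that by (intro free_product_generated) auto
  qed (use A B \<iota>_props \<kappa>_props in \<open>auto simp: jA_def jB_def\<close>)
qed

text \<open>The kernel criterion applied to the identity of R: elements of V already commute, so the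
  commutator ideal is zero and the projection is injective.\<close>

lemma partial_ab_trivial:
  assumes "V \<subseteq> \<iota> ` Abar"
  shows "\<pi> \<in> alg_iso \<P> \<Q>"
proof -
  have comm: "v \<otimes>\<^bsub>\<P>\<^esub> w = w \<otimes>\<^bsub>\<P>\<^esub> v" if vw: "v \<in> V" "w \<in> V" for v w
  proof -
    have "\<iota> ` Abar \<subseteq> \<iota> ` carrier A" using Abar_props by (intro image_mono) blast
    then have "v \<in> \<iota> ` carrier A" "w \<in> \<iota> ` carrier A" using vw assms by auto
    then show ?thesis by (elim imageE) (simp only: \<iota>_commute)
  qed
  have "(\<lambda>x. x) \<in> alg_hom \<P> \<P>" by (simp add: alg_hom_iff)
  then have zero: "x = \<zero>\<^bsub>\<P>\<^esub>" if "x \<in> commutator_ideal V \<P>" for x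
    using commutator_ideal_kernel[OF P.unital_algebra_axioms _ comm that] by blast
  have "inj_on \<pi> (carrier \<P>)"
  proof (rule inj_onI)
    fix x y assume xy: "x \<in> carrier \<P>" "y \<in> carrier \<P>" "\<pi> x = \<pi> y"
    then have "x \<ominus>\<^bsub>\<P>\<^esub> y = \<zero>\<^bsub>\<P>\<^esub>" by (intro zero) (simp flip: C.coset_eq_iff)
    then show "x = y" using xy by (simp add: P.r_right_minus_eq)
  qed
  moreover have "\<pi> ` carrier \<P> = carrier \<Q>" by (simp add: partial_ab_def C.quot_carrier)
  ultimately show ?thesis using proj_hom by (simp add: alg_iso_def bij_betw_def)
qed

text \<open>V contains some a_0 + c q with c nonzero. For b in A, the commutator with it is c times
  the commutator with q, since a_0 drops out by commutativity, and c can be divided out.\<close>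

lemma AV_central:
  assumes V: "\<not> V \<subseteq> \<iota> ` Abar" and a: "a \<in> AV"
  shows "jA a \<otimes>\<^bsub>\<Q>\<^esub> jB q = jB q \<otimes>\<^bsub>\<Q>\<^esub> jA a"
proof -
  obtain v where v: "v \<in> V" "v \<notin> \<iota> ` Abar" using V by blast
  obtain a0 c where a0: "a0 \<in> Abar" and v': "v = \<iota> a0 \<oplus>\<^bsub>\<P>\<^esub> c \<odot>\<^bsub>\<P>\<^esub> \<kappa> q" using V_decomp[OF v(1)] by blast
  have a0C: "a0 \<in> carrier A" using a0 Abar_props by blast
  have PC: "\<iota> a0 \<in> carrier \<P>" "\<kappa> q \<in> carrier \<P>" using a0C \<iota>_props \<kappa>_props q_closed by auto
  have "c \<noteq> 0"
  proof
    assume "c = 0"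
    then have "v = \<iota> a0" unfolding v' using PC by simp
    then show False using v a0 by blast
  qed
  have qC: "jB q \<in> carrier \<Q>" using jB_props q_closed by blast
  have gen: "jA b \<otimes>\<^bsub>\<Q>\<^esub> jB q = jB q \<otimes>\<^bsub>\<Q>\<^esub> jA b" if b: "b \<in> Abar" "\<iota> b \<in> V" for b
  proof -
    have bC: "b \<in> carrier A" using b Abar_props by blast
    have bP: "\<iota> b \<in> carrier \<P>" using bC \<iota>_props by blast
    have vP: "v \<in> carrier \<P>" using v V_props by blast
    have "\<iota> b \<otimes>\<^bsub>\<P>\<^esub> v \<ominus>\<^bsub>\<P>\<^esub> v \<otimes>\<^bsub>\<P>\<^esub> \<iota> b \<in> commutator_ideal V \<P>"
      unfolding commutator_ideal_def
      using P.genideal_self[OF commutators_closed] subalgebra_gen_superset[of V \<P>] b v by blast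
    then have "\<pi> (\<iota> b \<otimes>\<^bsub>\<P>\<^esub> v) = \<pi> (v \<otimes>\<^bsub>\<P>\<^esub> \<iota> b)"
      using bP vP by (subst C.coset_eq_iff) auto
    moreover have "\<pi> (\<iota> b \<otimes>\<^bsub>\<P>\<^esub> v) = jA b \<otimes>\<^bsub>\<Q>\<^esub> \<pi> v" "\<pi> (v \<otimes>\<^bsub>\<P>\<^esub> \<iota> b) = \<pi> v \<otimes>\<^bsub>\<Q>\<^esub> jA b"
      using proj_hom bP vP unfolding jA_def alg_hom_iff by blast+
    ultimately have "jA b \<otimes>\<^bsub>\<Q>\<^esub> \<pi> v = \<pi> v \<otimes>\<^bsub>\<Q>\<^esub> jA b" by simp
    moreover have "\<pi> v = jA a0 \<oplus>\<^bsub>\<Q>\<^esub> c \<odot>\<^bsub>\<Q>\<^esub> jB q"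
      using proj_hom PC unfolding v' jA_def jB_def alg_hom_iff by simp
    moreover have "jA b \<otimes>\<^bsub>\<Q>\<^esub> jA a0 = jA a0 \<otimes>\<^bsub>\<Q>\<^esub> jA b" using bC a0C by (rule jA_commute)
    moreover have JC: "jA b \<in> carrier \<Q>" "jA a0 \<in> carrier \<Q>" using jA_props bC a0C by auto
    ultimately have "c \<odot>\<^bsub>\<Q>\<^esub> (jA b \<otimes>\<^bsub>\<Q>\<^esub> jB q) = c \<odot>\<^bsub>\<Q>\<^esub> (jB q \<otimes>\<^bsub>\<Q>\<^esub> jA b)"
      using qC by (simp add: Q.l_distr Q.r_distr Q.smult_mult_left Q.smult_mult_right)
    then have "(1 / c * c) \<odot>\<^bsub>\<Q>\<^esub> (jA b \<otimes>\<^bsub>\<Q>\<^esub> jB q) = (1 / c * c) \<odot>\<^bsub>\<Q>\<^esub> (jB q \<otimes>\<^bsub>\<Q>\<^esub> jA b)"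
      using JC qC by (simp add: Q.smult_assoc del: times_divide_eq_left)
    then show ?thesis using \<open>c \<noteq> 0\<close> JC qC by simp
  qed
  \<comment> \<open>So far only the generators of A(V) are treated; the centralizer of q, pulled
    back along \<open>jA\<close>, is a subalgebra containing them.\<close>
  have "AV \<subseteq> {a \<in> carrier A. jA a \<in> {x \<in> carrier \<Q>. \<forall>y\<in>{jB q}. x \<otimes>\<^bsub>\<Q>\<^esub> y = y \<otimes>\<^bsub>\<Q>\<^esub> x}}"
    unfolding AV_def using Abar_props jA_props gen qC
    by (intro subalgebra_gen_least
        unital_subalgebra_vimage[OF A.unital_algebra_axioms partial_ab_unital_algebra jA_hom]
        Q.unital_subalgebra_centralizer) auto
  then show ?thesis using a by blast
qed

text \<open>When A(V) = A, both algebras are universal for commuting pairs of homomorphisms from A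
  and B. The two induced maps are inverse to each other on generators, hence everywhere.\<close>

lemma partial_ab_tensor:
  assumes V: "\<not> V \<subseteq> \<iota> ` Abar" and full: "AV = carrier A"
  shows "alg_iso \<Q> \<T> \<noteq> {}"
proof -
  interpret T: unital_algebra \<T> by (rule tensor_unital_algebra)
  let ?\<alpha> = "\<lambda>a. pure_tensor a \<one>\<^bsub>B\<^esub>" and ?\<beta> = "\<lambda>b. pure_tensor \<one>\<^bsub>A\<^esub> b"
  have "?\<alpha> a \<otimes>\<^bsub>\<T>\<^esub> ?\<beta> q = ?\<beta> q \<otimes>\<^bsub>\<T>\<^esub> ?\<alpha> a" if "a \<in> AV" for a
    using that AV_subset q_closed by (auto simp: pure_tensor_mult subset_iff)
  then obtain f where f: "f \<in> alg_hom \<Q> \<T>"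
    "\<And>a. a \<in> carrier A \<Longrightarrow> f (jA a) = ?\<alpha> a" "\<And>b. b \<in> carrier B \<Longrightarrow> f (jB b) = ?\<beta> b"
    using partial_ab_lift[OF tensor_unital_algebra pure_tensor_hom_left pure_tensor_hom_right] by blast
  \<comment> \<open>B is spanned by q and 1, so commuting with q is commuting with all of B.\<close>
  have "jA a \<otimes>\<^bsub>\<Q>\<^esub> jB b = jB b \<otimes>\<^bsub>\<Q>\<^esub> jA a" if a: "a \<in> carrier A" and b: "b \<in> carrier B" for a b
  proof -
    obtain c d where "b = c \<odot>\<^bsub>B\<^esub> q \<oplus>\<^bsub>B\<^esub> d \<odot>\<^bsub>B\<^esub> \<one>\<^bsub>B\<^esub>" using B_span[OF b] by blast
    then have jb: "jB b = c \<odot>\<^bsub>\<Q>\<^esub> jB q \<oplus>\<^bsub>\<Q>\<^esub> d \<odot>\<^bsub>\<Q>\<^esub> \<one>\<^bsub>\<Q>\<^esub>"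
      using jB_props q_closed by simp
    have "jA a \<in> carrier \<Q>" "jB q \<in> carrier \<Q>" using jA_props jB_props q_closed a by auto
    then show ?thesis
      using AV_central[OF V, of a] full a unfolding jb
      by (simp add: Q.l_distr Q.r_distr Q.smult_mult_left Q.smult_mult_right)
  qed
  then obtain g where g: "g \<in> alg_hom \<T> \<Q>"
    "\<And>a b. a \<in> carrier A \<Longrightarrow> b \<in> carrier B \<Longrightarrow> g (pure_tensor a b) = jA a \<otimes>\<^bsub>\<Q>\<^esub> jB b"
    using tensor_lift[OF partial_ab_unital_algebra jA_hom jB_hom] by blast
  have g1: "g (?\<alpha> a) = jA a" if "a \<in> carrier A" for a
    using g(2)[OF that B.one_closed] jB_props jA_props that by simp
  have g2: "g (?\<beta> b) = jB b" if "b \<in> carrier B" for b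
    using g(2)[OF A.one_closed that] jB_props jA_props that by simp
  have "{x \<in> carrier \<Q>. g (f x) = x} = carrier \<Q>"
  proof (rule partial_ab_generated)
    show "unital_subalgebra \<Q> {x \<in> carrier \<Q>. g (f x) = x}"
      by (rule unital_subalgebra_equalizer[OF partial_ab_unital_algebra alg_hom_comp[OF f(1) g(1)], of "\<lambda>x. x"])
        (simp add: alg_hom_iff)
  qed (use jA_props jB_props q_closed g1 g2 f(2,3) in auto)
  moreover have "{x \<in> carrier \<T>. f (g x) = x} = carrier \<T>"
  proof (rule tensor_generated)
    show "unital_subalgebra \<T> {x \<in> carrier \<T>. f (g x) = x}"
      by (rule unital_subalgebra_equalizer[OF tensor_unital_algebra alg_hom_comp[OF g(1) f(1)], of "\<lambda>x. x"])
        (simp add: alg_hom_iff)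
  qed (use f(2,3) g1 g2 pure_tensor_closed in auto)
  ultimately have "f \<in> alg_iso \<Q> \<T>" using alg_iso_if_inverse[OF f(1) g(1)] by blast
  then show ?thesis by blast
qed

end

section \<open>Dimensions of irreducible representations\<close>

text \<open>A homomorphism from k^2 is the choice of an idempotent e as the image of q_1. The
  formula is b_1 e + b_2 (1 - e), regrouped around the unit to avoid subtraction in
  \<open>T\<close>.\<close>

lemma idempotent_hom:
  assumes T: "unital_algebra T" and e: "e \<in> carrier T" "e \<otimes>\<^bsub>T\<^esub> e = e"
  shows "(\<lambda>b. b 2 \<odot>\<^bsub>T\<^esub> \<one>\<^bsub>T\<^esub> \<oplus>\<^bsub>T\<^esub> (b 1 - b 2) \<odot>\<^bsub>T\<^esub> e) \<in> alg_hom (field_power 2 :: ('k::field, nat \<Rightarrow> 'k) module) T"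
proof -
  interpret T: unital_algebra T by fact
  have mult: "(x \<odot>\<^bsub>T\<^esub> \<one>\<^bsub>T\<^esub> \<oplus>\<^bsub>T\<^esub> (y - x) \<odot>\<^bsub>T\<^esub> e) \<otimes>\<^bsub>T\<^esub> (x' \<odot>\<^bsub>T\<^esub> \<one>\<^bsub>T\<^esub> \<oplus>\<^bsub>T\<^esub> (y' - x') \<odot>\<^bsub>T\<^esub> e) =
    (x * x') \<odot>\<^bsub>T\<^esub> \<one>\<^bsub>T\<^esub> \<oplus>\<^bsub>T\<^esub> (y * y' - x * x') \<odot>\<^bsub>T\<^esub> e" for x y x' y'
  proof -
    have "(x \<odot>\<^bsub>T\<^esub> \<one>\<^bsub>T\<^esub> \<oplus>\<^bsub>T\<^esub> (y - x) \<odot>\<^bsub>T\<^esub> e) \<otimes>\<^bsub>T\<^esub> (x' \<odot>\<^bsub>T\<^esub> \<one>\<^bsub>T\<^esub> \<oplus>\<^bsub>T\<^esub> (y' - x') \<odot>\<^bsub>T\<^esub> e) =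
      (x * x') \<odot>\<^bsub>T\<^esub> \<one>\<^bsub>T\<^esub> \<oplus>\<^bsub>T\<^esub> (x * (y' - x') + (y - x) * x' + (y - x) * (y' - x')) \<odot>\<^bsub>T\<^esub> e"
      using e by (simp add: T.l_distr T.r_distr T.smult_mult_left T.smult_mult_right T.smult_l_distr T.smult_r_distr T.a_ac mult.commute
          flip: T.smult_assoc)
    moreover have "x * (y' - x') + (y - x) * x' + (y - x) * (y' - x') = y * y' - x * x'"
      by (simp add: algebra_simps)
    ultimately show ?thesis by simp
  qed
  have add: "(x + x') \<odot>\<^bsub>T\<^esub> \<one>\<^bsub>T\<^esub> \<oplus>\<^bsub>T\<^esub> (y + y' - (x + x')) \<odot>\<^bsub>T\<^esub> e =
    (x \<odot>\<^bsub>T\<^esub> \<one>\<^bsub>T\<^esub> \<oplus>\<^bsub>T\<^esub> (y - x) \<odot>\<^bsub>T\<^esub> e) \<oplus>\<^bsub>T\<^esub> (x' \<odot>\<^bsub>T\<^esub> \<one>\<^bsub>T\<^esub> \<oplus>\<^bsub>T\<^esub> (y' - x') \<odot>\<^bsub>T\<^esub> e)" for x y x' y'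
  proof -
    have "y + y' - (x + x') = (y - x) + (y' - x')" by simp
    then show ?thesis using e by (simp only: T.smult_l_distr T.one_closed) (simp add: T.a_ac)
  qed
  have smult: "c \<odot>\<^bsub>T\<^esub> (x \<odot>\<^bsub>T\<^esub> \<one>\<^bsub>T\<^esub> \<oplus>\<^bsub>T\<^esub> (y - x) \<odot>\<^bsub>T\<^esub> e) =
    (c * x) \<odot>\<^bsub>T\<^esub> \<one>\<^bsub>T\<^esub> \<oplus>\<^bsub>T\<^esub> (c * y - c * x) \<odot>\<^bsub>T\<^esub> e" for c x y
    using e by (simp add: T.smult_r_distr flip: T.smult_assoc right_diff_distrib)
  show ?thesis
    unfolding alg_hom_iff field_power_simps using e by (simp add: mult add smult)
qed

lemma mid_ge: "irreducible_rep S n \<rho> \<Longrightarrow> enat n \<le> mid S"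
  unfolding mid_def by (rule Sup_upper) blast

lemma mid_le: "(\<And>n \<rho>. irreducible_rep S n \<rho> \<Longrightarrow> n \<le> m) \<Longrightarrow> mid S \<le> enat m"
  unfolding mid_def by (rule Sup_least) auto

section \<open>Irreducible representations of (V,R)^ab for A = k^l and B = k^2\<close>

locale field_power_abelianization =
  partial_abelianization "field_power l :: ('k::alg_closed_field, nat \<Rightarrow> 'k) module"
    "field_power 2 :: ('k, nat \<Rightarrow> 'k) module" Abar "prim_idem 1" V
  for l :: nat and Abar V +
  assumes V_not_in_Abar: "\<not> V \<subseteq> free_product_inl (field_power l) (field_power 2) ` Abar"
begin

text \<open>q_2 is left out, being 1 - q_1.\<close>

abbreviation gens :: "(((nat \<Rightarrow> 'k) + (nat \<Rightarrow> 'k)) list \<Rightarrow>\<^sub>0 'k) set set set" where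
  "gens \<equiv> insert (jB (prim_idem 1)) ((\<lambda>i. jA (prim_idem i)) ` {1..l})"

lemma gens_closed: "gens \<subseteq> carrier \<Q>"
proof -
  have "jB (prim_idem 1) \<in> carrier \<Q>" using jB_props q_closed by blast
  moreover have "jA (prim_idem i) \<in> carrier \<Q>" if "i \<in> {1..l}" for i
    using jA_props prim_idem_closed[OF that] by blast
  ultimately show ?thesis by blast
qed

lemma gens_generate:
  assumes W: "unital_subalgebra \<Q> W" and "gens \<subseteq> W"
  shows "W = carrier \<Q>"
proof (rule partial_ab_generated[OF W])
  have "unital_subalgebra (field_power l) {a \<in> carrier (field_power l). jA a \<in> W}"
    by (rule unital_subalgebra_vimage[OF A.unital_algebra_axioms partial_ab_unital_algebra jA_hom W])
  then have "{a \<in> carrier (field_power l). jA a \<in> W} = carrier (field_power l)"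
    using assms(2) prim_idem_closed
    by (intro field_power_generated) (auto simp: unital_subalgebra_def)
  then show "jA a \<in> W" if "a \<in> carrier (field_power l)" for a using that by blast
qed (use assms in auto)

context
  fixes n \<rho>
  assumes \<rho>: "irreducible_rep \<Q> n \<rho>"
begin

lemma \<rho>_hom: "\<rho> \<in> alg_hom \<Q> (mat_algebra n)" and n_pos: "n > 0"
  using \<rho> by (auto simp: irreducible_rep_iff)

lemmas \<rho>_props = \<rho>_hom[unfolded alg_hom_iff mat_algebra_simps]

lemma \<rho>A_hom: "(\<lambda>a. \<rho> (jA a)) \<in> alg_hom (field_power l) (mat_algebra n)"
  by (rule alg_hom_comp[OF jA_hom \<rho>_hom])

lemmas \<rho>A_props = \<rho>A_hom[unfolded alg_hom_iff mat_algebra_simps]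

lemma irreducible_gens: "irreducible_mats n (\<rho> ` gens)"
  using irreducible_rep_generated[OF partial_ab_unital_algebra \<rho> gens_closed gens_generate] .

lemma central_scalar:
  assumes "z \<in> carrier \<Q>" "\<And>g. g \<in> gens \<Longrightarrow> z \<otimes>\<^bsub>\<Q>\<^esub> g = g \<otimes>\<^bsub>\<Q>\<^esub> z"
  obtains c where "\<rho> z = c \<cdot>\<^sub>m 1\<^sub>m n"
proof (rule irreducible_mats_schur[OF irreducible_gens n_pos])
  show "\<rho> ` gens \<subseteq> carrier_mat n n" using gens_closed \<rho>_props by blast
  show "\<rho> z \<in> carrier_mat n n" using assms(1) \<rho>_props by blast
  fix N assume "N \<in> \<rho> ` gens"
  then obtain g where g: "g \<in> gens" "N = \<rho> g" by blast
  then have "\<rho> (z \<otimes>\<^bsub>\<Q>\<^esub> g) = \<rho> z * N" "\<rho> (g \<otimes>\<^bsub>\<Q>\<^esub> z) = N * \<rho> z"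
    using gens_closed \<rho>_props assms(1) by blast+
  then show "\<rho> z * N = N * \<rho> z" using assms(2)[OF g(1)] by simp
qed (rule that)

text \<open>Elements of A(V) commute with q by centrality and with the p_i since A is commutative,
  so Schur's lemma applies.\<close>

lemma AV_scalar:
  assumes "a \<in> AV"
  obtains c where "\<rho> (jA a) = c \<cdot>\<^sub>m 1\<^sub>m n"
proof (rule central_scalar)
  have a: "a \<in> carrier (field_power l)" using assms AV_subset by blast
  then show "jA a \<in> carrier \<Q>" using jA_props by blast
  show "jA a \<otimes>\<^bsub>\<Q>\<^esub> g = g \<otimes>\<^bsub>\<Q>\<^esub> jA a" if "g \<in> gens" for g
    using that AV_central[OF V_not_in_Abar assms] jA_commute[OF a prim_idem_closed] by blast
qed (rule that)

text \<open>If A(V) = A, then q too commutes with every generator, so every generator acts as a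
  scalar.\<close>

lemma dim_le_one:
  assumes full: "AV = carrier (field_power l)" shows "n \<le> 1"
proof (rule irreducible_mats_scalar[OF irreducible_gens])
  fix M assume "M \<in> \<rho> ` gens"
  then consider i where "i \<in> {1..l}" "M = \<rho> (jA (prim_idem i))" | "M = \<rho> (jB (prim_idem 1))" by blast
  then show "\<exists>c. M = c \<cdot>\<^sub>m 1\<^sub>m n"
  proof cases
    case 1
    have "prim_idem i \<in> AV" using prim_idem_closed[OF 1(1)] full by simp
    then obtain c where "\<rho> (jA (prim_idem i)) = c \<cdot>\<^sub>m 1\<^sub>m n" by (rule AV_scalar)
    then show ?thesis unfolding 1(2) by blast
  next
    case 2
    have "jB (prim_idem 1) \<in> carrier \<Q>" using jB_props q_closed by blast
    moreover have "jB (prim_idem 1) \<otimes>\<^bsub>\<Q>\<^esub> g = g \<otimes>\<^bsub>\<Q>\<^esub> jB (prim_idem 1)" if g: "g \<in> gens" for g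
    proof -
      consider "g = jB (prim_idem 1)" | i where "i \<in> {1..l}" "g = jA (prim_idem i)" using g by blast
      then show ?thesis
      proof cases
        case 2
        have "prim_idem i \<in> AV" using prim_idem_closed[OF 2(1)] full by simp
        then show ?thesis unfolding 2(2) by (rule AV_central[OF V_not_in_Abar, symmetric])
      qed simp
    qed
    ultimately obtain c where "\<rho> (jB (prim_idem 1)) = c \<cdot>\<^sub>m 1\<^sub>m n" by (rule central_scalar)
    then show ?thesis unfolding 2 by blast
  qed
qed

lemma dim_le_two:
  fixes I :: "nat \<Rightarrow> nat set"
  assumes ind: "\<And>j. j \<in> J \<Longrightarrow> (\<lambda>i. if i \<in> I j then 1 else 0) \<in> AV"
    and cover: "(\<Union>j\<in>J. I j) = {1..l}" and card: "\<And>j. j \<in> J \<Longrightarrow> card (I j) \<le> 2"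
  shows "n \<le> 2"
proof -
  define E :: "nat \<Rightarrow> nat \<Rightarrow> 'k" where "E j = (\<lambda>i. if i \<in> I j then 1 else 0)" for j
  have E_AV: "E j \<in> AV" if "j \<in> J" for j using ind[OF that] by (simp add: E_def)
  have E_closed: "E j \<in> carrier (field_power l)" if "j \<in> J" for j using E_AV[OF that] AV_subset by blast
  have \<rho>C: "\<rho> (jA a) \<in> carrier_mat n n" if "a \<in> carrier (field_power l)" for a using that \<rho>A_props by blast
  have \<rho>_mult: "\<rho> (jA (a \<otimes>\<^bsub>field_power l\<^esub> b)) = \<rho> (jA a) * \<rho> (jA b)"
    if "a \<in> carrier (field_power l)" "b \<in> carrier (field_power l)" for a b
    using that \<rho>A_props by blast
  have \<rho>_add: "\<rho> (jA (a \<oplus>\<^bsub>field_power l\<^esub> b)) = \<rho> (jA a) + \<rho> (jA b)"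
    if "a \<in> carrier (field_power l)" "b \<in> carrier (field_power l)" for a b
    using that \<rho>A_props by blast
  note p_closed = prim_idem_closed[of _ l, where 'a='k]
  have one_zero: "1\<^sub>m n \<noteq> (0\<^sub>m n n :: 'k mat)"
  proof
    assume "1\<^sub>m n = (0\<^sub>m n n :: 'k mat)"
    then have "1\<^sub>m n $$ (0, 0) = (0\<^sub>m n n $$ (0, 0) :: 'k)" by simp
    then show False using n_pos by simp
  qed
  have p_E: "prim_idem i \<otimes>\<^bsub>field_power l\<^esub> E j = prim_idem i" if "i \<in> I j" for i j
    using that by (auto simp: field_power_simps prim_idem_def E_def)
  have p_E0: "prim_idem i \<otimes>\<^bsub>field_power l\<^esub> E j = \<zero>\<^bsub>field_power l\<^esub>" if "i \<notin> I j" for i j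
    using that by (auto simp: field_power_simps prim_idem_def E_def)
  have \<rho>_zero: "\<rho> (jA \<zero>\<^bsub>field_power l\<^esub>) = 0\<^sub>m n n"
    using alg_hom_zero[OF A.unital_algebra_axioms mat_algebra_unital_algebra \<rho>A_hom]
    by (simp add: mat_algebra_simps)
  \<comment> \<open>If every \<open>E j\<close> acted as zero, so would each p_i, being p_i times
    the \<open>E j\<close> of its class, and then also 1, which n > 0 forbids.\<close>
  have "\<exists>j\<in>J. \<rho> (jA (E j)) \<noteq> 0\<^sub>m n n"
  proof (rule ccontr)
    assume "\<not> (\<exists>j\<in>J. \<rho> (jA (E j)) \<noteq> 0\<^sub>m n n)"
    then have E0: "\<rho> (jA (E j)) = 0\<^sub>m n n" if "j \<in> J" for j using that by blast
    have "\<rho> (jA (prim_idem i)) = 0\<^sub>m n n" if i: "i \<in> {1..l}" for i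
    proof -
      obtain j where j: "j \<in> J" "i \<in> I j" using i cover by blast
      have "\<rho> (jA (prim_idem i)) = \<rho> (jA (prim_idem i)) * \<rho> (jA (E j))"
        using \<rho>_mult[OF p_closed[OF i] E_closed[OF j(1)]] p_E[OF j(2)] by simp
      then show ?thesis using E0[OF j(1)] \<rho>C[OF p_closed[OF i]] by simp
    qed
    moreover have "lin_subspace (field_power l) {a \<in> carrier (field_power l). \<rho> (jA a) = 0\<^sub>m n n}"
      unfolding A.lin_subspace_iff using \<rho>A_props \<rho>_zero by auto
    ultimately have "{a \<in> carrier (field_power l). \<rho> (jA a) = 0\<^sub>m n n} = carrier (field_power l)"
      using p_closed by (intro field_power_generated) auto
    then have "\<rho> (jA \<one>\<^bsub>field_power l\<^esub>) = 0\<^sub>m n n" using A.one_closed by blast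
    then show False using \<rho>A_props one_zero by simp
  qed
  then obtain j where j: "j \<in> J" "\<rho> (jA (E j)) \<noteq> 0\<^sub>m n n" by blast
  obtain c where c: "\<rho> (jA (E j)) = c \<cdot>\<^sub>m 1\<^sub>m n" using AV_scalar[OF E_AV[OF j(1)]] .
  \<comment> \<open>A nonzero scalar that is idempotent is 1, so this \<open>E j\<close> acts as the
    identity.\<close>
  have "E j \<otimes>\<^bsub>field_power l\<^esub> E j = E j" by (auto simp: field_power_simps E_def)
  then have "\<rho> (jA (E j)) = \<rho> (jA (E j)) * \<rho> (jA (E j))"
    using \<rho>_mult[OF E_closed[OF j(1)] E_closed[OF j(1)]] by simp
  then have "c \<cdot>\<^sub>m 1\<^sub>m n = c \<cdot>\<^sub>m (c \<cdot>\<^sub>m (1\<^sub>m n :: 'k mat))"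
    unfolding c by (simp add: mult_smult_distrib[of _ n n _ n])
  then have "(c \<cdot>\<^sub>m 1\<^sub>m n) $$ (0, 0) = (c \<cdot>\<^sub>m (c \<cdot>\<^sub>m (1\<^sub>m n :: 'k mat))) $$ (0, 0)" by simp
  then have "c = c * c" using n_pos by simp
  moreover have "c \<noteq> 0"
  proof
    assume "c = 0"
    then have "\<rho> (jA (E j)) = 0\<^sub>m n n" unfolding c by (auto intro!: eq_matI)
    then show False using j by simp
  qed
  ultimately have "c = 1" by simp
  then have E1: "\<rho> (jA (E j)) = 1\<^sub>m n" unfolding c by (auto intro!: eq_matI)
  \<comment> \<open>Such a p_i is orthogonal to \<open>E j\<close>, which acts as the
    identity.\<close>
  have p0: "\<rho> (jA (prim_idem i)) = 0\<^sub>m n n" if i: "i \<in> {1..l}" "i \<notin> I j" for i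
  proof -
    have "\<rho> (jA (prim_idem i)) * \<rho> (jA (E j)) = 0\<^sub>m n n"
      using \<rho>_mult[OF p_closed[OF i(1)] E_closed[OF j(1)]] p_E0[OF i(2)] \<rho>_zero by simp
    then show ?thesis unfolding E1 using \<rho>C[OF p_closed[OF i(1)]] by simp
  qed
  have Ij: "I j \<subseteq> {1..l}" "finite (I j)" using cover j(1) finite_subset[of "I j" "{1..l}"] by auto
  have "I j \<noteq> {}"
  proof
    assume "I j = {}"
    then have "E j = \<zero>\<^bsub>field_power l\<^esub>" by (simp add: E_def field_power_simps)
    then show False using j(2) \<rho>_zero by simp
  qed
  then obtain x where x: "x \<in> I j" by blast
  then have xl: "x \<in> {1..l}" using Ij by blast
  define P where "P = \<rho> (jA (prim_idem x))"
  define Q where "Q = \<rho> (jB (prim_idem 1))"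
  have P: "P \<in> carrier_mat n n" unfolding P_def by (rule \<rho>C[OF p_closed[OF xl]])
  have jBC: "jB (prim_idem 1) \<in> carrier \<Q>" using jB_props q_closed by blast
  have Q: "Q \<in> carrier_mat n n" unfolding Q_def using \<rho>_props jBC by blast
  have "prim_idem x \<otimes>\<^bsub>field_power l\<^esub> prim_idem x = (prim_idem x :: nat \<Rightarrow> 'k)"
    by (auto simp: field_power_simps prim_idem_def)
  then have PP: "P * P = P"
    using \<rho>_mult[OF p_closed[OF xl] p_closed[OF xl]] by (simp add: P_def)
  have "prim_idem 1 \<otimes>\<^bsub>field_power 2\<^esub> prim_idem 1 = (prim_idem 1 :: nat \<Rightarrow> 'k)"
    by (auto simp: field_power_simps prim_idem_def)
  then have "jB (prim_idem 1) \<otimes>\<^bsub>\<Q>\<^esub> jB (prim_idem 1) = jB (prim_idem 1)"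
    using jB_props q_closed by metis
  then have QQ: "Q * Q = Q" unfolding Q_def using \<rho>_props jBC by metis
  have "irreducible_mats n {P, Q}"
    unfolding irreducible_mats_def
  proof (intro allI impI, elim conjE)
    fix W :: "'k vec set" assume sub: "lin_subspace (module_vec TYPE('k) n) W"
      and inv: "\<forall>M\<in>{P, Q}. \<forall>w\<in>W. M *\<^sub>v w \<in> W"
    note W = sub[unfolded vec_lin_subspace_iff]
    have "M *\<^sub>v w \<in> W" if "M \<in> \<rho> ` gens" and w: "w \<in> W" for M w
    proof -
      have wC: "w \<in> carrier_vec n" using w W by blast
      consider "M = Q" | i where "i \<in> {1..l}" "M = \<rho> (jA (prim_idem i))"
        using \<open>M \<in> \<rho> ` gens\<close> unfolding Q_def by blast
      then show ?thesis
      proof cases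
        case 1
        then show ?thesis using inv w by blast
      next
        case 2
        consider "i \<notin> I j" | "i = x" | "i \<in> I j" "i \<noteq> x" by blast
        then show ?thesis
        proof cases
          case 1
          then have "M *\<^sub>v w = 0\<^sub>v n" using p0[OF 2(1)] 2(2) wC by (auto intro!: eq_vecI)
          then show ?thesis using W by simp
        next
          case 2
          then show ?thesis using inv w \<open>M = \<rho> (jA (prim_idem i))\<close> by (simp add: P_def)
        next
          case 3
          \<comment> \<open>A class with at most two elements is {x, i} here, so p_i acts as 1 - P
            and preserves whatever P preserves.\<close>
          have "card {x, i} = card (I j)"
            using 3 x card[OF j(1)] card_mono[OF Ij(2), of "{x, i}"] by simp
          then have "I j = {x, i}" using 3 x Ij(2) by (intro card_subset_eq[symmetric]) auto
          then have "E j = prim_idem x \<oplus>\<^bsub>field_power l\<^esub> prim_idem i"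
            using 3(2) by (auto simp: E_def field_power_simps prim_idem_def)
          then have "1\<^sub>m n = P + M"
            using \<rho>_add[OF p_closed[OF xl] p_closed[OF 2(1)]] E1 2(2) by (simp add: P_def)
          moreover have M: "M \<in> carrier_mat n n" using 2 \<rho>C p_closed by simp
          ultimately have "w = P *\<^sub>v w + M *\<^sub>v w"
            using P wC by (metis add_mult_distrib_mat_vec one_mult_mat_vec)
          then have "M *\<^sub>v w = w + (- 1) \<cdot>\<^sub>v (P *\<^sub>v w)"
            using P M wC by (intro eq_vecI) (auto simp: vec_eq_iff)
          then show ?thesis using W w inv by auto
        qed
      qed
    qed
    then have "lin_subspace (module_vec TYPE('k) n) W \<and> (\<forall>M\<in>\<rho> ` gens. \<forall>w\<in>W. M *\<^sub>v w \<in> W)"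
      by (intro conjI sub ballI)
    then show "W = {0\<^sub>v n} \<or> W = carrier_vec n"
      by (rule mp[OF spec[OF irreducible_gens[unfolded irreducible_mats_def]]])
  qed
  then show ?thesis using n_pos P Q PP QQ by (rule irreducible_two_idempotents)
qed

end

text \<open>An element a of k^l acts diagonally, by the scalar \<open>a (blk r)\<close> on the r-th
  basis vector, and q_1 acts as \<open>Q\<close>. By \<open>const\<close>, A(V) acts through
  scalars, so the required commutation puts no condition on \<open>Q\<close>.\<close>

lemma irreducible_rep_exists:
  fixes Q :: "'k mat"
  assumes n: "n > 0" and blk: "\<And>r. r < n \<Longrightarrow> blk r \<in> {1..l}"
    and Q: "Q \<in> carrier_mat n n" "Q * Q = Q"
    and const: "\<And>a r r'. a \<in> AV \<Longrightarrow> r < n \<Longrightarrow> r' < n \<Longrightarrow> a (blk r) = a (blk r')"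
    and irr: "irreducible_mats n (insert Q ((\<lambda>i. mat_diag n (\<lambda>r. if blk r = i then 1 else 0)) ` {1..l}))"
  shows "\<exists>\<rho>. irreducible_rep \<Q> n \<rho>"
proof -
  define \<alpha> where "\<alpha> a = mat_diag n (\<lambda>r. a (blk r) :: 'k)" for a
  have \<alpha>: "\<alpha> \<in> alg_hom (field_power l) (mat_algebra n)"
    unfolding alg_hom_iff
  proof (intro conjI ballI allI)
    fix x y :: "nat \<Rightarrow> 'k"
    show "\<alpha> (x \<otimes>\<^bsub>field_power l\<^esub> y) = \<alpha> x \<otimes>\<^bsub>mat_algebra n\<^esub> \<alpha> y"
      by (simp add: \<alpha>_def field_power_simps mat_algebra_simps)
  qed (use blk in \<open>auto simp: \<alpha>_def field_power_simps mat_algebra_simps mat_diag_def intro!: eq_matI\<close>)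
  define \<beta> where "\<beta> b = b 2 \<odot>\<^bsub>mat_algebra n\<^esub> \<one>\<^bsub>mat_algebra n\<^esub> \<oplus>\<^bsub>mat_algebra n\<^esub> (b 1 - b 2) \<odot>\<^bsub>mat_algebra n\<^esub> Q" for b :: "nat \<Rightarrow> 'k"
  have \<beta>: "\<beta> \<in> alg_hom (field_power 2) (mat_algebra n)"
    unfolding \<beta>_def[abs_def] using Q
    by (intro idempotent_hom mat_algebra_unital_algebra) (auto simp: mat_algebra_simps)
  have \<beta>q: "\<beta> (prim_idem 1) = Q"
    using Q by (auto simp: \<beta>_def mat_algebra_simps prim_idem_def intro!: eq_matI)
  have "\<alpha> a \<otimes>\<^bsub>mat_algebra n\<^esub> \<beta> (prim_idem 1) = \<beta> (prim_idem 1) \<otimes>\<^bsub>mat_algebra n\<^esub> \<alpha> a" if "a \<in> AV" for a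
  proof -
    \<comment> \<open>The labels are interchangeable for elements of A(V); position 0 exists because
      n > 0.\<close>
    have "\<alpha> a = a (blk 0) \<cdot>\<^sub>m 1\<^sub>m n"
    proof (rule eq_matI)
      fix i j assume "i < dim_row (a (blk 0) \<cdot>\<^sub>m 1\<^sub>m n)" "j < dim_col (a (blk 0) \<cdot>\<^sub>m 1\<^sub>m n)"
      then have "i < n" "j < n" by auto
      then show "\<alpha> a $$ (i, j) = (a (blk 0) \<cdot>\<^sub>m 1\<^sub>m n) $$ (i, j)"
        using const[OF that _ n, of j] by (simp add: \<alpha>_def mat_diag_def)
    qed (auto simp: \<alpha>_def mat_diag_def)
    then show ?thesis
      unfolding \<beta>q mat_algebra_simps
      using Q(1) by (simp add: mult_smult_distrib[of _ n n _ n] mult_smult_assoc_mat[of _ n n _ n])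
  qed
  then obtain \<rho> where \<rho>: "\<rho> \<in> alg_hom \<Q> (mat_algebra n)"
    "\<And>a. a \<in> carrier (field_power l) \<Longrightarrow> \<rho> (jA a) = \<alpha> a" "\<And>b. b \<in> carrier (field_power 2) \<Longrightarrow> \<rho> (jB b) = \<beta> b"
    using partial_ab_lift[OF mat_algebra_unital_algebra \<alpha> \<beta>] by blast
  have "insert Q ((\<lambda>i. mat_diag n (\<lambda>r. if blk r = i then 1 else 0)) ` {1..l}) = \<rho> ` gens"
  proof -
    have "\<rho> (jA (prim_idem i)) = mat_diag n (\<lambda>r. if blk r = i then 1 else 0)" if "i \<in> {1..l}" for i
      using \<rho>(2)[OF prim_idem_closed[OF that]] by (simp add: \<alpha>_def prim_idem_def)
    moreover have "\<rho> (jB (prim_idem 1)) = Q" using \<rho>(3)[OF q_closed] \<beta>q by simp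
    ultimately show ?thesis by (simp add: image_image)
  qed
  with irr have "irreducible_mats n (\<rho> ` gens)" by (simp only:)
  then have "irreducible_mats n (\<rho> ` carrier \<Q>)"
    by (rule irreducible_mats_mono) (rule image_mono[OF gens_closed])
  then show ?thesis using n \<rho>(1) by (auto simp: irreducible_rep_iff)
qed

end

text \<open>Being constant on each class is a linear condition and holds for the indicator functions
  that span \<open>S\<close>. It makes A(V) act by scalars when all labels come from one
  class.\<close>

lemma determines_partition_constant:
  assumes I: "determines_partition n S s I" and a: "a \<in> S"
    and "j \<in> {1..s}" "x \<in> I j" "y \<in> I j"
  shows "a x = (a y :: 'k::field)"
proof -
  interpret unital_algebra "field_power n :: ('k, nat \<Rightarrow> 'k) module" by (rule field_power_unital_algebra)
  let ?W = "{a \<in> carrier (field_power n). \<forall>j\<in>{1..s}. \<forall>x\<in>I j. \<forall>y\<in>I j. a x = (a y :: 'k)}"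
  have sub: "I j \<subseteq> {1..n}" if "j \<in> {1..s}" for j
    using I that unfolding determines_partition_def by blast
  have disj: "x \<in> I j \<longleftrightarrow> y \<in> I j" if "j \<in> {1..s}" "i \<in> {1..s}" "x \<in> I i" "y \<in> I i" for i j x y
  proof -
    have "disjoint_family_on I {1..s}" using I unfolding determines_partition_def by blast
    then have "i \<noteq> j \<Longrightarrow> I i \<inter> I j = {}" using that unfolding disjoint_family_on_def by blast
    then show ?thesis using that by (cases "i = j") auto
  qed
  have "lin_span (field_power n) {\<Oplus>\<^bsub>field_power n\<^esub>i\<in>I j. prim_idem i | j. j \<in> {1..s}} \<subseteq> ?W"
  proof (rule lin_span_least)
    have add: "f \<oplus>\<^bsub>field_power n\<^esub> g \<in> ?W" if "f \<in> ?W" "g \<in> ?W" for f g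
    proof -
      have "(f \<oplus>\<^bsub>field_power n\<^esub> g) x = (f \<oplus>\<^bsub>field_power n\<^esub> g) y"
        if "j \<in> {1..s}" "x \<in> I j" "y \<in> I j" for j x y
        using that \<open>f \<in> ?W\<close> \<open>g \<in> ?W\<close> unfolding field_power_simps(5) by (metis (mono_tags, lifting) mem_Collect_eq)
      then show ?thesis using that by blast
    qed
    have smult: "c \<odot>\<^bsub>field_power n\<^esub> f \<in> ?W" if "f \<in> ?W" for c f
    proof -
      have "(c \<odot>\<^bsub>field_power n\<^esub> f) x = (c \<odot>\<^bsub>field_power n\<^esub> f) y"
        if "j \<in> {1..s}" "x \<in> I j" "y \<in> I j" for j x y
        using that \<open>f \<in> ?W\<close> unfolding field_power_simps(6) by (metis (mono_tags, lifting) mem_Collect_eq)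
      then show ?thesis using that by blast
    qed
    show "lin_subspace (field_power n) ?W"
      unfolding lin_subspace_iff
    proof (intro conjI ballI allI add smult)
      show "\<zero>\<^bsub>field_power n\<^esub> \<in> ?W" using zero_closed by (simp add: field_power_simps(4))
    qed (blast, assumption+)
    show "{\<Oplus>\<^bsub>field_power n\<^esub>i\<in>I j. prim_idem i | j. j \<in> {1..s}} \<subseteq> ?W"
    proof (rule subsetI)
      fix f :: "nat \<Rightarrow> 'k" assume "f \<in> {\<Oplus>\<^bsub>field_power n\<^esub>i\<in>I j. prim_idem i | j. j \<in> {1..s}}"
      then obtain j where j: "j \<in> {1..s}" and f: "f = (\<Oplus>\<^bsub>field_power n\<^esub>i\<in>I j. prim_idem i)" by blast
      have f': "f = (\<lambda>i. if i \<in> I j then 1 else 0)" unfolding f by (rule finsum_prim_idem[OF sub[OF j]])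
      have "f \<in> carrier (field_power n)" using sub[OF j] by (auto simp: f' field_power_simps)
      moreover have "f x = f y" if "i \<in> {1..s}" "x \<in> I i" "y \<in> I i" for i x y
        using disj[OF j that] by (simp add: f')
      ultimately show "f \<in> ?W" by blast
    qed
  qed
  moreover have "S = lin_span (field_power n) {\<Oplus>\<^bsub>field_power n\<^esub>i\<in>I j. prim_idem i | j. j \<in> {1..s}}"
    using I unfolding determines_partition_def by blast
  ultimately show ?thesis using assms(2-) by blast
qed

text \<open>Provides the P_j as elements of A(V) in pointwise form; they are the central idempotents
  of the bound for classes of size at most two.\<close>

lemma determines_partition_indicator:
  assumes I: "determines_partition n S s I" and j: "j \<in> {1..s}"
  shows "(\<lambda>i. if i \<in> I j then 1 else (0::'k::field)) \<in> S"
proof -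
  have "I j \<subseteq> {1..n}" using I j unfolding determines_partition_def by blast
  then have "(\<lambda>i. if i \<in> I j then 1 else (0::'k)) = (\<Oplus>\<^bsub>field_power n\<^esub>i\<in>I j. prim_idem i)"
    by (rule finsum_prim_idem[symmetric])
  moreover have "S = lin_span (field_power n) {\<Oplus>\<^bsub>field_power n\<^esub>i\<in>I j. prim_idem i | j. j \<in> {1..s}}"
    using I unfolding determines_partition_def by blast
  moreover have "(\<Oplus>\<^bsub>field_power n\<^esub>i\<in>I j. prim_idem i :: nat \<Rightarrow> 'k) \<in>
      {\<Oplus>\<^bsub>field_power n\<^esub>i\<in>I j. prim_idem i | j. j \<in> {1..s}}" using j by blast
  ultimately show ?thesis using lin_span_superset by fastforce
qed

lemma partial_abelianization_field_power:
  fixes l :: nat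
    and V :: "(((nat \<Rightarrow> 'k) + (nat \<Rightarrow> 'k)) list \<Rightarrow>\<^sub>0 'k::field) set set"
  defines "A \<equiv> field_power l :: ('k, nat \<Rightarrow> 'k) module" and "B \<equiv> field_power 2 :: ('k, nat \<Rightarrow> 'k) module"
  assumes Abar: "Abar = lin_span A (prim_idem ` {1..l - 1})"
    and V: "lin_subspace (free_product A B) V"
    and V_subset: "V \<subseteq> {free_product_inl A B a \<oplus>\<^bsub>free_product A B\<^esub> free_product_inr A B b | a b.
      a \<in> Abar \<and> b \<in> lin_span B {prim_idem 1}}"
  shows "partial_abelianization A B Abar (prim_idem 1) V"
proof -
  interpret unital_algebra_pair A B
    unfolding A_def B_def by (intro unital_algebra_pair.intro field_power_unital_algebra)
  have q: "prim_idem 1 \<in> carrier B" unfolding B_def by (rule prim_idem_closed) simp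
  \<comment> \<open>A span is an intersection of subspaces, so it is bounded from above by showing
    that the multiples of q_1 form one.\<close>
  have "lin_subspace B {c \<odot>\<^bsub>B\<^esub> prim_idem 1 | c. True}"
    unfolding B.lin_subspace_iff
  proof (intro conjI ballI allI subsetI)
    have "\<zero>\<^bsub>B\<^esub> = 0 \<odot>\<^bsub>B\<^esub> prim_idem 1" using q by simp
    then show "\<zero>\<^bsub>B\<^esub> \<in> {c \<odot>\<^bsub>B\<^esub> prim_idem 1 | c. True}" by blast
  next
    fix x y assume "x \<in> {c \<odot>\<^bsub>B\<^esub> prim_idem 1 | c. True}" "y \<in> {c \<odot>\<^bsub>B\<^esub> prim_idem 1 | c. True}"
    then obtain c d where "x = c \<odot>\<^bsub>B\<^esub> prim_idem 1" "y = d \<odot>\<^bsub>B\<^esub> prim_idem 1" by blast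
    then have "x \<oplus>\<^bsub>B\<^esub> y = (c + d) \<odot>\<^bsub>B\<^esub> prim_idem 1" using B.smult_l_distr[OF q] by simp
    then show "x \<oplus>\<^bsub>B\<^esub> y \<in> {c \<odot>\<^bsub>B\<^esub> prim_idem 1 | c. True}" by blast
  next
    fix c x assume "x \<in> {c \<odot>\<^bsub>B\<^esub> prim_idem 1 | c. True}"
    then obtain d where "x = d \<odot>\<^bsub>B\<^esub> prim_idem 1" by blast
    then have "c \<odot>\<^bsub>B\<^esub> x = (c * d) \<odot>\<^bsub>B\<^esub> prim_idem 1" using B.smult_assoc[OF q] by simp
    then show "c \<odot>\<^bsub>B\<^esub> x \<in> {c \<odot>\<^bsub>B\<^esub> prim_idem 1 | c. True}" by blast
  qed (use q in auto)
  moreover have "{prim_idem 1} \<subseteq> {c \<odot>\<^bsub>B\<^esub> prim_idem 1 | c. True}"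
    using B.smult_one[OF q, symmetric] by blast
  ultimately have Bbar: "lin_span B {prim_idem 1} \<subseteq> {c \<odot>\<^bsub>B\<^esub> prim_idem 1 | c. True}"
    by (rule lin_span_least)
  show ?thesis
  proof (intro partial_abelianization.intro partial_abelianization_axioms.intro unital_algebra_pair_axioms q V)
    show "a \<otimes>\<^bsub>A\<^esub> a' = a' \<otimes>\<^bsub>A\<^esub> a" for a a' by (simp add: A_def field_power_simps mult.commute)
    show "\<exists>c d. b = c \<odot>\<^bsub>B\<^esub> prim_idem 1 \<oplus>\<^bsub>B\<^esub> d \<odot>\<^bsub>B\<^esub> \<one>\<^bsub>B\<^esub>" if "b \<in> carrier B" for b
    proof (intro exI)
      \<comment> \<open>The second entry is taken as a multiple of 1, and q_1 corrects the
        first.\<close>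
      show "b = (b 1 - b 2) \<odot>\<^bsub>B\<^esub> prim_idem 1 \<oplus>\<^bsub>B\<^esub> b 2 \<odot>\<^bsub>B\<^esub> \<one>\<^bsub>B\<^esub>"
      proof
        fix i :: nat
        consider "i = 1" | "i = 2" | "i \<notin> {1..2}" by fastforce
        then show "b i = ((b 1 - b 2) \<odot>\<^bsub>B\<^esub> prim_idem 1 \<oplus>\<^bsub>B\<^esub> b 2 \<odot>\<^bsub>B\<^esub> \<one>\<^bsub>B\<^esub>) i"
          using that by cases (auto simp: B_def field_power_simps prim_idem_def)
      qed
    qed
    show "lin_subspace A Abar"
      unfolding Abar by (intro A.lin_span_subspace) (auto simp: A_def intro!: prim_idem_closed)
    fix v assume "v \<in> V"
    then obtain a b where "a \<in> Abar" and v: "v = free_product_inl A B a \<oplus>\<^bsub>free_product A B\<^esub> free_product_inr A B b"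
      and "b \<in> lin_span B {prim_idem 1}" using V_subset by blast
    then obtain c where "b = c \<odot>\<^bsub>B\<^esub> prim_idem 1" using Bbar by blast
    then have "free_product_inr A B b = c \<odot>\<^bsub>free_product A B\<^esub> free_product_inr A B (prim_idem 1)"
      using free_product_inr_hom q unfolding alg_hom_iff by blast
    then show "\<exists>a\<in>Abar. \<exists>c. v = free_product_inl A B a \<oplus>\<^bsub>free_product A B\<^esub>
      c \<odot>\<^bsub>free_product A B\<^esub> free_product_inr A B (prim_idem 1)"
      using \<open>a \<in> Abar\<close> v by (intro bexI[of _ a] exI[of _ c]) simp_all
  qed
qed

theorem proposition9:
  fixes l s :: nat
    and A B :: "('k::{alg_closed_field, field_char_0}, nat \<Rightarrow> 'k) module"
    and R :: "('k, (((nat \<Rightarrow> 'k) + (nat \<Rightarrow> 'k)) list \<Rightarrow>\<^sub>0 'k) set) module"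
    and Abar Bbar AV :: "(nat \<Rightarrow> 'k) set"
    and \<iota>\<^sub>A \<iota>\<^sub>B :: "(nat \<Rightarrow> 'k) \<Rightarrow> (((nat \<Rightarrow> 'k) + (nat \<Rightarrow> 'k)) list \<Rightarrow>\<^sub>0 'k) set"
    and V :: "(((nat \<Rightarrow> 'k) + (nat \<Rightarrow> 'k)) list \<Rightarrow>\<^sub>0 'k) set set"
    and I :: "nat \<Rightarrow> nat set"
  assumes l: "l > 0"
    and A: "A = field_power l"
    and B: "B = field_power 2"
    and R: "R = free_product A B"
    and \<iota>\<^sub>A: "\<iota>\<^sub>A = free_product_inl A B"
    and \<iota>\<^sub>B: "\<iota>\<^sub>B = free_product_inr A B"
    and Abar: "Abar = lin_span A (prim_idem ` {1..l - 1})"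
    and Bbar: "Bbar = lin_span B {prim_idem 1}"
    and V_subspace: "lin_subspace R V"
    and V_subset: "V \<subseteq> {\<iota>\<^sub>A a \<oplus>\<^bsub>R\<^esub> \<iota>\<^sub>B b | a b. a \<in> Abar \<and> b \<in> Bbar}"
    and AV: "AV = subalgebra_gen A {a \<in> Abar. \<iota>\<^sub>A a \<in> V}"
    and I: "determines_partition l AV s I"
  shows
    "(V \<subseteq> \<iota>\<^sub>A ` Abar \<longrightarrow>
        (\<lambda>x. commutator_ideal V R +>\<^bsub>R\<^esub> x) \<in> alg_iso R (partial_ab V R)) \<and>
     (\<not> V \<subseteq> \<iota>\<^sub>A ` Abar \<and> AV = carrier A \<longrightarrow>
        alg_iso (partial_ab V R) (tensor_algebra A B) \<noteq> {} \<and> mid (partial_ab V R) = 1) \<and>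
     (\<not> V \<subseteq> \<iota>\<^sub>A ` Abar \<and> Max ((\<lambda>j. card (I j)) ` {1..s}) = 2 \<longrightarrow>
        mid (partial_ab V R) = 2) \<and>
     (\<not> V \<subseteq> \<iota>\<^sub>A ` Abar \<and> Max ((\<lambda>j. card (I j)) ` {1..s}) > 2 \<longrightarrow>
        mid (partial_ab V R) = \<infinity>)"
proof -
  have "partial_abelianization (field_power l) (field_power 2) Abar (prim_idem 1) V"
    using Abar V_subspace V_subset unfolding Bbar A B R \<iota>\<^sub>A \<iota>\<^sub>B by (intro partial_abelianization_field_power)
  then interpret PA: partial_abelianization "field_power l" "field_power 2" Abar "prim_idem 1" V .
  have AV': "AV = PA.AV" unfolding AV PA.AV_def A B \<iota>\<^sub>A ..
  have cover: "(\<Union>j\<in>{1..s}. I j) = {1..l}" using I unfolding determines_partition_def by blast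
  have fin: "finite (I j)" if "j \<in> {1..s}" for j
    using cover that by (intro finite_subset[of "I j" "{1..l}"]) auto
  \<comment> \<open>Makes \<open>Max\<close> range over a nonempty set; s = 0 would leave {1..l}
    uncovered although l > 0.\<close>
  have "{1..s} \<noteq> {}"
  proof
    assume "{1..s} = {}"
    then have "{1..l} = {}" using cover by (simp only: UN_empty)
    then show False using l by simp
  qed
  let ?M = "Max ((\<lambda>j. card (I j)) ` {1..s})"
  have card_le: "card (I j) \<le> ?M" if "j \<in> {1..s}" for j using that by (intro Max_ge) auto
  have "?M \<in> (\<lambda>j. card (I j)) ` {1..s}" using \<open>{1..s} \<noteq> {}\<close> by (intro Max_in) auto
  \<comment> \<open>A class of maximal size. The representations of dimension above one take all
    their labels from it.\<close>
  then obtain j where j: "j \<in> {1..s}" and card_j: "card (I j) = ?M" by auto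
  have const: "a x = a y" if "a \<in> PA.AV" "x \<in> I j" "y \<in> I j" for a x y
    using determines_partition_constant[OF I _ j that(2,3)] that(1) by (simp add: AV')
  have Ij: "x \<in> {1..l}" if "x \<in> I j" for x using that j cover by blast
  show ?thesis
    unfolding A B R \<iota>\<^sub>A \<iota>\<^sub>B AV'
  proof (intro conjI impI; (elim conjE)?)
    assume "V \<subseteq> PA.\<iota> ` Abar"
    then show "PA.\<pi> \<in> alg_iso (free_product (field_power l) (field_power 2)) PA.\<Q>"
      by (rule PA.partial_ab_trivial)
  next
    assume V: "\<not> V \<subseteq> PA.\<iota> ` Abar" and full: "PA.AV = carrier (field_power l)"
    show "alg_iso PA.\<Q> (tensor_algebra (field_power l) (field_power 2)) \<noteq> {}"
      using V full by (rule PA.partial_ab_tensor)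
  next
    assume V: "\<not> V \<subseteq> PA.\<iota> ` Abar" and full: "PA.AV = carrier (field_power l)"
    interpret F: field_power_abelianization l Abar V by unfold_locales (rule V)
    have "mid PA.\<Q> \<le> enat 1" using F.dim_le_one full by (intro mid_le) blast
    \<comment> \<open>The representation reading off the first coordinate of A, with q_1 acting as
      1; l > 0 makes the label 1 available.\<close>
    moreover have "\<exists>\<rho>. irreducible_rep PA.\<Q> 1 \<rho>"
      using l by (intro F.irreducible_rep_exists[of 1 "\<lambda>_. 1" "1\<^sub>m 1"] irreducible_mats_one) auto
    then have "enat 1 \<le> mid PA.\<Q>" using mid_ge by blast
    ultimately show "mid PA.\<Q> = 1" by (simp add: one_enat_def)
  next
    assume V: "\<not> V \<subseteq> PA.\<iota> ` Abar" and two: "?M = 2"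
    interpret F: field_power_abelianization l Abar V by unfold_locales (rule V)
    have card_two: "card (I i) \<le> 2" if "i \<in> {1..s}" for i using card_le[OF that] two by simp
    have indicator: "(\<lambda>x. if x \<in> I i then 1 else 0) \<in> PA.AV" if "i \<in> {1..s}" for i
      using determines_partition_indicator[OF I that] by (simp add: AV')
    have "n \<le> 2" if "irreducible_rep PA.\<Q> n \<rho>" for n \<rho>
      using that indicator cover card_two by (rule F.dim_le_two)
    then have "mid PA.\<Q> \<le> enat 2" by (rule mid_le)
    moreover have "\<exists>\<rho>. irreducible_rep PA.\<Q> 2 \<rho>"
    proof -
      obtain a b where ab: "I j = {a, b}" "a \<noteq> b" using card_j two by (auto simp: card_2_iff)
      \<comment> \<open>The two basis vectors are labelled by the two elements of the class, so p_a
        and p_b act as the coordinate projections.\<close>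
      let ?blk = "\<lambda>r::nat. if r = 0 then a else b"
      show ?thesis
      proof (rule F.irreducible_rep_exists[of 2 ?blk idem2])
        show "irreducible_mats 2 (insert idem2 ((\<lambda>i. mat_diag 2 (\<lambda>r. if ?blk r = i then 1 else (0::'k))) ` {1..l}))"
        proof (rule irreducible_mats_mono[OF irreducible_idem2])
          have "mat_diag 2 (\<lambda>r. if r = 0 then 1 else (0::'k)) = mat_diag 2 (\<lambda>r. if ?blk r = a then 1 else 0)"
            "mat_diag 2 (\<lambda>r. if r = 1 then 1 else (0::'k)) = mat_diag 2 (\<lambda>r. if ?blk r = b then 1 else 0)"
            using ab(2) by (auto simp: mat_diag_def intro!: eq_matI)
          then show "{mat_diag 2 (\<lambda>r. if r = 0 then 1 else 0), mat_diag 2 (\<lambda>r. if r = 1 then 1 else 0), idem2 :: 'k mat}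
            \<subseteq> insert idem2 ((\<lambda>i. mat_diag 2 (\<lambda>r. if ?blk r = i then 1 else 0)) ` {1..l})"
            using Ij[of a] Ij[of b] ab(1) by blast
        qed
        show "c (?blk r) = c (?blk r')" if "c \<in> PA.AV" for c r r'
          using const[OF that] ab(1) by (metis insertCI)
        show "?blk r \<in> {1..l}" for r using Ij ab(1) by auto
      qed (simp_all add: idem2_closed idem2_idem)
    qed
    then have "enat 2 \<le> mid PA.\<Q>" using mid_ge by blast
    ultimately show "mid PA.\<Q> = 2" by (metis antisym numeral_eq_enat)
  next
    assume V: "\<not> V \<subseteq> PA.\<iota> ` Abar" and three: "?M > 2"
    interpret F: field_power_abelianization l Abar V by unfold_locales (rule V)
    obtain J where "J \<subseteq> I j" "card J = 3"
      using obtain_subset_with_card_n[of 3 "I j"] card_j three by auto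
    then obtain a b c where abc: "a \<in> I j" "b \<in> I j" "c \<in> I j" "a \<noteq> b" "a \<noteq> c" "b \<noteq> c"
      by (auto simp: card_3_iff)
    \<comment> \<open>Three distinct elements of the class label the three blocks of size m, so the
      corresponding p_i act as the block projections.\<close>
    define f where "f i = (if i = 0 then a else if i = 1 then b else c)" for i :: nat
    have f: "f i \<in> I j" for i using abc by (simp add: f_def)
    have f_inj: "f i = f i' \<longleftrightarrow> i = i'" if "i < 3" "i' < 3" for i i'
      using that abc by (auto simp: f_def)
    have "enat (3 * m) \<le> mid PA.\<Q>" if m: "m > 0" for m
    proof -
      have "\<exists>\<rho>. irreducible_rep PA.\<Q> (3 * m) \<rho>"
      proof (rule F.irreducible_rep_exists[of "3 * m" "\<lambda>r. f (r div m)" "idem3 m"])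
        show "irreducible_mats (3 * m) (insert (idem3 m)
            ((\<lambda>i. mat_diag (3 * m) (\<lambda>r. if f (r div m) = i then 1 else (0::'k))) ` {1..l}))"
        proof (rule irreducible_mats_mono[OF irreducible_idem3[OF m]])
          have "mat_diag (3 * m) (\<lambda>r. if r div m = i then 1 else (0::'k)) =
              mat_diag (3 * m) (\<lambda>r. if f (r div m) = f i then 1 else 0)" if "i < 3" for i
          proof -
            have "f (r div m) = f i \<longleftrightarrow> r div m = i" if "r < 3 * m" for r
              using that \<open>i < 3\<close> by (intro f_inj) (auto simp: less_mult_imp_div_less)
            then show ?thesis by (auto simp: mat_diag_def intro!: eq_matI)
          qed
          then show "insert (idem3 m) ((\<lambda>i. mat_diag (3 * m) (\<lambda>r. if r div m = i then 1 else (0::'k))) ` {..<3})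
            \<subseteq> insert (idem3 m) ((\<lambda>i. mat_diag (3 * m) (\<lambda>r. if f (r div m) = i then 1 else 0)) ` {1..l})"
            using Ij[OF f] by auto
        qed
        show "d (f (r div m)) = d (f (r' div m))" if "d \<in> PA.AV" for d r r'
          using const[OF that f f] .
        show "f (r div m) \<in> {1..l}" for r using Ij[OF f] .
      qed (use m in \<open>simp_all add: idem3_closed idem3_idem\<close>)
      then show ?thesis using mid_ge by blast
    qed
    note large = this
    show "mid PA.\<Q> = \<infinity>"
    proof (cases "mid PA.\<Q>")
      case (enat d)
      \<comment> \<open>A finite value d is exceeded by the dimension 3 (d + 1).\<close>
      then show ?thesis using large[of "Suc d"] by simp
    qed simp
  qed
qed

end
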